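(* Let $U,V\subset\mathbb R^n$ be open bounded and let $c\in C^4(\overline U\times\overline V)$ satisfy (B1), (B2), (B3). Let $\lambda,\Lambda>0$, let $U^\lambda\subset U$ be open, and let $u$ be a $c$-convex function on $\overline U$ with $\lambda\le|\partial^cu|\le1/\lambda$ on $U^\lambda$ and $|\partial^cu|\le\Lambda$ on $\overline U$. Fix $\tilde x\in U^\lambda$ and $\tilde y\in\partial^cu(\tilde x)$, and let $S:=\{x\in\overline U: u(x)=u(\tilde x)-c(x,\tilde y)+c(\tilde x,\tilde y)\}$. If $S\ne\{\tilde x\}$, then $S$ intersects $\partial U$.
   Context: (B1): for all $\tilde x\in\overline U,\tilde y\in\overline V$ the maps $x\mapsto-D_yc(x,\tilde y)$ on $\overline U$ and $y\mapsto-D_xc(\tilde x,y)$ on $\overline V$ are diffeomorphisms onto their ranges. (B2): $-D_yc(U,\tilde y)$ and $-D_xc(\tilde x,V)$ are convex. (B3): for all curves with $t\in[-1,1]\mapsto(D_yc(x(t),y(0)),D_xc(x(0),y(t)))$ an affinely parametrized segment, $-\partial_s^2\partial_t^2c(x(s),y(t))|_{s=t=0}\ge0$. $u$ is $c$-convex if $u=(u^{c^*})^c$, with $u^{c^*}(y)=\sup_{x\in\overline U}(-c(x,y)-u(x))$, $v^c(x)=\sup_{y\in\overline V}(-c(x,y)-v(y))$. $\partial^cu=\{(x,y)\in\overline U\times\overline V:u(x)+u^{c^*}(y)+c(x,y)=0\}$, $\partial^cu(X)=\{y:\exists x\in X,(x,y)\in\partial^cu\}$, $|\partial^cu|(X)=\mathcal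 L^n(\partial^cu(X))$; "$a\le|\partial^cu|\le b$ on $W$" means $a\mathcal L^n(X)\le|\partial^cu|(X)\le b\mathcal L^n(X)$ for all Borel $X\subset W$. *)

theory Defs
  imports "HOL-Analysis.Analysis"
begin

text \<open>C^k on a set S (intended: S open): f is differentiable at every point of S and
  all partial derivatives (along the standard basis) are C^(k-1); C^0 = continuous.\<close>
fun Ck_on :: "nat \<Rightarrow> 'a::euclidean_space set \<Rightarrow> ('a \<Rightarrow> 'b::real_normed_vector) \<Rightarrow> bool" where
  "Ck_on 0 S f = continuous_on S f"
| "Ck_on (Suc k) S f =
     ((\<forall>x\<in>S. f differentiable (at x)) \<and>
      (\<forall>v\<in>Basis. Ck_on k S (\<lambda>x. frechet_derivative f (at x) v)))"

definition Ck_near :: "nat \<Rightarrow> 'a::euclidean_space set \<Rightarrow> ('a \<Rightarrow> 'b::real_normed_vector) \<Rightarrow> bool" where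
  "Ck_near k K f \<longleftrightarrow> (\<exists>W. open W \<and> K \<subseteq> W \<and> Ck_on k W f)"

definition gradx :: "(real^'n \<Rightarrow> real^'n \<Rightarrow> real) \<Rightarrow> real^'n \<Rightarrow> real^'n \<Rightarrow> real^'n" where
  "gradx c x y = (\<chi> i. frechet_derivative (\<lambda>x'. c x' y) (at x) (axis i 1))"

definition grady :: "(real^'n \<Rightarrow> real^'n \<Rightarrow> real) \<Rightarrow> real^'n \<Rightarrow> real^'n \<Rightarrow> real^'n" where
  "grady c x y = (\<chi> i. frechet_derivative (\<lambda>y'. c x y') (at y) (axis i 1))"

definition diffeo_onto_range :: "'a::euclidean_space set \<Rightarrow> ('a \<Rightarrow> 'a) \<Rightarrow> bool" where
  "diffeo_onto_range S f \<longleftrightarrow> inj_on f S \<and> Ck_near 1 S f \<and>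
     (\<exists>g. Ck_near 1 (f ` S) g \<and> (\<forall>x\<in>S. g (f x) = x))"

definition B1 :: "(real^'n) set \<Rightarrow> (real^'n) set \<Rightarrow> (real^'n \<Rightarrow> real^'n \<Rightarrow> real) \<Rightarrow> bool" where
  "B1 U V c \<longleftrightarrow>
     (\<forall>xt\<in>closure U. \<forall>yt\<in>closure V.
        diffeo_onto_range (closure U) (\<lambda>x. - grady c x yt) \<and>
        diffeo_onto_range (closure V) (\<lambda>y. - gradx c xt y))"

definition B2 :: "(real^'n) set \<Rightarrow> (real^'n) set \<Rightarrow> (real^'n \<Rightarrow> real^'n \<Rightarrow> real) \<Rightarrow> bool" where
  "B2 U V c \<longleftrightarrow>
     (\<forall>xt\<in>closure U. \<forall>yt\<in>closure V.
        convex ((\<lambda>x. - grady c x yt) ` U) \<and> convex ((\<lambda>y. - gradx c xt y) ` V))"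

definition B3 :: "(real^'n) set \<Rightarrow> (real^'n) set \<Rightarrow> (real^'n \<Rightarrow> real^'n \<Rightarrow> real) \<Rightarrow> bool" where
  "B3 U V c \<longleftrightarrow>
     (\<forall>(x::real \<Rightarrow> real^'n) (y::real \<Rightarrow> real^'n).
        (\<forall>t\<in>{-1..1}. x t \<in> closure U \<and> y t \<in> closure V) \<and>
        (\<exists>p q. \<forall>t\<in>{-1..1}. grady c (x t) (y 0) = p + t *\<^sub>R q) \<and>
        (\<exists>p q. \<forall>t\<in>{-1..1}. gradx c (x 0) (y t) = p + t *\<^sub>R q)
        \<longrightarrow> - deriv (deriv (\<lambda>s. deriv (deriv (\<lambda>t. c (x s) (y t))) 0)) 0 \<ge> 0)"

text \<open>c-transforms (extended-real valued, so that no finiteness is presupposed).\<close>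
definition cstar :: "(real^'n) set \<Rightarrow> (real^'n \<Rightarrow> real^'n \<Rightarrow> real) \<Rightarrow> (real^'n \<Rightarrow> real) \<Rightarrow> real^'n \<Rightarrow> ereal" where
  "cstar U c u y = (SUP x\<in>closure U. ereal (- c x y - u x))"

definition ctrans :: "(real^'n) set \<Rightarrow> (real^'n \<Rightarrow> real^'n \<Rightarrow> real) \<Rightarrow> (real^'n \<Rightarrow> ereal) \<Rightarrow> real^'n \<Rightarrow> ereal" where
  "ctrans V c v x = (SUP y\<in>closure V. ereal (- c x y) - v y)"

definition c_convex :: "(real^'n) set \<Rightarrow> (real^'n) set \<Rightarrow> (real^'n \<Rightarrow> real^'n \<Rightarrow> real) \<Rightarrow> (real^'n \<Rightarrow> real) \<Rightarrow> bool" where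
  "c_convex U V c u \<longleftrightarrow> (\<forall>x\<in>closure U. ereal (u x) = ctrans V c (cstar U c u) x)"

definition csubdiff :: "(real^'n) set \<Rightarrow> (real^'n) set \<Rightarrow> (real^'n \<Rightarrow> real^'n \<Rightarrow> real) \<Rightarrow> (real^'n \<Rightarrow> real) \<Rightarrow> ((real^'n) \<times> (real^'n)) set" where
  "csubdiff U V c u = {(x, y). x \<in> closure U \<and> y \<in> closure V \<and>
       ereal (u x) + cstar U c u y + ereal (c x y) = 0}"

definition csubdiff_img :: "(real^'n) set \<Rightarrow> (real^'n) set \<Rightarrow> (real^'n \<Rightarrow> real^'n \<Rightarrow> real) \<Rightarrow> (real^'n \<Rightarrow> real) \<Rightarrow> (real^'n) set \<Rightarrow> (real^'n) set" where
  "csubdiff_img U V c u X = {y. \<exists>x\<in>X. (x, y) \<in> csubdiff U V c u}"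

definition cMA :: "(real^'n) set \<Rightarrow> (real^'n) set \<Rightarrow> (real^'n \<Rightarrow> real^'n \<Rightarrow> real) \<Rightarrow> (real^'n \<Rightarrow> real) \<Rightarrow> (real^'n) set \<Rightarrow> ennreal" where
  "cMA U V c u X = emeasure lebesgue (csubdiff_img U V c u X)"

end

theory Submission
  imports Defs
begin

text \<open>Write $F = -c$. Because (B3) is imposed in all directions (nonnegative cross-curvature), in the
  coordinates $q = -D_yc(x,\tilde y)$ every function $b(q,y) = F(x(q),y) - F(x(q),\tilde y)$ is convex
  in $q$, so $v(q) = u(x(q)) + c(x(q),\tilde y) - \mbox{const}$ is a convex function whose zero set is the
  image of $S$; dually, $y \mapsto b(q,y) - b(q_0,y)$ is convex along c-segments with respect to $q_0$,
  which makes local supports global.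

  Suppose $S$ avoids $\partial U$ and contains a second point. Let $q_0$ be the point of $S$ farthest
  from $\tilde q$, at distance $R$ in direction $e_1$, and let $Z = \{v \le \epsilon\}$, a convex set shrinking
  to $S$. A greedy Gram-Schmidt frame $e_1, \ldots, e_n$ yields widths $w_i$ of $Z$ such that the volume of
  $Z$ is comparable to $\prod_{i\ge2} w_i$. The lower bound on the Monge-Ampere measure near $\tilde x$ gives
  $(\prod_{i\ge2} w_i)^2 \le C\epsilon^n$. The upper bound gives $\epsilon^n \le C d (\prod_{i\ge2} w_i)^2$,
  where $d$ bounds the extent of $Z$ beyond $q_0$ in direction $e_1$. Since $d \to 0$ as
  $\epsilon \to 0$, this is a contradiction.\<close>

text \<open>Both estimates are polar duality. Functions b(.,y) that rise by about \<epsilon> over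
  the sublevel set \<open>Z\<close> have gradients comparable with \<epsilon> times the polar body
  of \<open>Z\<close>, whose volume is \<epsilon>^n over the product of the widths of
  \<open>Z\<close>. Seen from a central point every width counts fully. Seen from \<open>q0\<close>
  the set ends within \<open>d\<close> in the direction \<open>e1\<close>, so the polar body is
  longer there by a factor 1/\<open>d\<close>, although \<open>Z\<close> reaches back by at least
  \<open>R\<close>. The obstacle is that b(.,y) is convex but not affine, so the gradient of one
  contact changes from point to point. Bounding gradients from above needs only tangent
  inequalities. Filling a body with gradients at the single point \<open>q0\<close> is harder: all
  maps \<open>P q\<close> are tangent to the identity at the base point, and the contacts used lie
  close to it, so each gradient is known up to an error relative to its own length. Dividing every
  row of a determinant by its length leaves a perturbed orthonormal frame, however eccentric
  \<open>Z\<close> is; hence no affine normalisation of \<open>Z\<close> is made. The constant of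
  the upper estimate does not involve \<open>d\<close>; only the range of \<epsilon> does.\<close>

section \<open>Lebesgue measure in Cartesian space over an arbitrary finite index type\<close>

text \<open>The change of variables theorems of the library need a well-ordered index type; the copy
  \<open>'n wo\<close> of the index type carries an arbitrary well-order.\<close>

typedef (overloaded) ('a::finite) wo = "UNIV :: 'a set"
  morphisms un_wo mk_wo by simp

lemma bij_un_wo: "bij un_wo"
  by (metis bijI' mk_wo_inverse un_wo_inject UNIV_I)

instance wo :: (finite) finite
proof
  show "finite (UNIV :: 'a wo set)"
    using bij_betw_finite[OF bij_un_wo] by simp
qed

definition wo_rank :: "'a::finite wo \<Rightarrow> nat"
  where "wo_rank = (SOME f. inj f)"

lemma inj_wo_rank: "inj (wo_rank :: 'a::finite wo \<Rightarrow> nat)"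
proof -
  have "\<exists>f :: 'a wo \<Rightarrow> nat. inj f"
    using finite_imp_inj_to_nat_seg[OF finite[of "UNIV :: 'a wo set"]] by fast
  then show ?thesis
    unfolding wo_rank_def by (rule someI_ex)
qed

instantiation wo :: (finite) wellorder
begin

definition "x \<le> y \<longleftrightarrow> wo_rank x \<le> wo_rank y"
definition "x < y \<longleftrightarrow> wo_rank x < wo_rank y"

instance
proof
  fix P :: "'a wo \<Rightarrow> bool" and a
  assume step: "\<And>x. (\<And>y. y < x \<Longrightarrow> P y) \<Longrightarrow> P x"
  show "P a"
    by (induction a rule: measure_induct[of wo_rank]) (metis step less_wo_def)
qed (auto simp: less_eq_wo_def less_wo_def dest: injD[OF inj_wo_rank])

end

definition to_wo :: "real^'n \<Rightarrow> real^('n wo)"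
  where "to_wo x = (\<chi> i. x $ un_wo i)"

definition of_wo :: "real^('n wo) \<Rightarrow> real^'n"
  where "of_wo x = (\<chi> i. x $ mk_wo i)"

lemma to_wo_of_wo [simp]: "to_wo (of_wo x) = x"
  by (auto simp: to_wo_def of_wo_def vec_eq_iff un_wo_inverse)

lemma of_wo_to_wo [simp]: "of_wo (to_wo x) = x"
  by (auto simp: to_wo_def of_wo_def vec_eq_iff mk_wo_inverse)

lemma linear_to_wo: "linear to_wo" and linear_of_wo: "linear of_wo"
  by (auto intro!: linearI simp: to_wo_def of_wo_def vec_eq_iff)

lemma sum_wo: "(\<Sum>i\<in>UNIV. f (un_wo i)) = (\<Sum>i\<in>UNIV. f i)"
  by (rule sum.reindex_bij_betw[OF bij_un_wo])

lemma prod_wo: "(\<Prod>i\<in>UNIV. f (un_wo i)) = (\<Prod>i\<in>UNIV. f i)"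
  by (rule prod.reindex_bij_betw[OF bij_un_wo])

lemma inner_to_wo: "to_wo x \<bullet> to_wo y = x \<bullet> y"
  by (simp add: inner_vec_def to_wo_def sum_wo[of "\<lambda>i. x $ i * y $ i"])

lemma to_wo_image_eq_vimage: "to_wo ` S = of_wo -` S"
  by (metis bijI' bij_vimage_eq_inv_image inv_equality of_wo_to_wo to_wo_of_wo)

lemma bij_betw_to_wo_Basis: "bij_betw to_wo (Basis :: (real^'n) set) Basis"
proof (rule bij_betwI[where g = of_wo])
  show "to_wo \<in> (Basis :: (real^'n) set) \<rightarrow> Basis"
  proof
    fix b :: "real^'n" assume "b \<in> Basis"
    then obtain i where "b = axis i 1" by (auto simp: Basis_vec_def)
    then have "to_wo b = axis (mk_wo i) 1"
      by (auto simp: to_wo_def axis_def vec_eq_iff un_wo_inverse mk_wo_inverse)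
    then show "to_wo b \<in> Basis" by (auto simp: Basis_vec_def)
  qed
  show "of_wo \<in> (Basis :: (real^('n wo)) set) \<rightarrow> Basis"
  proof
    fix b :: "real^('n wo)" assume "b \<in> Basis"
    then obtain i where "b = axis i 1" by (auto simp: Basis_vec_def)
    then have "of_wo b = axis (un_wo i) 1"
      by (auto simp: of_wo_def axis_def vec_eq_iff un_wo_inverse mk_wo_inverse)
    then show "of_wo b \<in> Basis" by (auto simp: Basis_vec_def)
  qed
qed auto

text \<open>Relabelling coordinates takes boxes to boxes with the same side lengths, and
  \<open>lborel\<close> is determined by its values on boxes.\<close>

lemma lborel_to_wo: "distr lborel borel (of_wo :: real^('n wo) \<Rightarrow> real^'n) = lborel"
proof (rule lborel_eqI[symmetric])
  have meas: "(of_wo :: real^('n wo) \<Rightarrow> real^'n) \<in> borel_measurable borel"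
    by (intro borel_measurable_continuous_onI linear_continuous_on linear_of_wo[unfolded linear_conv_bounded_linear])
  fix l u :: "real^'n" assume *: "\<And>b. b \<in> Basis \<Longrightarrow> l \<bullet> b \<le> u \<bullet> b"
  have "of_wo -` box l u = box (to_wo l) (to_wo u)"
  proof -
    have "x \<in> of_wo -` box l u \<longleftrightarrow> x \<in> box (to_wo l) (to_wo u)" for x :: "real^('n wo)"
    proof -
      have "(\<forall>b\<in>Basis. to_wo l \<bullet> b < x \<bullet> b \<and> x \<bullet> b < to_wo u \<bullet> b) \<longleftrightarrow>
            (\<forall>b\<in>Basis. to_wo l \<bullet> to_wo b < x \<bullet> to_wo b \<and> x \<bullet> to_wo b < to_wo u \<bullet> to_wo b)"
        using bij_betw_to_wo_Basis[where 'n='n] unfolding bij_betw_def by (metis (no_types, lifting) imageE imageI)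
      then show ?thesis
        by (simp add: mem_box inner_to_wo) (metis inner_to_wo to_wo_of_wo)
    qed
    then show ?thesis by blast
  qed
  then have "emeasure (distr lborel borel of_wo) (box l u) = emeasure lborel (box (to_wo l) (to_wo u))"
    using meas by (simp add: emeasure_distr)
  also have "\<dots> = (\<Prod>b\<in>Basis. (to_wo u - to_wo l) \<bullet> b)"
  proof (rule emeasure_lborel_box)
    fix b :: "real^('n wo)" assume "b \<in> Basis"
    then obtain b' where "b' \<in> Basis" "b = to_wo b'"
      using bij_betw_to_wo_Basis[where 'n='n] by (auto simp: bij_betw_def)
    then show "to_wo l \<bullet> b \<le> to_wo u \<bullet> b" using * by (simp add: inner_to_wo)
  qed
  also have "(\<Prod>b\<in>Basis. (to_wo u - to_wo l) \<bullet> b) = (\<Prod>b\<in>(Basis :: (real^'n) set). (to_wo u - to_wo l) \<bullet> to_wo b)"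
    by (rule prod.reindex_bij_betw[OF bij_betw_to_wo_Basis, symmetric])
  also have "\<dots> = (\<Prod>b\<in>Basis. (u - l) \<bullet> b)"
    by (simp add: inner_diff_left inner_to_wo)
  finally show "emeasure (distr lborel borel of_wo) (box l u) = ennreal (\<Prod>b\<in>Basis. (u - l) \<bullet> b)" .
qed simp

lemma measure_to_wo:
  fixes S :: "(real^'n) set"
  assumes "S \<in> sets borel"
  shows "measure lebesgue (to_wo ` S) = measure lebesgue S"
proof -
  have meas: "(of_wo :: real^('n wo) \<Rightarrow> real^'n) \<in> borel_measurable borel"
    by (intro borel_measurable_continuous_onI linear_continuous_on linear_of_wo[unfolded linear_conv_bounded_linear])
  have "measure lborel S = measure (distr lborel borel (of_wo :: real^('n wo) \<Rightarrow> real^'n)) S"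
    by (simp add: lborel_to_wo)
  also have "\<dots> = measure lborel (to_wo ` S)"
    using assms meas by (simp add: measure_distr to_wo_image_eq_vimage)
  finally have "measure lborel S = measure lborel (to_wo ` S)" .
  moreover have "to_wo ` S \<in> sets borel"
    using measurable_sets[OF meas assms] by (simp add: to_wo_image_eq_vimage)
  ultimately show ?thesis
    using assms by simp
qed

text \<open>Conjugation with \<open>un_wo\<close> is a bijection between the permutations of the two
  index types that preserves signs, so the two Leibniz expansions agree term by term.\<close>

lemma det_wo: "det (\<chi> i j. A $ un_wo i $ un_wo j) = det (A :: real^'n^'n)"
proof -
  let ?f = "map_permutation (UNIV :: 'n wo set) un_wo :: ('n wo \<Rightarrow> 'n wo) \<Rightarrow> 'n \<Rightarrow> 'n"
  have inj: "inj (un_wo :: 'n wo \<Rightarrow> 'n)" using bij_un_wo bij_is_inj by blast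
  have img: "un_wo ` UNIV = (UNIV :: 'n set)" using bij_un_wo bij_is_surj by blast
  have bij: "bij_betw ?f {p. p permutes UNIV} {p. p permutes UNIV}"
  proof (rule bij_betwI[where g = "map_permutation UNIV mk_wo"])
    have img': "mk_wo ` UNIV = (UNIV :: 'n wo set)"
      by (metis UNIV_I surjI un_wo_inverse)
    have inj': "inj (mk_wo :: 'n \<Rightarrow> _)" by (metis UNIV_I injI mk_wo_inverse)
    show "?f \<in> {p. p permutes UNIV} \<rightarrow> {p. p permutes UNIV}"
      using map_permutation_permutes[OF bij_un_wo] by auto
    show "map_permutation UNIV mk_wo \<in> {p. p permutes (UNIV :: 'n set)} \<rightarrow> {p. p permutes (UNIV :: 'n wo set)}"
      using map_permutation_permutes[of mk_wo UNIV UNIV] inj' img' by (auto simp: bij_betw_def)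
    show "map_permutation UNIV mk_wo (?f p) = p" if "p \<in> {p. p permutes UNIV}" for p
    proof
      fix x
      have "?f p (un_wo x) = un_wo (p x)" using that inj by (simp add: map_permutation_apply)
      moreover have "map_permutation UNIV mk_wo (?f p) (mk_wo (un_wo x)) = mk_wo (?f p (un_wo x))"
        using inj' by (simp add: map_permutation_apply)
      ultimately show "map_permutation UNIV mk_wo (?f p) x = p x"
        by (simp add: un_wo_inverse)
    qed
    show "?f (map_permutation UNIV mk_wo p) = p" if "p \<in> {p. p permutes UNIV}" for p
    proof
      fix x :: 'n
      have "map_permutation UNIV mk_wo p (mk_wo x) = mk_wo (p x)"
        using inj' by (simp add: map_permutation_apply)
      moreover have "?f (map_permutation UNIV mk_wo p) (un_wo (mk_wo x)) = un_wo (map_permutation UNIV mk_wo p (mk_wo x))"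
        using inj by (simp add: map_permutation_apply)
      ultimately show "?f (map_permutation UNIV mk_wo p) x = p x"
        by (simp add: mk_wo_inverse)
    qed
  qed
  have "det A = (\<Sum>p | p permutes UNIV. of_int (sign (?f p)) * (\<Prod>i\<in>UNIV. A $ i $ ?f p i))"
    unfolding det_def by (rule sum.reindex_bij_betw[OF bij, symmetric])
  also have "\<dots> = det (\<chi> i j. A $ un_wo i $ un_wo j)"
    unfolding det_def
  proof (rule sum.cong)
    fix p :: "'n wo \<Rightarrow> 'n wo" assume p: "p \<in> {p. p permutes UNIV}"
    have "sign (?f p) = sign p"
      using p inj by (intro sign_map_permutation) auto
    moreover have "(\<Prod>i\<in>UNIV. A $ i $ ?f p i) = (\<Prod>i\<in>UNIV. A $ un_wo i $ ?f p (un_wo i))"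
      by (rule prod_wo[symmetric])
    moreover have "?f p (un_wo i) = un_wo (p i)" for i
      using inj by (simp add: map_permutation_apply)
    ultimately show "of_int (sign (?f p)) * (\<Prod>i\<in>UNIV. A $ i $ ?f p i) =
      of_int (sign p) * (\<Prod>i\<in>UNIV. (\<chi> i j. A $ un_wo i $ un_wo j) $ i $ p i)"
      by simp
  qed auto
  finally show ?thesis ..
qed

lemma matrix_to_wo:
  fixes f :: "real^'n::finite \<Rightarrow> real^'n"
  assumes "linear f"
  shows "matrix (to_wo \<circ> f \<circ> of_wo) = (\<chi> i j. matrix f $ un_wo i $ un_wo j)"
proof -
  have "of_wo (axis j 1) = (axis (un_wo j) 1 :: real^'n)" for j :: "'n::finite wo"
    by (auto simp: of_wo_def axis_def vec_eq_iff un_wo_inverse mk_wo_inverse)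
  then show ?thesis
    by (simp add: matrix_def to_wo_def)
qed

lemma compact_to_wo: "compact S \<Longrightarrow> compact (to_wo ` S)"
  by (intro compact_continuous_image linear_continuous_on linear_to_wo[unfolded linear_conv_bounded_linear])

section \<open>Volumes of images under linear and C^1 maps, of slabs and of parallelepipeds\<close>

lemma measure_linear_image_compact:
  fixes f :: "real^'n \<Rightarrow> real^'n"
  assumes f: "linear f" and S: "compact S"
  shows "measure lebesgue (f ` S) = \<bar>det (matrix f)\<bar> * measure lebesgue S"
proof -
  have cf: "compact (f ` S)"
    by (intro compact_continuous_image linear_continuous_on f[unfolded linear_conv_bounded_linear] S)
  have lin: "linear (to_wo \<circ> f \<circ> of_wo)"
    by (intro linear_compose linear_to_wo linear_of_wo f)
  have "measure lebesgue (f ` S) = measure lebesgue (to_wo ` f ` S)"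
    using cf by (simp add: measure_to_wo borel_compact)
  also have "to_wo ` f ` S = (to_wo \<circ> f \<circ> of_wo) ` to_wo ` S"
    by (simp add: image_comp comp_def)
  also have "measure lebesgue \<dots> = \<bar>det (matrix (to_wo \<circ> f \<circ> of_wo))\<bar> * measure lebesgue (to_wo ` S)"
    using lin S by (intro measure_linear_image lmeasurable_compact compact_to_wo)
  also have "det (matrix (to_wo \<circ> f \<circ> of_wo)) = det (matrix f)"
    by (simp add: matrix_to_wo f det_wo)
  also have "measure lebesgue (to_wo ` S) = measure lebesgue S"
    using S by (simp add: measure_to_wo borel_compact)
  finally show ?thesis .
qed

text \<open>A crude bound from the Leibniz expansion: \<open>fact CARD('n)\<close> terms, each a
  product of entries of size at most \<open>B\<close>.\<close>

lemma det_le_onorm: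
  fixes f :: "real^'n \<Rightarrow> real^'n"
  assumes "linear f" "\<And>v. norm (f v) \<le> B * norm v"
  shows "\<bar>det (matrix f)\<bar> \<le> fact CARD('n) * B ^ CARD('n)"
proof -
  have "\<bar>matrix f $ i $ j\<bar> \<le> B" for i j
  proof -
    have "\<bar>matrix f $ i $ j\<bar> \<le> norm (f (axis j 1))"
      unfolding matrix_def by (simp add: component_le_norm_cart)
    also have "\<dots> \<le> B" using assms(2)[of "axis j 1"] by simp
    finally show ?thesis .
  qed
  then have "\<bar>\<Prod>i\<in>UNIV. matrix f $ i $ p i\<bar> \<le> (\<Prod>i\<in>(UNIV :: 'n set). B)" for p
    unfolding abs_prod by (intro prod_mono) auto
  then have le: "\<bar>of_int (sign p) * (\<Prod>i\<in>UNIV. matrix f $ i $ p i)\<bar> \<le> B ^ CARD('n)" for p :: "'n \<Rightarrow> 'n"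
    by (simp add: abs_mult sign_def)
  have "\<bar>det (matrix f)\<bar> \<le> (\<Sum>p | p permutes (UNIV :: 'n set). B ^ CARD('n))"
    unfolding det_def by (rule order_trans[OF sum_abs sum_mono]) (rule le)
  also have "\<dots> = fact CARD('n) * B ^ CARD('n)"
    by (simp add: card_permutations[OF refl])
  finally show ?thesis .
qed

text \<open>An inequality for images holds without injectivity. Applied to a map and to its inverse
  it yields the two-sided volume comparison for changes of coordinates.\<close>

lemma measure_C1_image_le:
  fixes f :: "real^'n \<Rightarrow> real^'n"
  assumes S: "compact S"
    and der: "\<And>x. x \<in> S \<Longrightarrow> (f has_derivative f' x) (at x within S)"
    and cont: "\<And>v. continuous_on S (\<lambda>x. f' x v)"
    and le: "\<And>x v. x \<in> S \<Longrightarrow> norm (f' x v) \<le> B * norm v"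
  shows "measure lebesgue (f ` S) \<le> fact CARD('n) * B ^ CARD('n) * measure lebesgue S"
proof -
  define g where "g = to_wo \<circ> f \<circ> of_wo"
  define g' where "g' x = to_wo \<circ> f' (of_wo x) \<circ> of_wo" for x
  have lin: "linear (f' x)" if "x \<in> S" for x
    using der[OF that] has_derivative_linear by blast
  have cf: "continuous_on S f"
    using der by (meson has_derivative_continuous continuous_on_eq_continuous_within)
  have bl: "bounded_linear (to_wo :: real^'n \<Rightarrow> _)" "bounded_linear (of_wo :: _ \<Rightarrow> real^'n)"
    using linear_to_wo linear_of_wo by (auto simp: linear_conv_bounded_linear)
  have derg: "(g has_derivative g' x) (at x within to_wo ` S)" if "x \<in> to_wo ` S" for x
  proof -
    have x: "of_wo x \<in> S" using that by auto
    have im: "of_wo ` to_wo ` S = S" by (simp add: image_image)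
    have "((f \<circ> of_wo) has_derivative (f' (of_wo x) \<circ> of_wo)) (at x within to_wo ` S)"
      by (rule diff_chain_within[OF bounded_linear_imp_has_derivative[OF bl(2)]])
         (use der[OF x] im in simp)
    from diff_chain_within[OF this bounded_linear_imp_has_derivative[OF bl(1)]]
    show ?thesis by (simp add: g_def g'_def comp_assoc)
  qed
  have det: "det (matrix (g' x)) = det (matrix (f' (of_wo x)))" if "x \<in> to_wo ` S" for x
    using that lin unfolding g'_def by (auto simp: matrix_to_wo det_wo)
  have contd: "continuous_on (to_wo ` S) (\<lambda>x. \<bar>det (matrix (g' x))\<bar>)"
  proof -
    have "continuous_on S (\<lambda>x. \<bar>det (matrix (f' x))\<bar>)"
      unfolding det_def matrix_def vec_lambda_beta
      by (intro continuous_on_rabs continuous_on_sum continuous_on_mult continuous_on_const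
          continuous_on_prod continuous_on_component cont)
    then have "continuous_on (to_wo ` S) (\<lambda>x. \<bar>det (matrix (f' (of_wo x)))\<bar>)"
      by (rule continuous_on_compose2) (auto intro: linear_continuous_on bl)
    then show ?thesis by (rule continuous_on_eq) (simp add: det)
  qed
  have "set_integrable lborel (to_wo ` S) (\<lambda>x. \<bar>det (matrix (g' x))\<bar>)"
    using borel_integrable_compact[OF compact_to_wo[OF S] contd] unfolding set_integrable_def .
  from set_borel_integral_eq_integral(1)[OF this]
  have int: "(\<lambda>x. \<bar>det (matrix (g' x))\<bar>) integrable_on (to_wo ` S)" .
  have "measure lebesgue (g ` to_wo ` S) \<le> (fact CARD('n) * B ^ CARD('n)) * measure lebesgue (to_wo ` S)"
  proof (rule measure_bounded_differentiable_image[OF lmeasurable_compact[OF compact_to_wo[OF S]] derg int])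
    show "\<bar>det (matrix (g' x))\<bar> \<le> fact CARD('n) * B ^ CARD('n)" if "x \<in> to_wo ` S" for x
      using that by (auto simp: det intro!: det_le_onorm lin le)
  qed
  moreover have "g ` to_wo ` S = to_wo ` f ` S"
    by (simp add: g_def image_comp comp_def)
  moreover have "measure lebesgue (to_wo ` f ` S) = measure lebesgue (f ` S)"
    using compact_continuous_image[OF cf S] by (simp add: measure_to_wo borel_compact)
  moreover have "measure lebesgue (to_wo ` S) = measure lebesgue S"
    using S by (simp add: measure_to_wo borel_compact)
  ultimately show ?thesis by simp
qed

text \<open>This volume varies inversely with the determinant of the \<open>a i\<close>, that of the
  parallelepiped spanned by the \<open>a i\<close> varies directly. Comparing the two is what
  produces the square of the determinant in \<open>lower_estimate\<close>.\<close>

lemma slab_box: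
  fixes a :: "'n \<Rightarrow> real^'n" and h :: "'n \<Rightarrow> real"
  assumes d: "det (\<chi> i. a i) \<noteq> 0" and h: "\<And>i. 0 \<le> h i"
  shows compact_slabs: "compact {x. \<forall>i. \<bar>a i \<bullet> x\<bar> \<le> h i}"
    and measure_slabs: "measure lebesgue {x. \<forall>i. \<bar>a i \<bullet> x\<bar> \<le> h i} = (\<Prod>i\<in>UNIV. 2 * h i) / \<bar>det (\<chi> i. a i)\<bar>"
proof -
  let ?A = "\<chi> i. a i" and ?S = "{x. \<forall>i. \<bar>a i \<bullet> x\<bar> \<le> h i}" and ?h = "(\<chi> i. h i) :: real^'n"
  have inv: "invertible ?A" using d by (simp add: invertible_det_nz)
  then obtain B where B: "?A ** B = mat 1" "B ** ?A = mat 1" unfolding invertible_def by auto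
  have row: "(?A *v x) $ i = a i \<bullet> x" for x i
    by (simp add: matrix_vector_mult_def inner_vec_def)
  have S: "?S = (*v) B ` cbox (-?h) ?h"
  proof safe
    fix x assume x: "\<forall>i. \<bar>a i \<bullet> x\<bar> \<le> h i"
    have "?A *v x \<in> cbox (-?h) ?h" using x unfolding mem_box_cart row by (auto simp: abs_le_iff minus_le_iff)
    moreover have "x = B *v (?A *v x)" by (simp add: matrix_vector_mul_assoc B)
    ultimately show "x \<in> (*v) B ` cbox (-?h) ?h" by blast
  next
    fix x i assume x: "x \<in> cbox (-?h) ?h"
    have "?A *v (B *v x) = x" by (simp add: matrix_vector_mul_assoc B)
    then have "a i \<bullet> (B *v x) = x $ i" by (metis row)
    then show "\<bar>a i \<bullet> (B *v x)\<bar> \<le> h i" using x by (auto simp: mem_box_cart abs_le_iff minus_le_iff dest!: spec[of _ i])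
  qed
  show "compact ?S" unfolding S
    by (intro compact_continuous_image linear_continuous_on) (auto simp: linear_conv_bounded_linear[symmetric])
  have "det B * det ?A = 1" using B(2) det_mul[of B ?A] by simp
  then have detB: "\<bar>det B\<bar> = 1 / \<bar>det ?A\<bar>" using d by (metis abs_divide abs_one nonzero_eq_divide_eq)
  have "measure lebesgue ?S = \<bar>det B\<bar> * measure lebesgue (cbox (-?h) ?h)"
    unfolding S by (subst measure_linear_image_compact) auto
  also have "measure lebesgue (cbox (-?h) ?h) = (\<Prod>i\<in>UNIV. 2 * h i)"
  proof -
    have "0 \<in> cbox (-?h) ?h" using h by (simp add: mem_box_cart)
    then have "cbox (-?h) ?h \<noteq> {}" by blast
    from content_cbox_cart[OF this] show ?thesis by simp
  qed
  finally show "measure lebesgue ?S = (\<Prod>i\<in>UNIV. 2 * h i) / \<bar>det ?A\<bar>" by (simp add: detB)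
qed

lemma
  fixes a :: "'n \<Rightarrow> real^'n" and r :: real
  assumes r: "0 \<le> r"
  shows compact_parallelepiped: "compact {\<Sum>i\<in>UNIV. t $ i *\<^sub>R a i |t. \<forall>i. 0 \<le> t $ i \<and> t $ i \<le> r}"
    and measure_parallelepiped: "measure lebesgue {\<Sum>i\<in>UNIV. t $ i *\<^sub>R a i |t. \<forall>i. 0 \<le> t $ i \<and> t $ i \<le> r}
           = r ^ CARD('n) * \<bar>det (\<chi> i. a i)\<bar>"
proof -
  let ?A = "\<chi> i. a i" and ?S = "{\<Sum>i\<in>UNIV. t $ i *\<^sub>R a i |t. \<forall>i. 0 \<le> t $ i \<and> t $ i \<le> r}" and ?h = "(\<chi> i. r) :: real^'n"
  have "(\<Sum>i\<in>UNIV. t $ i *\<^sub>R a i) = transpose ?A *v t" for t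
    by (simp add: matrix_vector_mult_def transpose_def vec_eq_iff mult.commute)
  then have S: "?S = (*v) (transpose ?A) ` cbox 0 ?h"
    by (auto simp: mem_box_cart image_iff)
  show "compact ?S" unfolding S
    by (intro compact_continuous_image linear_continuous_on) (auto simp: linear_conv_bounded_linear[symmetric])
  have "measure lebesgue ?S = \<bar>det ?A\<bar> * measure lebesgue (cbox 0 ?h)"
    unfolding S by (subst measure_linear_image_compact) (auto simp: det_transpose)
  also have "measure lebesgue (cbox 0 ?h) = r ^ CARD('n)"
  proof -
    have "0 \<in> cbox 0 ?h" using r by (simp add: mem_box_cart)
    then have "cbox 0 ?h \<noteq> {}" by blast
    from content_cbox_cart[OF this] show ?thesis by simp
  qed
  finally show "measure lebesgue ?S = r ^ CARD('n) * \<bar>det ?A\<bar>" by simp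
qed

section \<open>Directional derivatives of C^k functions\<close>

text \<open>The point comes last, so that \<open>dd v\<close> acts on functions and mixed
  derivatives are iterates of it.\<close>

definition dd :: "'a::euclidean_space \<Rightarrow> ('a \<Rightarrow> real) \<Rightarrow> 'a \<Rightarrow> real"
  where "dd v F z = frechet_derivative F (at z) v"

lemma Ck_on_Suc_iff_dd:
  "Ck_on (Suc k) S F \<longleftrightarrow> (\<forall>x\<in>S. F differentiable (at x)) \<and> (\<forall>v\<in>Basis. Ck_on k S (dd v F))"
  by (simp add: dd_def[abs_def])

declare Ck_on.simps(2) [simp del]

lemma Ck_on_SucD: "Ck_on (Suc k) S F \<Longrightarrow> Ck_on k S F"
proof (induction k arbitrary: F)
  case 0
  then have "F differentiable_on S"
    by (auto simp: Ck_on.simps(2) differentiable_on_def intro: differentiable_at_withinI)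
  then show ?case by (simp add: differentiable_imp_continuous_on)
next
  case (Suc k)
  then show ?case by (auto simp: Ck_on.simps(2))
qed

lemma Ck_on_mono: "Ck_on m S F \<Longrightarrow> k \<le> m \<Longrightarrow> Ck_on k S F"
  by (induction m) (auto simp: le_Suc_eq dest: Ck_on_SucD)

lemma Ck_on_differentiable: "Ck_on k S F \<Longrightarrow> 0 < k \<Longrightarrow> x \<in> S \<Longrightarrow> F differentiable (at x)"
  by (cases k) (auto simp: Ck_on.simps(2))

lemma Ck_on_continuous: "Ck_on k S F \<Longrightarrow> continuous_on S F"
  using Ck_on_mono[of k S F 0] by simp

lemma dd_cong:
  assumes "open S" "z \<in> S" "F differentiable (at z)" "\<And>x. x \<in> S \<Longrightarrow> F x = G x"
  shows "dd v F z = dd v G z"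
  unfolding dd_def using frechet_derivative_transform_within_open[OF assms(3,1,2,4)] by simp

lemma Ck_on_cong:
  fixes F G :: "'a::euclidean_space \<Rightarrow> real"
  assumes "open S" "\<And>x. x \<in> S \<Longrightarrow> F x = G x" "Ck_on k S F"
  shows "Ck_on k S G"
  using assms(2,3)
proof (induction k arbitrary: F G)
  case 0
  then show ?case by (auto intro: continuous_on_eq)
next
  case (Suc k)
  have d: "G differentiable (at x)" if "x \<in> S" for x
  proof -
    have "(F has_derivative frechet_derivative F (at x)) (at x)"
      using Suc.prems(2) that by (simp add: frechet_derivative_works[symmetric] Ck_on_differentiable)
    from has_derivative_transform_within_open[OF this assms(1) that Suc.prems(1)]
    show ?thesis by (auto simp: differentiable_def)
  qed
  have "Ck_on k S (dd v G)" if "v \<in> Basis" for v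
  proof (rule Suc.IH)
    show "Ck_on k S (dd v F)" using Suc.prems(2) that by (simp add: Ck_on_Suc_iff_dd)
    show "dd v F x = dd v G x" if "x \<in> S" for x
      using Suc.prems that by (intro dd_cong[OF assms(1) that]) (auto intro: Ck_on_differentiable)
  qed
  with d show ?case by (simp add: Ck_on_Suc_iff_dd)
qed

lemma has_derivative_dd: "F differentiable (at z) \<Longrightarrow> (F has_derivative (\<lambda>v. dd v F z)) (at z)"
  unfolding dd_def by (simp add: frechet_derivative_works)

lemma dd_eqI: "(F has_derivative F') (at z) \<Longrightarrow> dd v F z = F' v"
  unfolding dd_def using frechet_derivative_at by metis

lemma linear_dd: "F differentiable (at z) \<Longrightarrow> linear (\<lambda>v. dd v F z)"
  using has_derivative_linear[OF has_derivative_dd] .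

lemma dd_add:
  assumes "F differentiable (at z)" "G differentiable (at z)"
  shows "dd v (\<lambda>x. F x + G x) z = dd v F z + dd v G z"
  by (rule dd_eqI[OF has_derivative_add]) (intro has_derivative_dd assms)+

lemma dd_cmult:
  assumes "F differentiable (at z)"
  shows "dd v (\<lambda>x. a * F x) z = a * dd v F z"
  by (rule dd_eqI) (auto intro!: derivative_eq_intros has_derivative_dd assms)

lemma Ck_on_add:
  fixes F G :: "'a::euclidean_space \<Rightarrow> real"
  assumes "open S" "Ck_on k S F" "Ck_on k S G"
  shows "Ck_on k S (\<lambda>x. F x + G x)"
  using assms(2,3)
proof (induction k arbitrary: F G)
  case 0
  then show ?case by (auto intro: continuous_intros)
next
  case (Suc k)
  have "Ck_on k S (dd v (\<lambda>x. F x + G x))" if "v \<in> Basis" for v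
    by (rule Ck_on_cong[OF assms(1) _ Suc.IH[of "dd v F" "dd v G"]])
       (use Suc.prems that in \<open>auto simp: Ck_on_Suc_iff_dd dd_add\<close>)
  then show ?case using Suc.prems by (auto simp: Ck_on_Suc_iff_dd)
qed

lemma Ck_on_cmult:
  fixes F :: "'a::euclidean_space \<Rightarrow> real"
  assumes "open S" "Ck_on k S F"
  shows "Ck_on k S (\<lambda>x. a * F x)"
  using assms(2)
proof (induction k arbitrary: F)
  case 0
  then show ?case by (auto intro: continuous_intros)
next
  case (Suc k)
  have "Ck_on k S (dd v (\<lambda>x. a * F x))" if "v \<in> Basis" for v
    by (rule Ck_on_cong[OF assms(1) _ Suc.IH[of "dd v F"]])
       (use Suc.prems that in \<open>auto simp: Ck_on_Suc_iff_dd dd_cmult\<close>)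
  then show ?case using Suc.prems by (auto simp: Ck_on_Suc_iff_dd)
qed

lemma Ck_on_zero: "Ck_on k S (\<lambda>x. 0 :: real)"
proof (induction k)
  case (Suc k)
  have "dd v (\<lambda>x. 0 :: real) = (\<lambda>x. 0)" for v :: 'a
    by (rule ext, rule dd_eqI) simp
  with Suc show ?case by (simp add: Ck_on_Suc_iff_dd)
qed simp

lemma Ck_on_sum:
  fixes F :: "'b \<Rightarrow> 'a::euclidean_space \<Rightarrow> real"
  assumes "open S" "finite I" "\<And>i. i \<in> I \<Longrightarrow> Ck_on k S (F i)"
  shows "Ck_on k S (\<lambda>x. \<Sum>i\<in>I. F i x)"
  using assms(2,3)
  by (induction I rule: finite_induct) (auto intro!: Ck_on_zero Ck_on_add assms(1))

lemma dd_Basis: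
  assumes "F differentiable (at z)"
  shows "dd v F z = (\<Sum>b\<in>Basis. (v \<bullet> b) * dd b F z)"
proof -
  have "dd v F z = dd (\<Sum>b\<in>Basis. (v \<bullet> b) *\<^sub>R b) F z" by (simp add: euclidean_representation)
  then show ?thesis
    by (simp add: linear_sum[OF linear_dd[OF assms]] linear_cmul[OF linear_dd[OF assms]])
qed

text \<open>\<open>Ck_on\<close> speaks of the standard basis only; a general direction is reached
  as a linear combination.\<close>

lemma Ck_on_dd:
  assumes "open S" "Ck_on (Suc k) S F"
  shows "Ck_on k S (dd v F)"
proof (rule Ck_on_cong[OF assms(1)])
  show "Ck_on k S (\<lambda>z. \<Sum>b\<in>Basis. (v \<bullet> b) * dd b F z)"
    using assms by (intro Ck_on_sum Ck_on_cmult) (auto simp: Ck_on_Suc_iff_dd)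
  show "(\<Sum>b\<in>Basis. (v \<bullet> b) * dd b F z) = dd v F z" if "z \<in> S" for z
    by (rule dd_Basis[symmetric]) (use assms that in \<open>auto intro: Ck_on_differentiable\<close>)
qed

lemma dd_sum_cmult:
  assumes "\<And>i. i \<in> I \<Longrightarrow> F i differentiable (at z)"
  shows "dd v (\<lambda>x. \<Sum>i\<in>I. a i * F i x) z = (\<Sum>i\<in>I. a i * dd v (F i) z)"
  by (rule dd_eqI) (auto intro!: derivative_eq_intros has_derivative_dd assms)

lemma dd_dd_Basis:
  assumes "open S" "Ck_on (Suc (Suc k)) S F" "z \<in> S"
  shows "dd u (dd v F) z = (\<Sum>b\<in>Basis. (v \<bullet> b) * dd u (dd b F) z)"
proof -
  have "dd u (dd v F) z = dd u (\<lambda>x. \<Sum>b\<in>Basis. (v \<bullet> b) * dd b F x) z"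
  proof (rule dd_cong[OF assms(1,3)])
    show "dd v F differentiable (at z)"
      using Ck_on_dd[OF assms(1,2)] assms(3) by (auto intro: Ck_on_differentiable)
    show "dd v F x = (\<Sum>b\<in>Basis. (v \<bullet> b) * dd b F x)" if "x \<in> S" for x
      using assms that by (intro dd_Basis) (auto intro: Ck_on_differentiable)
  qed
  also have "\<dots> = (\<Sum>b\<in>Basis. (v \<bullet> b) * dd u (dd b F) z)"
    using Ck_on_dd[OF assms(1,2)] assms(3) by (intro dd_sum_cmult) (auto intro: Ck_on_differentiable)
  finally show ?thesis .
qed

text \<open>Linearity in the direction of the inner derivative; for the outer one it is
  \<open>linear_dd\<close>.\<close>

lemma linear_dd_inner:
  assumes "open S" "Ck_on (Suc (Suc k)) S F" "z \<in> S"
  shows "linear (\<lambda>v. dd u (dd v F) z)"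
proof -
  have "(\<lambda>v. dd u (dd v F) z) = (\<lambda>v. \<Sum>b\<in>Basis. (v \<bullet> b) * dd u (dd b F) z)"
    by (rule ext) (rule dd_dd_Basis[OF assms])
  then show ?thesis
    by (simp add: linear_iff inner_add_left distrib_right sum.distrib sum_distrib_left mult.assoc)
qed

lemma dd_curve:
  assumes "F differentiable (at (z t))" "(z has_vector_derivative z') (at t)"
  shows "((\<lambda>t. F (z t)) has_real_derivative dd z' F (z t)) (at t)"
proof -
  have "(F \<circ> z has_derivative (\<lambda>v. dd v F (z t)) \<circ> (\<lambda>h. h *\<^sub>R z')) (at t)"
    using assms(2) unfolding has_vector_derivative_def
    by (rule diff_chain_at) (rule has_derivative_dd[OF assms(1)])
  then have "((\<lambda>t. F (z t)) has_derivative (\<lambda>h. dd (h *\<^sub>R z') F (z t))) (at t)"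
    by (simp only: comp_def)
  moreover have "(\<lambda>h. dd (h *\<^sub>R z') F (z t)) = (*) (dd z' F (z t))"
    by (rule ext) (simp only: linear_cmul[OF linear_dd[OF assms(1)]] real_scaleR_def mult.commute)
  ultimately show ?thesis
    by (simp add: has_field_derivative_def)
qed

text \<open>The direction \<open>z' s\<close> itself moves with \<open>s\<close>. Expanding it in
  the standard basis leaves products of scalar functions, and the product rule yields the
  acceleration term.\<close>

lemma dd_curve2:
  assumes S: "open S" "Ck_on (Suc (Suc k)) S F"
    and T: "open T" "t \<in> T" "\<And>s. s \<in> T \<Longrightarrow> z s \<in> S" "\<And>s. s \<in> T \<Longrightarrow> (z has_vector_derivative z' s) (at s)"
    and z'': "(z' has_vector_derivative z'') (at t)"
  shows "((\<lambda>s. dd (z' s) F (z s)) has_real_derivative dd z'' F (z t) + dd (z' t) (dd (z' t) F) (z t)) (at t)"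
proof -
  have diff: "F differentiable (at (z s))" "dd b F differentiable (at (z s))" if "s \<in> T" for b s
    using S that T(3) Ck_on_dd[OF S] by (auto intro: Ck_on_differentiable)
  have db: "((\<lambda>s. z' s \<bullet> b) has_real_derivative z'' \<bullet> b) (at t)" for b
    using bounded_linear.has_vector_derivative[OF bounded_linear_inner_left z'']
    by (simp add: has_real_derivative_iff_has_vector_derivative)
  have "((\<lambda>s. \<Sum>b\<in>Basis. (z' s \<bullet> b) * dd b F (z s)) has_real_derivative
        (\<Sum>b\<in>Basis. (z' t \<bullet> b) * dd (z' t) (dd b F) (z t) + (z'' \<bullet> b) * dd b F (z t))) (at t)"
    by (rule DERIV_sum) (auto intro!: DERIV_mult' db dd_curve diff T)
  moreover have "(\<Sum>b\<in>Basis. (z' t \<bullet> b) * dd (z' t) (dd b F) (z t) + (z'' \<bullet> b) * dd b F (z t)) =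
      dd z'' F (z t) + dd (z' t) (dd (z' t) F) (z t)"
    using dd_dd_Basis[OF S T(3)[OF T(2)], of "z' t" "z' t"] dd_Basis[OF diff(1)[OF T(2)], of z'']
    by (simp only: sum.distrib add.commute)
  ultimately have "((\<lambda>s. \<Sum>b\<in>Basis. (z' s \<bullet> b) * dd b F (z s)) has_real_derivative
      dd z'' F (z t) + dd (z' t) (dd (z' t) F) (z t)) (at t)" by simp
  then show ?thesis
    by (rule has_field_derivative_transform_within_open[OF _ T(1,2)]) (rule dd_Basis[OF diff(1), symmetric])
qed

lemma second_difference:
  assumes S: "open S" "Ck_on (Suc (Suc k)) S F" and h: "h > 0"
    and sub: "\<And>s t. 0 \<le> s \<Longrightarrow> s \<le> h \<Longrightarrow> 0 \<le> t \<Longrightarrow> t \<le> h \<Longrightarrow> z + s *\<^sub>R u + t *\<^sub>R v \<in> S"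
  shows "\<exists>s t. 0 < s \<and> s < h \<and> 0 < t \<and> t < h \<and>
    F (z + h *\<^sub>R u + h *\<^sub>R v) - F (z + h *\<^sub>R u) - F (z + h *\<^sub>R v) + F z
      = h\<^sup>2 * dd v (dd u F) (z + s *\<^sub>R u + t *\<^sub>R v)"
proof -
  have diff: "F differentiable (at x)" "dd u F differentiable (at x)" if "x \<in> S" for x
    using S that Ck_on_dd[OF S] by (auto intro: Ck_on_differentiable)
  define f where "f s = F (z + s *\<^sub>R u + h *\<^sub>R v) - F (z + s *\<^sub>R u + 0 *\<^sub>R v)" for s
  have vd: "((\<lambda>s. z + s *\<^sub>R u + t *\<^sub>R v) has_vector_derivative u) (at s)"
    "((\<lambda>t. z + s *\<^sub>R u + t *\<^sub>R v) has_vector_derivative v) (at t)" for s t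
    by (auto intro!: derivative_eq_intros)
  have f': "(f has_real_derivative (dd u F (z + s *\<^sub>R u + h *\<^sub>R v) - dd u F (z + s *\<^sub>R u + 0 *\<^sub>R v))) (at s)"
    if "0 \<le> s" "s \<le> h" for s
    unfolding f_def by (intro DERIV_diff dd_curve diff sub vd) (use that h in auto)
  obtain s where s: "0 < s" "s < h"
    "f h - f 0 = (h - 0) * (dd u F (z + s *\<^sub>R u + h *\<^sub>R v) - dd u F (z + s *\<^sub>R u + 0 *\<^sub>R v))"
    using MVT2[OF h f'] by blast
  have g': "((\<lambda>t. dd u F (z + s *\<^sub>R u + t *\<^sub>R v)) has_real_derivative dd v (dd u F) (z + s *\<^sub>R u + t *\<^sub>R v)) (at t)"
    if "0 \<le> t" "t \<le> h" for t
    by (intro dd_curve diff sub vd) (use that s in auto)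
  obtain t where t: "0 < t" "t < h"
    "dd u F (z + s *\<^sub>R u + h *\<^sub>R v) - dd u F (z + s *\<^sub>R u + 0 *\<^sub>R v) = (h - 0) * dd v (dd u F) (z + s *\<^sub>R u + t *\<^sub>R v)"
    using MVT2[OF h g'] by blast
  have "f h - f 0 = h\<^sup>2 * dd v (dd u F) (z + s *\<^sub>R u + t *\<^sub>R v)"
    using s(3) t(3) by (simp add: power2_eq_square)
  then have "F (z + h *\<^sub>R u + h *\<^sub>R v) - F (z + h *\<^sub>R u) - F (z + h *\<^sub>R v) + F z
      = h\<^sup>2 * dd v (dd u F) (z + s *\<^sub>R u + t *\<^sub>R v)"
    by (simp add: f_def)
  with s(1,2) t(1,2) show ?thesis by blast
qed

text \<open>The second difference is symmetric in \<open>u\<close> and \<open>v\<close>. By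
  \<open>second_difference\<close> it is h^2 times either mixed derivative at some nearby point, and
  both mixed derivatives are continuous.\<close>

lemma dd_commute:
  assumes S: "open S" "Ck_on (Suc (Suc k)) S F" "z \<in> S"
  shows "dd u (dd v F) z = dd v (dd u F) z"
proof (rule ccontr)
  assume "dd u (dd v F) z \<noteq> dd v (dd u F) z"
  then have e: "\<bar>dd u (dd v F) z - dd v (dd u F) z\<bar> / 2 > 0" (is "?e > 0") by simp
  have cont: "isCont (dd a (dd b F)) z" for a b
    using Ck_on_continuous[OF Ck_on_dd[OF S(1) Ck_on_dd[OF S(1,2)]]] S(1,3)
    by (simp add: continuous_on_eq_continuous_at)
  obtain r0 where r0: "r0 > 0" "ball z r0 \<subseteq> S" using S(1,3) open_contains_ball_eq by blast
  obtain r1 where r1: "r1 > 0" "\<And>x. dist x z < r1 \<Longrightarrow> \<bar>dd u (dd v F) x - dd u (dd v F) z\<bar> < ?e"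
    using cont[of u v, unfolded continuous_at_eps_delta] e by (metis dist_real_def)
  obtain r2 where r2: "r2 > 0" "\<And>x. dist x z < r2 \<Longrightarrow> \<bar>dd v (dd u F) x - dd v (dd u F) z\<bar> < ?e"
    using cont[of v u, unfolded continuous_at_eps_delta] e by (metis dist_real_def)
  define r where "r = min r0 (min r1 r2)"
  \<comment> \<open>Small enough to keep the parallelogram spanned by \<open>h\<close> times
    \<open>u\<close> and \<open>v\<close> in the ball of radius \<open>r\<close>; the summand 1
    keeps the denominator positive when both directions vanish.\<close>
  define h where "h = r / (2 * (norm u + norm v + 1))"
  have "norm u + norm v + 1 > 0" by (smt (verit) norm_ge_zero)
  then have h: "h > 0" using r0 r1 r2 by (simp add: h_def r_def)
  have hr: "h * (norm u + norm v) < r"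
  proof -
    have "h * (norm u + norm v) \<le> h * (norm u + norm v + 1)" using h by simp
    also have "\<dots> = r / 2" using \<open>norm u + norm v + 1 > 0\<close> unfolding h_def by (simp add: divide_simps)
    also have "\<dots> < r" using r0(1) r1(1) r2(1) by (simp add: r_def min_def)
    finally show ?thesis .
  qed
  have near: "dist (z + s *\<^sub>R u + t *\<^sub>R v) z < r" "dist (z + t *\<^sub>R v + s *\<^sub>R u) z < r"
    if "0 \<le> s" "s \<le> h" "0 \<le> t" "t \<le> h" for s t
  proof -
    have "norm (s *\<^sub>R u + t *\<^sub>R v) \<le> s * norm u + t * norm v"
      using norm_triangle_ineq[of "s *\<^sub>R u" "t *\<^sub>R v"] that by simp
    also have "\<dots> \<le> h * (norm u + norm v)"
      using that by (simp add: distrib_left add_mono mult_right_mono)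
    finally show "dist (z + s *\<^sub>R u + t *\<^sub>R v) z < r"
      using hr by (simp add: dist_norm add.assoc)
    then show "dist (z + t *\<^sub>R v + s *\<^sub>R u) z < r" by (simp add: algebra_simps)
  qed
  have sub: "x \<in> S" if "dist x z < r" for x
    using that r0 by (auto simp: r_def dist_commute)
  obtain s t where st: "0 < s" "s < h" "0 < t" "t < h"
    "F (z + h *\<^sub>R u + h *\<^sub>R v) - F (z + h *\<^sub>R u) - F (z + h *\<^sub>R v) + F z = h\<^sup>2 * dd v (dd u F) (z + s *\<^sub>R u + t *\<^sub>R v)"
    using second_difference[OF S(1,2) h, of z u v] sub near by blast
  obtain s' t' where st': "0 < s'" "s' < h" "0 < t'" "t' < h"
    "F (z + h *\<^sub>R v + h *\<^sub>R u) - F (z + h *\<^sub>R v) - F (z + h *\<^sub>R u) + F z = h\<^sup>2 * dd u (dd v F) (z + s' *\<^sub>R v + t' *\<^sub>R u)"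
    using second_difference[OF S(1,2) h, of z v u] sub near by blast
  have "h\<^sup>2 * dd v (dd u F) (z + s *\<^sub>R u + t *\<^sub>R v) = h\<^sup>2 * dd u (dd v F) (z + s' *\<^sub>R v + t' *\<^sub>R u)"
    using st(5) st'(5) by (simp only: add.assoc add.commute[of "h *\<^sub>R v" "h *\<^sub>R u"])
  then have eq: "dd v (dd u F) (z + s *\<^sub>R u + t *\<^sub>R v) = dd u (dd v F) (z + s' *\<^sub>R v + t' *\<^sub>R u)"
    using h by simp
  have "\<bar>dd v (dd u F) (z + s *\<^sub>R u + t *\<^sub>R v) - dd v (dd u F) z\<bar> < ?e"
    using near(1)[of s t] st by (intro r2) (auto simp: r_def)
  moreover have "\<bar>dd u (dd v F) (z + s' *\<^sub>R v + t' *\<^sub>R u) - dd u (dd v F) z\<bar> < ?e"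
    using near(2)[of t' s'] st' by (intro r1) (auto simp: r_def)
  ultimately show False using eq by (auto simp: abs_if split: if_splits)
qed

section \<open>c-segments\<close>

definition gX :: "('a::euclidean_space \<times> 'a \<Rightarrow> real) \<Rightarrow> 'a \<Rightarrow> 'a \<Rightarrow> 'a"
  where "gX F x y = (\<Sum>b\<in>Basis. dd (b, 0) F (x, y) *\<^sub>R b)"

definition gY :: "('a::euclidean_space \<times> 'a \<Rightarrow> real) \<Rightarrow> 'a \<Rightarrow> 'a \<Rightarrow> 'a"
  where "gY F x y = (\<Sum>b\<in>Basis. dd (0, b) F (x, y) *\<^sub>R b)"

text \<open>The mixed Hessian as a linear map in \<open>v\<close>: the derivative of
  \<open>gY F x y\<close> with respect to \<open>x\<close> (see
  \<open>gY_has_derivative\<close>).\<close>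

definition hXY :: "('a::euclidean_space \<times> 'a \<Rightarrow> real) \<Rightarrow> 'a \<Rightarrow> 'a \<Rightarrow> 'a \<Rightarrow> 'a"
  where "hXY F x y v = (\<Sum>b\<in>Basis. dd (v, 0) (dd (0, b) F) (x, y) *\<^sub>R b)"

text \<open>Differentiating $D_yF(x(t),y) = p + tq$ twice shows that a c-segment with $x' = v$ has
  acceleration $x'' = a$ satisfying the relation below; \<open>accY\<close> is its mirror image.\<close>

definition accX :: "('a::euclidean_space \<times> 'a \<Rightarrow> real) \<Rightarrow> 'a \<Rightarrow> 'a \<Rightarrow> 'a \<Rightarrow> 'a \<Rightarrow> bool"
  where "accX F x y v a \<longleftrightarrow>
    (\<forall>w. dd (v, 0) (dd (v, 0) (dd (0, w) F)) (x, y) + dd (a, 0) (dd (0, w) F) (x, y) = 0)"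

definition accY :: "('a::euclidean_space \<times> 'a \<Rightarrow> real) \<Rightarrow> 'a \<Rightarrow> 'a \<Rightarrow> 'a \<Rightarrow> 'a \<Rightarrow> bool"
  where "accY F x y w b \<longleftrightarrow>
    (\<forall>v. dd (0, w) (dd (0, w) (dd (v, 0) F)) (x, y) + dd (0, b) (dd (v, 0) F) (x, y) = 0)"

lemma linear_Pair_right: "linear (\<lambda>v. (v, 0))" and linear_Pair_left: "linear (\<lambda>v. (0, v))"
  by (auto intro!: linearI)

lemma inner_Basis_sum:
  fixes f :: "'a::euclidean_space \<Rightarrow> real"
  assumes "linear f"
  shows "(\<Sum>b\<in>Basis. f b *\<^sub>R b) \<bullet> v = f v"
proof -
  have "f v = f (\<Sum>b\<in>Basis. (v \<bullet> b) *\<^sub>R b)" by (simp add: euclidean_representation)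
  also have "\<dots> = (\<Sum>b\<in>Basis. (v \<bullet> b) * f b)"
    by (simp add: linear_sum[OF assms] linear_cmul[OF assms])
  finally show ?thesis
    by (simp add: inner_sum_left inner_sum_right inner_commute mult.commute)
qed

lemma gX_inner: "F differentiable (at (x, y)) \<Longrightarrow> gX F x y \<bullet> v = dd (v, 0) F (x, y)"
  unfolding gX_def
  by (rule inner_Basis_sum[OF linear_compose[OF linear_Pair_right linear_dd, unfolded comp_def]])

lemma gY_inner: "F differentiable (at (x, y)) \<Longrightarrow> gY F x y \<bullet> v = dd (0, v) F (x, y)"
  unfolding gY_def
  by (rule inner_Basis_sum[OF linear_compose[OF linear_Pair_left linear_dd, unfolded comp_def]])

lemma hXY_inner:
  assumes "open S" "Ck_on (Suc (Suc k)) S F" "(x, y) \<in> S"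
  shows "hXY F x y v \<bullet> w = dd (v, 0) (dd (0, w) F) (x, y)"
  unfolding hXY_def
  by (rule inner_Basis_sum[OF linear_compose[OF linear_Pair_left linear_dd_inner[OF assms], unfolded comp_def]])

lemma vec_eq_inner: "(\<And>w. a \<bullet> w = b \<bullet> w) \<Longrightarrow> a = (b::'a::euclidean_space)"
  by (rule euclidean_eqI) auto

lemma linear_hXY:
  assumes "open S" "Ck_on (Suc (Suc k)) S F" "(x, y) \<in> S"
  shows "linear (hXY F x y)"
proof -
  have l: "linear (\<lambda>v. dd (v, 0) (dd (0, w) F) (x, y))" for w
    using linear_compose[OF linear_Pair_right linear_dd[of "dd (0, w) F" "(x, y)"]]
      Ck_on_differentiable[OF Ck_on_dd[OF assms(1,2)] _ assms(3)] by (simp add: comp_def)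
  show ?thesis
    by (rule linearI)
       (rule vec_eq_inner, simp add: hXY_inner[OF assms] inner_add_left linear_add[OF l] linear_cmul[OF l])+
qed

lemma gY_has_derivative:
  assumes "open S" "Ck_on (Suc (Suc k)) S F" "(x, y) \<in> S"
  shows "((\<lambda>x. gY F x y) has_derivative hXY F x y) (at x)"
proof -
  have "((\<lambda>x. dd (0, b) F (x, y)) has_derivative (\<lambda>v. dd (v, 0) (dd (0, b) F) (x, y))) (at x)" for b
  proof -
    have "((\<lambda>x. (x, y)) has_derivative (\<lambda>v. (v, 0))) (at x)"
      by (auto intro!: derivative_eq_intros)
    from diff_chain_at[OF this has_derivative_dd[OF Ck_on_differentiable[OF Ck_on_dd[OF assms(1,2)] _ assms(3)]]]
    show ?thesis by (simp add: comp_def)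
  qed
  then show ?thesis
    unfolding gY_def hXY_def by (intro has_derivative_sum has_derivative_scaleR_left)
qed

lemma dd_commute_inner:
  assumes "open S" "Ck_on (Suc (Suc (Suc k))) S F" "z \<in> S"
  shows "dd p (dd u (dd v F)) z = dd p (dd v (dd u F)) z"
proof (rule dd_cong[OF assms(1,3)])
  show "dd u (dd v F) differentiable (at z)"
    using Ck_on_differentiable[OF Ck_on_dd[OF assms(1) Ck_on_dd[OF assms(1,2)]] _ assms(3)] by simp
  show "dd u (dd v F) x = dd v (dd u F) x" if "x \<in> S" for x
    by (rule dd_commute[OF assms(1,2) that])
qed

text \<open>The cross-curvature does not change when the two variables are interchanged, so the convexity
  results below may be dualised.\<close>

lemma cross_eq:
  assumes S: "open S" "Ck_on 4 S F" "(x, y) \<in> S"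
    and a: "accX F x y v a" and b: "accY F x y w b"
  shows "dd (v, 0) (dd (v, 0) (dd (0, w) (dd (0, w) F))) (x, y) + dd (a, 0) (dd (0, w) (dd (0, w) F)) (x, y)
    = dd (0, w) (dd (0, w) (dd (v, 0) (dd (v, 0) F))) (x, y) + dd (0, b) (dd (v, 0) (dd (v, 0) F)) (x, y)"
proof -
  have C4: "Ck_on (Suc (Suc (Suc (Suc 0)))) S F" using S(2) by (simp add: eval_nat_numeral)
  note C3 = Ck_on_SucD[OF C4] and C3' = Ck_on_dd[OF S(1) C4]
  note C2' = Ck_on_SucD[OF C3'] and C2'' = Ck_on_dd[OF S(1) C3']
  let ?V = "(v, 0::'a)" and ?W = "(0::'a, w)" and ?A = "(a, 0::'a)" and ?B = "(0::'a, b)" and ?z = "(x, y)"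
  have "dd ?V (dd ?V (dd ?W (dd ?W F))) ?z = dd ?V (dd ?W (dd ?V (dd ?W F))) ?z"
    by (rule dd_commute_inner[OF S(1) C3' S(3)])
  also have "\<dots> = dd ?W (dd ?V (dd ?V (dd ?W F))) ?z"
    by (rule dd_commute[OF S(1) C2'' S(3)])
  also have "\<dots> = dd ?W (dd ?W (dd ?V (dd ?V F))) ?z"
  proof (rule dd_cong[OF S(1,3)])
    show "dd ?V (dd ?V (dd ?W F)) differentiable (at ?z)"
      using Ck_on_differentiable[OF Ck_on_dd[OF S(1) C2''] _ S(3)] by simp
    show "dd ?V (dd ?V (dd ?W F)) z = dd ?W (dd ?V (dd ?V F)) z" if "z \<in> S" for z
      using dd_commute_inner[OF S(1) C3 that, of ?V ?V ?W] dd_commute[OF S(1) C2' that, of ?V ?W ?V] by simp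
  qed
  finally have 1: "dd ?V (dd ?V (dd ?W (dd ?W F))) ?z = dd ?W (dd ?W (dd ?V (dd ?V F))) ?z" .
  have "dd ?A (dd ?W (dd ?W F)) ?z = dd ?W (dd ?W (dd ?A F)) ?z"
    using dd_commute[OF S(1) C2' S(3), of ?A ?W ?W] dd_commute_inner[OF S(1) C3 S(3), of ?W ?A ?W] by simp
  also have "\<dots> = - dd ?B (dd ?A F) ?z"
    using b by (simp add: accY_def eq_neg_iff_add_eq_0)
  also have "\<dots> = - dd ?A (dd ?B F) ?z"
    using dd_commute[OF S(1) Ck_on_SucD[OF C3] S(3)] by simp
  also have "\<dots> = dd ?V (dd ?V (dd ?B F)) ?z"
    using a by (simp add: accX_def eq_neg_iff_add_eq_0[symmetric])
  also have "\<dots> = dd ?B (dd ?V (dd ?V F)) ?z"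
    using dd_commute_inner[OF S(1) C3 S(3), of ?V ?V ?B] dd_commute[OF S(1) C2' S(3), of ?V ?B ?V] by simp
  finally show ?thesis using 1 by simp
qed

text \<open>Smoothness, (B1) and (B2) for \<open>F\<close>, without a curvature condition: the
  c-segments built here are what turns (B3) into the pointwise inequality added in
  \<open>cost\<close>. The inverse charts live on open neighbourhoods of the compact images, so that
  they have derivatives at boundary points too.\<close>

locale cost_pre =
  fixes U V :: "'a::euclidean_space set" and W :: "('a \<times> 'a) set" and F :: "'a \<times> 'a \<Rightarrow> real"
  assumes U: "open U" "bounded U" and V: "open V" "bounded V"
    and W: "open W" "closure U \<times> closure V \<subseteq> W" and Ck4: "Ck_on 4 W F"
    and invX: "\<And>y. y \<in> closure V \<Longrightarrow> \<exists>g T. open T \<and> (\<lambda>x. gY F x y) ` closure U \<subseteq> T \<and> Ck_on 1 T g \<and>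
        (\<forall>x\<in>closure U. g (gY F x y) = x)"
    and invY: "\<And>x. x \<in> closure U \<Longrightarrow> \<exists>g T. open T \<and> (\<lambda>y. gX F x y) ` closure V \<subseteq> T \<and> Ck_on 1 T g \<and>
        (\<forall>y\<in>closure V. g (gX F x y) = y)"
    and convX: "\<And>y. y \<in> closure V \<Longrightarrow> convex ((\<lambda>x. gY F x y) ` U)"
    and convY: "\<And>x. x \<in> closure U \<Longrightarrow> convex ((\<lambda>y. gX F x y) ` V)"
begin

lemma C4: "Ck_on (Suc (Suc (Suc (Suc 0)))) W F" using Ck4 by (simp add: eval_nat_numeral)
lemmas C3 = Ck_on_SucD[OF C4] and C3' = Ck_on_dd[OF W(1) C4]
lemmas C2 = Ck_on_SucD[OF C3] and C2' = Ck_on_SucD[OF C3'] and C2'' = Ck_on_dd[OF W(1) C3']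

lemma inW: "x \<in> closure U \<Longrightarrow> y \<in> closure V \<Longrightarrow> (x, y) \<in> W" using W by auto

lemma inW': "x \<in> U \<Longrightarrow> y \<in> V \<Longrightarrow> (x, y) \<in> W" using inW closure_subset by blast

lemma diffF: "z \<in> W \<Longrightarrow> F differentiable (at z)" "z \<in> W \<Longrightarrow> dd u F differentiable (at z)"
  "z \<in> W \<Longrightarrow> dd u (dd v F) differentiable (at z)"
  using Ck_on_differentiable[OF C4] Ck_on_differentiable[OF C3'] Ck_on_differentiable[OF C2''] by auto

lemma gX_cont: "continuous_on W (\<lambda>z. gX F (fst z) (snd z))"
  unfolding gX_def using Ck_on_continuous[OF C3'] by (auto intro!: continuous_intros)

lemma gY_cont: "continuous_on W (\<lambda>z. gY F (fst z) (snd z))"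
  unfolding gY_def using Ck_on_continuous[OF C3'] by (auto intro!: continuous_intros)

lemma continuous_on_slice_x:
  assumes "y \<in> closure V" "continuous_on W G"
  shows "continuous_on (closure U) (\<lambda>x. G (x, y))"
  by (rule continuous_on_compose2[OF assms(2)]) (use inW assms in \<open>auto intro!: continuous_intros\<close>)

lemma continuous_on_slice_y:
  assumes "x \<in> closure U" "continuous_on W G"
  shows "continuous_on (closure V) (\<lambda>y. G (x, y))"
  by (rule continuous_on_compose2[OF assms(2)]) (use inW assms in \<open>auto intro!: continuous_intros\<close>)

lemma gX_cont_y: "x \<in> closure U \<Longrightarrow> continuous_on (closure V) (gX F x)"
  using continuous_on_slice_y[OF _ gX_cont] by simp

lemma gY_cont_x: "y \<in> closure V \<Longrightarrow> continuous_on (closure U) (\<lambda>x. gY F x y)"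
  using continuous_on_slice_x[OF _ gY_cont] by simp

lemma inj_gY: "y \<in> closure V \<Longrightarrow> inj_on (\<lambda>x. gY F x y) (closure U)"
  using invX by (metis inj_on_inverseI)

lemma inj_gX: "x \<in> closure U \<Longrightarrow> inj_on (gX F x) (closure V)"
  using invY by (metis inj_on_inverseI)

lemma open_gY_image: "y \<in> closure V \<Longrightarrow> open ((\<lambda>x. gY F x y) ` U)"
  using closure_subset by (intro invariance_of_domain U continuous_on_subset[OF gY_cont_x] inj_on_subset[OF inj_gY]) auto

text \<open>That \<open>g'\<close> inverts \<open>hXY\<close> is the chain rule at points of
  \<open>U\<close>. At a boundary point the identity \<open>g (gY F x y) = x\<close> holds on no
  full neighbourhood, so there the relation is obtained by continuity.\<close>

lemma invX_deriv:
  assumes y: "y \<in> closure V"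
  obtains g g' where "\<And>x. x \<in> closure U \<Longrightarrow> g (gY F x y) = x"
    "\<And>x. x \<in> closure U \<Longrightarrow> (g has_derivative g' (gY F x y)) (at (gY F x y))"
    "\<And>x v. x \<in> closure U \<Longrightarrow> g' (gY F x y) (hXY F x y v) = v"
    "\<And>v. continuous_on ((\<lambda>x. gY F x y) ` closure U) (\<lambda>q. g' q v)"
proof -
  obtain g T where T: "open T" "(\<lambda>x. gY F x y) ` closure U \<subseteq> T" "Ck_on 1 T g"
    and g: "\<And>x. x \<in> closure U \<Longrightarrow> g (gY F x y) = x"
    using invX[OF y] by blast
  define g' where "g' q = frechet_derivative g (at q)" for q
  have g': "(g has_derivative g' q) (at q)" if "q \<in> T" for q
    using T(3) that by (auto simp: g'_def frechet_derivative_works[symmetric] intro: Ck_on_differentiable)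
  have lin: "linear (g' q)" if "q \<in> T" for q using has_derivative_linear[OF g'[OF that]] .
  have contO: "continuous_on T (\<lambda>q. g' q v)" for v
  proof -
    have "continuous_on T (\<lambda>q. \<Sum>b\<in>Basis. (v \<bullet> b) *\<^sub>R g' q b)"
      using T(3) by (auto intro!: continuous_intros simp: g'_def Ck_on.simps(2))
    moreover have "(\<Sum>b\<in>Basis. (v \<bullet> b) *\<^sub>R g' q b) = g' q v" if "q \<in> T" for q
    proof -
      have "g' q v = g' q (\<Sum>b\<in>Basis. (v \<bullet> b) *\<^sub>R b)" by (simp add: euclidean_representation)
      then show ?thesis by (simp add: linear_sum[OF lin[OF that]] linear_cmul[OF lin[OF that]])
    qed
    ultimately show ?thesis by (rule continuous_on_eq)
  qed
  have inv_U: "g' (gY F x y) (hXY F x y v) = v" if "x \<in> U" for x v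
  proof -
    have x: "x \<in> closure U" using that closure_subset by blast
    have "(g \<circ> (\<lambda>x. gY F x y) has_derivative g' (gY F x y) \<circ> hXY F x y) (at x)"
      using x y T(2) by (intro diff_chain_at gY_has_derivative[OF W(1) C2] g' inW) auto
    moreover have "((\<lambda>x. x) has_derivative g' (gY F x y) \<circ> hXY F x y) (at x)"
      by (rule has_derivative_transform_within_open[OF calculation U(1) that])
         (use g closure_subset in auto)
    ultimately have "g' (gY F x y) \<circ> hXY F x y = (\<lambda>v. v)"
      using has_derivative_unique has_derivative_ident by blast
    then show ?thesis by (metis comp_apply)
  qed
  have "g' (gY F x y) (hXY F x y v) = v" if "x \<in> closure U" for x v
  proof -
    have "continuous_on (closure U) (\<lambda>x. g' (gY F x y) (hXY F x y v))"
    proof -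
      have h: "continuous_on (closure U) (\<lambda>x. dd (v, 0) (dd (0, b) F) (x, y))" for b
        using continuous_on_slice_x[OF y Ck_on_continuous[OF Ck_on_dd[OF W(1) C3']]] .
      have c: "continuous_on (closure U) (\<lambda>x. g' (gY F x y) b)" for b
        using continuous_on_compose2[OF contO gY_cont_x[OF y]] T(2) by blast
      have "continuous_on (closure U) (\<lambda>x. \<Sum>b\<in>Basis. dd (v, 0) (dd (0, b) F) (x, y) *\<^sub>R g' (gY F x y) b)"
        by (intro continuous_intros h c)
      moreover have "(\<Sum>b\<in>Basis. dd (v, 0) (dd (0, b) F) (x, y) *\<^sub>R g' (gY F x y) b) = g' (gY F x y) (hXY F x y v)"
        if "x \<in> closure U" for x
        using lin[of "gY F x y"] T(2) that by (auto simp: hXY_def linear_sum linear_cmul)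
      ultimately show ?thesis by (rule continuous_on_eq)
    qed
    then have "closed {x \<in> closure U. g' (gY F x y) (hXY F x y v) = v}"
      by (intro continuous_closed_preimage_constant) auto
    moreover have "U \<subseteq> {x \<in> closure U. g' (gY F x y) (hXY F x y v) = v}"
      using inv_U closure_subset by blast
    ultimately have "closure U \<subseteq> {x \<in> closure U. g' (gY F x y) (hXY F x y v) = v}"
      by (rule closure_minimal[rotated])
    with that show ?thesis by blast
  qed
  with g g' T(2) continuous_on_subset[OF contO T(2)] show ?thesis
    by (intro that[of g g']) auto
qed

text \<open>Nondegeneracy of the mixed Hessian up to the boundary, a consequence of the
  differentiable inverse chart.\<close>

lemma hXY_inj:
  assumes "x \<in> closure U" "y \<in> closure V" "hXY F x y v = hXY F x y v'"
  shows "v = v'"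
  using invX_deriv[OF assms(2)] assms by metis

text \<open>A c-segment is the image of a line under \<open>g\<close>, but \<open>g\<close> is only
  C^1 while two derivatives are wanted. The second one comes from the relation
  \<open>hXY F (x t) y (x' t) = q\<close>, whose coefficients are smoother than
  \<open>g\<close>.\<close>

lemma segX:
  assumes y: "y \<in> closure V"
  shows "\<exists>x x' x''. \<forall>t. p + t *\<^sub>R q \<in> (\<lambda>x. gY F x y) ` U \<longrightarrow>
    x t \<in> U \<and> gY F (x t) y = p + t *\<^sub>R q \<and> (x has_vector_derivative x' t) (at t) \<and>
    (x' has_vector_derivative x'' t) (at t) \<and> hXY F (x t) y (x' t) = q \<and> accX F (x t) y (x' t) (x'' t)"
proof -
  obtain g g' where g: "\<And>x. x \<in> closure U \<Longrightarrow> g (gY F x y) = x"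
    and g': "\<And>x. x \<in> closure U \<Longrightarrow> (g has_derivative g' (gY F x y)) (at (gY F x y))"
    and inv: "\<And>x v. x \<in> closure U \<Longrightarrow> g' (gY F x y) (hXY F x y v) = v"
    and cont: "\<And>v. continuous_on ((\<lambda>x. gY F x y) ` closure U) (\<lambda>q. g' q v)"
    using invX_deriv[OF y] by metis
  define C where "C = {t. p + t *\<^sub>R q \<in> (\<lambda>x. gY F x y) ` U}"
  have "open ((\<lambda>t. p + t *\<^sub>R q) -` ((\<lambda>x. gY F x y) ` U))"
    by (intro open_vimage open_gY_image y continuous_intros)
  then have C: "open C" by (simp add: C_def vimage_def)
  define x where "x t = g (p + t *\<^sub>R q)" for t
  define x' where "x' t = g' (p + t *\<^sub>R q) q" for t
  have clU: "u \<in> closure U" if "u \<in> U" for u using that closure_subset by blast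
  have x: "x t \<in> U" "gY F (x t) y = p + t *\<^sub>R q" if t: "t \<in> C" for t
  proof -
    from t obtain u where "u \<in> U" "p + t *\<^sub>R q = gY F u y" by (auto simp: C_def)
    then show "x t \<in> U" "gY F (x t) y = p + t *\<^sub>R q" using g clU by (auto simp: x_def)
  qed
  note xcl = clU[OF x(1)]
  have xW: "(x t, y) \<in> W" if "t \<in> C" for t using inW[OF xcl[OF that] y] .
  have line: "((\<lambda>t. p + t *\<^sub>R q) has_vector_derivative q) (at t)" for t
    by (auto intro!: derivative_eq_intros)
  have dx: "(x has_vector_derivative x' t) (at t)" if t: "t \<in> C" for t
  proof -
    have "(g has_derivative g' (p + t *\<^sub>R q)) (at (p + t *\<^sub>R q))"
      using g'[OF xcl[OF t]] x(2)[OF t] by simp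
    from vector_derivative_diff_chain_within[OF line this[THEN has_derivative_at_withinI]]
    show ?thesis by (simp add: x_def[abs_def] x'_def comp_def)
  qed
  have Hq: "hXY F (x t) y (x' t) = q" if t: "t \<in> C" for t
  proof -
    have "((\<lambda>s. gY F (x s) y) has_vector_derivative hXY F (x t) y (x' t)) (at t)"
      using vector_derivative_diff_chain_within[OF dx[OF t]
          gY_has_derivative[OF W(1) C2 xW[OF t], THEN has_derivative_at_withinI]]
      by (simp add: comp_def)
    then have "((\<lambda>s. p + s *\<^sub>R q) has_vector_derivative hXY F (x t) y (x' t)) (at t)"
      by (rule has_vector_derivative_transform_within_open[OF _ C t]) (simp add: x)
    then show ?thesis using line vector_derivative_unique_at by blast
  qed
  have dx': "\<exists>d. (x' has_vector_derivative d) (at t)" if t: "t \<in> C" for t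
  proof -
    define L where "L = g' (gY F (x t) y)"
    have linL: "bounded_linear L" using g'[OF xcl[OF t]] has_derivative_bounded_linear unfolding L_def by blast
    define m where "m e b s = dd (e, 0) (dd (0, b) F) (x s, y)" for e b s
    have "isCont (\<lambda>s. x' s) t"
    proof -
      have "continuous_on C x'"
        unfolding x'_def
        by (rule continuous_on_compose2[OF cont])
           (use x xcl in \<open>auto intro!: continuous_intros simp: image_iff, metis\<close>)
      then show ?thesis using C t by (simp add: continuous_on_eq_continuous_at)
    qed
    then have cx': "isCont (\<lambda>s. x' s \<bullet> e) t" for e by (intro continuous_intros)
    have "\<exists>d. (m e b has_real_derivative d) (at t)" for e b
    proof -
      have "((\<lambda>s. (x s, y)) has_vector_derivative (x' t, 0)) (at t)"
        by (intro has_vector_derivative_Pair dx t has_vector_derivative_const)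
      from dd_curve[OF diffF(3)[OF xW[OF t]] this] show ?thesis unfolding m_def[abs_def] by blast
    qed
    then obtain m' where m': "\<And>e b. (m e b has_real_derivative m' e b) (at t)" by metis
    \<comment> \<open>At this stage \<open>x'\<close> is only continuous at \<open>t\<close>. The
      other factor is differentiable and vanishes there, and in Caratheodory's form of the
      derivative this makes the product differentiable.\<close>
    have prod: "((\<lambda>s. (x' s \<bullet> e) * (m e b t - m e b s)) has_real_derivative (x' t \<bullet> e) * (- m' e b)) (at t)" for e b
    proof -
      have "((\<lambda>s. m e b t - m e b s) has_real_derivative - m' e b) (at t)"
        using DERIV_diff[OF DERIV_const m'] by simp
      then obtain k where k: "\<And>s. m e b t - m e b s - (m e b t - m e b t) = k s * (s - t)" "isCont k t" "k t = - m' e b"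
        unfolding CARAT_DERIV by blast
      have "isCont (\<lambda>s. (x' s \<bullet> e) * k s) t" by (intro continuous_intros cx' k(2))
      then show ?thesis unfolding CARAT_DERIV
        by (intro exI[of _ "\<lambda>s. (x' s \<bullet> e) * k s"]) (use k in auto)
    qed
    define R where "R s = (\<Sum>b\<in>Basis. (\<Sum>e\<in>Basis. (x' s \<bullet> e) * (m e b t - m e b s)) *\<^sub>R b)" for s :: real
    define d where "d = (\<Sum>b\<in>Basis. (\<Sum>e\<in>Basis. (x' t \<bullet> e) * (- m' e b)) *\<^sub>R b)"
    have inner: "((\<lambda>s. \<Sum>e\<in>Basis. (x' s \<bullet> e) * (m e b t - m e b s)) has_vector_derivative
        (\<Sum>e\<in>Basis. (x' t \<bullet> e) * (- m' e b))) (at t)" for b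
      by (rule has_vector_derivative_sum) (rule prod[unfolded has_real_derivative_iff_has_vector_derivative])
    have d: "(R has_vector_derivative d) (at t)"
      unfolding R_def d_def
      by (rule has_vector_derivative_sum, rule bounded_linear.has_vector_derivative[OF bounded_linear_scaleR_left inner])
    \<comment> \<open>Write H_s for \<open>hXY F (x s) y\<close>. Then \<open>R s\<close> is (H_t -
      H_s) applied to \<open>x' s\<close>, and since H_s (x' s) = q = H_t (x' t) it equals H_t (x' s
      - x' t). The inverse \<open>L\<close> of H_t recovers \<open>x' s\<close>.\<close>
    have eq: "x' t + L (R s) = x' s" if s: "s \<in> C" for s
    proof -
      have hb: "hXY F (x r) y v = (\<Sum>b\<in>Basis. (\<Sum>e\<in>Basis. (v \<bullet> e) * m e b r) *\<^sub>R b)" if "r \<in> C" for r v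
      proof -
        have "dd (v, 0) (dd (0, b) F) (x r, y) = (\<Sum>e\<in>Basis. (v \<bullet> e) * m e b r)" for b
        proof -
          have l: "linear (\<lambda>v. dd (v, 0) (dd (0, b) F) (x r, y))"
            using linear_compose[OF linear_Pair_right linear_dd[OF diffF(2)[OF xW[OF that]]]] by (simp add: comp_def)
          have "dd (v, 0) (dd (0, b) F) (x r, y) = (\<lambda>v. dd (v, 0) (dd (0, b) F) (x r, y)) (\<Sum>e\<in>Basis. (v \<bullet> e) *\<^sub>R e)"
            by (simp add: euclidean_representation)
          then show ?thesis unfolding linear_sum[OF l] linear_cmul[OF l] by (simp add: m_def)
        qed
        then show ?thesis by (simp add: hXY_def)
      qed
      have "R s = hXY F (x t) y (x' s) - hXY F (x s) y (x' s)"
        by (simp add: R_def hb s t right_diff_distrib sum_subtractf scaleR_left_diff_distrib)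
      then have "R s = hXY F (x t) y (x' s) - hXY F (x t) y (x' t)" by (simp add: Hq s t)
      then have "L (R s) = x' s - x' t"
        using inv[OF xcl[OF t]] bounded_linear.linear[OF linL] by (simp add: linear_diff L_def)
      then show ?thesis by simp
    qed
    have "((\<lambda>s. x' t + L (R s)) has_vector_derivative 0 + L d) (at t)"
      by (intro has_vector_derivative_add has_vector_derivative_const bounded_linear.has_vector_derivative[OF linL d])
    then have "(x' has_vector_derivative 0 + L d) (at t)"
      by (rule has_vector_derivative_transform_within_open[OF _ C t]) (rule eq)
    then show ?thesis by blast
  qed
  define x'' where "x'' t = vector_derivative x' (at t)" for t
  have dx'': "(x' has_vector_derivative x'' t) (at t)" if "t \<in> C" for t
    using dx'[OF that] unfolding x''_def by (auto simp: vector_derivative_works[symmetric] differentiableI_vector)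
  have acc: "accX F (x t) y (x' t) (x'' t)" if t: "t \<in> C" for t
    unfolding accX_def
  proof
    fix w
    have "((\<lambda>s. dd (x' s, 0) (dd (0, w) F) (x s, y)) has_real_derivative
        dd (x'' t, 0) (dd (0, w) F) (x t, y) + dd (x' t, 0) (dd (x' t, 0) (dd (0, w) F)) (x t, y)) (at t)"
      by (rule dd_curve2[OF W(1) C2' C t, where z = "\<lambda>s. (x s, y)" and z' = "\<lambda>s. (x' s, 0)"])
         (auto intro!: has_vector_derivative_Pair dx dx'' t xW has_vector_derivative_const)
    then have "((\<lambda>s. q \<bullet> w) has_real_derivative
        dd (x'' t, 0) (dd (0, w) F) (x t, y) + dd (x' t, 0) (dd (x' t, 0) (dd (0, w) F)) (x t, y)) (at t)"
      by (rule has_field_derivative_transform_within_open[OF _ C t])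
         (simp add: hXY_inner[OF W(1) C2 xW, symmetric] Hq)
    then show "dd (x' t, 0) (dd (x' t, 0) (dd (0, w) F)) (x t, y) + dd (x'' t, 0) (dd (0, w) F) (x t, y) = 0"
      using DERIV_unique DERIV_const by (metis add.commute)
  qed
  show ?thesis
    by (rule exI[of _ x], rule exI[of _ x'], rule exI[of _ x'']) (use x dx dx'' Hq acc in \<open>auto simp: C_def\<close>)
qed

end

section \<open>Convexity along c-segments\<close>

lemma swap_image_eq_vimage: "prod.swap ` S = prod.swap -` S"
  by force

lemma open_swap_image: "open S \<Longrightarrow> open (prod.swap ` S :: ('b::topological_space \<times> 'a::topological_space) set)"
  unfolding swap_image_eq_vimage by (intro open_vimage continuous_on_swap)

lemma swap_has_derivative: "(prod.swap has_derivative prod.swap) (at z)"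
  unfolding prod.swap_def by (auto intro!: derivative_eq_intros)

lemma comp_swap_has_derivative:
  assumes "G differentiable (at z)"
  shows "(G \<circ> prod.swap has_derivative (\<lambda>p. dd (prod.swap p) G z)) (at (prod.swap z))"
  using diff_chain_at[OF swap_has_derivative, of G _ "prod.swap z"] has_derivative_dd[OF assms]
  by (simp add: comp_def)

lemma dd_swap:
  fixes G :: "'a::euclidean_space \<times> 'a \<Rightarrow> real"
  assumes W: "open W" "Ck_on (Suc k) W G" and eq: "\<And>z. z \<in> W \<Longrightarrow> H (prod.swap z) = G z" and z: "z \<in> W"
  shows "dd p H (prod.swap z) = dd (prod.swap p) G z"
proof -
  have d: "(G \<circ> prod.swap has_derivative (\<lambda>p. dd (prod.swap p) G z)) (at (prod.swap z))"
    using W z by (intro comp_swap_has_derivative) (auto intro: Ck_on_differentiable)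
  then have "dd p (G \<circ> prod.swap) (prod.swap z) = dd p H (prod.swap z)"
    by (intro dd_cong[OF open_swap_image[OF W(1)]]) (use z eq in \<open>auto simp: differentiable_def\<close>)
  then show ?thesis using dd_eqI[OF d] by simp
qed

lemma Ck_on_swap:
  fixes G :: "'a::euclidean_space \<times> 'a \<Rightarrow> real"
  assumes "open W" "Ck_on k W G"
  shows "Ck_on k (prod.swap ` W) (G \<circ> prod.swap)"
  using assms(2)
proof (induction k arbitrary: G)
  case 0
  then have "continuous_on W G" by simp
  then have "continuous_on (prod.swap ` W) (\<lambda>z. G (prod.swap z))"
    by (rule continuous_on_compose2[OF _ continuous_on_swap]) auto
  then show ?case by (simp add: comp_def)
next
  case (Suc k)
  have "(G \<circ> prod.swap) differentiable (at z)" if z: "z \<in> prod.swap ` W" for z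
  proof -
    from z obtain w where w: "w \<in> W" "z = prod.swap w" by blast
    have "G differentiable (at w)" using Suc.prems w(1) by (auto intro: Ck_on_differentiable)
    from comp_swap_has_derivative[OF this] show ?thesis unfolding w(2) differentiable_def by blast
  qed
  moreover have "Ck_on k (prod.swap ` W) (dd b (G \<circ> prod.swap))" for b
  proof (rule Ck_on_cong[OF open_swap_image[OF assms(1)]])
    show "Ck_on k (prod.swap ` W) (dd (prod.swap b) G \<circ> prod.swap)"
      by (rule Suc.IH) (rule Ck_on_dd[OF assms(1) Suc.prems])
    fix z assume "z \<in> prod.swap ` W"
    then obtain w where w: "w \<in> W" "z = prod.swap w" by blast
    have "dd b (G \<circ> prod.swap) (prod.swap w) = dd (prod.swap b) G w"
      by (rule dd_swap[OF assms(1) Suc.prems _ w(1)]) simp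
    then show "(dd (prod.swap b) G \<circ> prod.swap) z = dd b (G \<circ> prod.swap) z"
      unfolding w(2) comp_apply swap_swap by (rule sym)
  qed
  ultimately show ?case unfolding Ck_on_Suc_iff_dd by blast
qed

context cost_pre
begin

abbreviation "Fs \<equiv> F \<circ> prod.swap"

lemma dd_Fs:
  assumes "z \<in> W"
  shows "dd p Fs (prod.swap z) = dd (prod.swap p) F z"
    and "dd p (dd q Fs) (prod.swap z) = dd (prod.swap p) (dd (prod.swap q) F) z"
    and "dd p (dd q (dd r Fs)) (prod.swap z) = dd (prod.swap p) (dd (prod.swap q) (dd (prod.swap r) F)) z"
    and "dd p (dd q (dd r (dd s Fs))) (prod.swap z)
      = dd (prod.swap p) (dd (prod.swap q) (dd (prod.swap r) (dd (prod.swap s) F))) z"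
proof -
  have 1: "dd p Fs (prod.swap z) = dd (prod.swap p) F z" if "z \<in> W" for p z
    by (rule dd_swap[OF W(1) C4 _ that]) simp
  have 2: "dd p (dd q Fs) (prod.swap z) = dd (prod.swap p) (dd (prod.swap q) F) z" if "z \<in> W" for p q z
    by (rule dd_swap[OF W(1) C3' _ that]) (rule 1)
  have 3: "dd p (dd q (dd r Fs)) (prod.swap z) = dd (prod.swap p) (dd (prod.swap q) (dd (prod.swap r) F)) z"
    if "z \<in> W" for p q r z
    by (rule dd_swap[OF W(1) C2'' _ that]) (rule 2)
  show "dd p Fs (prod.swap z) = dd (prod.swap p) F z"
    "dd p (dd q Fs) (prod.swap z) = dd (prod.swap p) (dd (prod.swap q) F) z"
    "dd p (dd q (dd r Fs)) (prod.swap z) = dd (prod.swap p) (dd (prod.swap q) (dd (prod.swap r) F)) z"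
    using 1 2 3 assms by blast+
  show "dd p (dd q (dd r (dd s Fs))) (prod.swap z)
      = dd (prod.swap p) (dd (prod.swap q) (dd (prod.swap r) (dd (prod.swap s) F))) z"
    by (rule dd_swap[OF W(1) Ck_on_dd[OF W(1) C2''] _ assms]) (rule 3)
qed

lemma gX_Fs: "(x, y) \<in> W \<Longrightarrow> gX Fs y x = gY F x y"
  unfolding gX_def gY_def using dd_Fs(1)[of "(x, y)"] by simp

lemma gY_Fs: "(x, y) \<in> W \<Longrightarrow> gY Fs y x = gX F x y"
  unfolding gX_def gY_def using dd_Fs(1)[of "(x, y)"] by simp

lemma accX_Fs: "(x, y) \<in> W \<Longrightarrow> accX Fs y x w b \<longleftrightarrow> accY F x y w b"
  unfolding accX_def accY_def using dd_Fs(2,3)[of "(x, y)"] by simp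

lemma accY_Fs: "(x, y) \<in> W \<Longrightarrow> accY Fs y x v a \<longleftrightarrow> accX F x y v a"
  unfolding accX_def accY_def using dd_Fs(2,3)[of "(x, y)"] by simp

lemma cost_pre_swap: "cost_pre V U (prod.swap ` W) Fs"
proof
  show "open (prod.swap ` W)" using W(1) by (rule open_swap_image)
  show "closure V \<times> closure U \<subseteq> prod.swap ` W" using W(2) by force
  show "Ck_on 4 (prod.swap ` W) Fs" using W(1) Ck4 by (rule Ck_on_swap)
  show "\<exists>g T. open T \<and> (\<lambda>x. gY Fs x y) ` closure V \<subseteq> T \<and> Ck_on 1 T g \<and> (\<forall>x\<in>closure V. g (gY Fs x y) = x)"
    if "y \<in> closure U" for y
    using invY[OF that] gY_Fs inW[OF that] by (simp add: image_subset_iff) 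
  show "\<exists>g T. open T \<and> (\<lambda>y. gX Fs x y) ` closure U \<subseteq> T \<and> Ck_on 1 T g \<and> (\<forall>y\<in>closure U. g (gX Fs x y) = y)"
    if "x \<in> closure V" for x
    using invX[OF that] gX_Fs inW[OF _ that] by (simp add: image_subset_iff)
  show "convex ((\<lambda>x. gY Fs x y) ` V)" if "y \<in> closure U" for y
  proof -
    have "(\<lambda>x. gY Fs x y) ` V = (\<lambda>x. gX F y x) ` V"
      using gY_Fs inW[OF that] closure_subset[of V] by (intro image_cong) auto
    then show ?thesis using convY[OF that] by simp
  qed
  show "convex ((\<lambda>y. gX Fs x y) ` U)" if "x \<in> closure V" for x
  proof -
    have "(\<lambda>y. gX Fs x y) ` U = (\<lambda>y. gY F y x) ` U"
      using gX_Fs inW[OF _ that] closure_subset[of U] by (intro image_cong) auto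
    then show ?thesis using convX[OF that] by simp
  qed
qed (use U V in auto)

lemma segY:
  assumes x: "x \<in> closure U"
  shows "\<exists>y y' y''. \<forall>t. p + t *\<^sub>R q \<in> gX F x ` V \<longrightarrow>
    y t \<in> V \<and> gX F x (y t) = p + t *\<^sub>R q \<and> (y has_vector_derivative y' t) (at t) \<and>
    (y' has_vector_derivative y'' t) (at t) \<and> accY F x (y t) (y' t) (y'' t)"
proof -
  interpret sw: cost_pre V U "prod.swap ` W" Fs by (rule cost_pre_swap)
  have im: "(\<lambda>y. gY Fs y x) ` V = gX F x ` V"
    using gY_Fs inW[OF x] closure_subset[of V] by (intro image_cong) auto
  obtain y y' y'' where *: "\<And>t. p + t *\<^sub>R q \<in> gX F x ` V \<Longrightarrow>
    y t \<in> V \<and> gY Fs (y t) x = p + t *\<^sub>R q \<and> (y has_vector_derivative y' t) (at t) \<and>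
    (y' has_vector_derivative y'' t) (at t) \<and> hXY Fs (y t) x (y' t) = q \<and> accX Fs (y t) x (y' t) (y'' t)"
    using sw.segX[OF x, of p q, unfolded im] by metis
  have "y t \<in> V \<and> gX F x (y t) = p + t *\<^sub>R q \<and> (y has_vector_derivative y' t) (at t) \<and>
    (y' has_vector_derivative y'' t) (at t) \<and> accY F x (y t) (y' t) (y'' t)"
    if "p + t *\<^sub>R q \<in> gX F x ` V" for t
  proof -
    have "(x, y t) \<in> W" using *[OF that] inW[OF x] closure_subset[of V] by blast
    then show ?thesis using *[OF that] gY_Fs accX_Fs by auto
  qed
  then show ?thesis by blast
qed

text \<open>The acceleration is read off at time 0 from the c-segment that leaves \<open>x\<close>
  with velocity \<open>v\<close>.\<close>

lemma accX_exists:
  assumes "x \<in> U" "y \<in> closure V"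
  shows "\<exists>a. accX F x y v a"
proof -
  have x: "x \<in> closure U" using assms(1) closure_subset by blast
  obtain c c' c'' where *: "\<And>t. gY F x y + t *\<^sub>R hXY F x y v \<in> (\<lambda>x. gY F x y) ` U \<Longrightarrow>
    c t \<in> U \<and> gY F (c t) y = gY F x y + t *\<^sub>R hXY F x y v \<and>
    hXY F (c t) y (c' t) = hXY F x y v \<and> accX F (c t) y (c' t) (c'' t)"
    using segX[OF assms(2), of "gY F x y" "hXY F x y v"] by metis
  have "gY F x y + 0 *\<^sub>R hXY F x y v \<in> (\<lambda>x. gY F x y) ` U" using assms(1) by simp
  note c = *[OF this]
  have "c 0 = x"
    using c x closure_subset[of U] inj_onD[OF inj_gY[OF assms(2)], of "c 0" x] by auto
  with c hXY_inj[OF x assms(2), of "c' 0" v] show ?thesis by auto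
qed

end

text \<open>The fourth derivative in (B3), written for \<open>F\<close> = -c along c-segments with
  velocities \<open>v\<close>, \<open>w\<close> and accelerations \<open>a\<close>,
  \<open>b\<close>. The two terms of the expansion that contain \<open>b\<close> cancel by
  \<open>accX\<close>, so only these two remain.\<close>

locale cost = cost_pre +
  assumes cross: "\<And>x y v w a b. x \<in> U \<Longrightarrow> y \<in> V \<Longrightarrow> accX F x y v a \<Longrightarrow> accY F x y w b \<Longrightarrow>
      0 \<le> dd (v, 0) (dd (v, 0) (dd (0, w) (dd (0, w) F))) (x, y) + dd (a, 0) (dd (0, w) (dd (0, w) F)) (x, y)"
begin

lemma cost_swap: "cost V U (prod.swap ` W) Fs"
proof (intro cost.intro cost_pre_swap cost_axioms.intro)
  fix y x v w a b
  assume xy: "y \<in> V" "x \<in> U" and acc: "accX Fs y x v a" "accY Fs y x w b"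
  have z: "(x, y) \<in> W" using inW' xy by blast
  have acc': "accX F x y w b" "accY F x y v a" using acc accX_Fs[OF z] accY_Fs[OF z] by auto
  have "0 \<le> dd (0, v) (dd (0, v) (dd (w, 0) (dd (w, 0) F))) (x, y) + dd (0, a) (dd (w, 0) (dd (w, 0) F)) (x, y)"
    using cross[OF xy(2,1) acc'] cross_eq[OF W(1) Ck4 z acc'] by simp
  then show "0 \<le> dd (v, 0) (dd (v, 0) (dd (0, w) (dd (0, w) Fs))) (y, x) + dd (a, 0) (dd (0, w) (dd (0, w) Fs)) (y, x)"
    using dd_Fs(3,4)[OF z] by simp
qed

text \<open>Along the c-segment from \<open>y0\<close> to \<open>y1\<close> the quantity to be compared is convex by the
  cross-curvature condition, and its derivative at \<open>y0\<close> vanishes by the choice of \<open>a\<close>.\<close>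

lemma second_derivative_mono:
  assumes x: "x \<in> U" and y: "y0 \<in> V" "y1 \<in> V" and acc: "accX F x y0 v a"
  shows "dd (v, 0) (dd (v, 0) F) (x, y0) + dd (a, 0) F (x, y0) \<le> dd (v, 0) (dd (v, 0) F) (x, y1) + dd (a, 0) F (x, y1)"
proof -
  have xcl: "x \<in> closure U" using x closure_subset by blast
  define p where "p = gX F x y0"
  define q where "q = gX F x y1 - p"
  define C where "C = {t. p + t *\<^sub>R q \<in> gX F x ` V}"
  have im: "(\<lambda>y. gY Fs y x) ` V = gX F x ` V"
    using gY_Fs inW[OF xcl] closure_subset[of V] by (intro image_cong) auto
  have opn: "open (gX F x ` V)" using cost_pre.open_gY_image[OF cost_pre_swap xcl] unfolding im .
  have "open ((\<lambda>t. p + t *\<^sub>R q) -` (gX F x ` V))"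
    by (rule open_vimage[OF opn]) (intro continuous_intros)
  then have C: "open C" by (simp add: C_def vimage_def)
  have Cconv: "convex C"
  proof (rule convexI)
    fix s t u w :: real assume *: "s \<in> C" "t \<in> C" "0 \<le> u" "0 \<le> w" "u + w = 1"
    have "u *\<^sub>R (p + s *\<^sub>R q) + w *\<^sub>R (p + t *\<^sub>R q) \<in> gX F x ` V"
      using * by (intro convexD[OF convY[OF xcl]]) (auto simp: C_def)
    moreover have "u *\<^sub>R (p + s *\<^sub>R q) + w *\<^sub>R (p + t *\<^sub>R q) = (u + w) *\<^sub>R p + (u *\<^sub>R s + w *\<^sub>R t) *\<^sub>R q"
      by (simp add: algebra_simps)
    ultimately show "u *\<^sub>R s + w *\<^sub>R t \<in> C" using *(5) by (simp add: C_def)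
  qed
  obtain c c' c'' where *: "\<And>t. t \<in> C \<Longrightarrow>
    c t \<in> V \<and> gX F x (c t) = p + t *\<^sub>R q \<and> (c has_vector_derivative c' t) (at t) \<and>
    (c' has_vector_derivative c'' t) (at t) \<and> accY F x (c t) (c' t) (c'' t)"
    using segY[OF xcl, of p q] unfolding C_def by (metis mem_Collect_eq)
  have 01: "0 \<in> C" "1 \<in> C" using y by (auto simp: C_def p_def q_def)
  have Vcl: "t \<in> V \<Longrightarrow> t \<in> closure V" for t using closure_subset by blast
  have c0: "c 0 = y0" using *[OF 01(1)] y(1) Vcl by - (rule inj_onD[OF inj_gX[OF xcl]], auto simp: p_def q_def)
  have c1: "c 1 = y1" using *[OF 01(2)] y(2) Vcl by - (rule inj_onD[OF inj_gX[OF xcl]], auto simp: p_def q_def)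
  define G where "G z = dd (v, 0) (dd (v, 0) F) z + dd (a, 0) F z" for z
  have cW: "(x, c t) \<in> W" if "t \<in> C" for t using * that inW'[OF x] by blast
  have dz: "((\<lambda>t. (x, c t)) has_vector_derivative (0, c' t)) (at t)" if "t \<in> C" for t
    using *[OF that] by (intro has_vector_derivative_Pair has_vector_derivative_const) auto
  have dz': "((\<lambda>t. (0, c' t)) has_vector_derivative (0, c'' t)) (at t)" if "t \<in> C" for t
    using *[OF that] by (intro has_vector_derivative_Pair has_vector_derivative_const) auto
  have GCk: "Ck_on (Suc (Suc 0)) W G"
    unfolding G_def by (intro Ck_on_add W(1) Ck_on_dd[OF W(1) C3'] C2')
  have ddG: "dd r G z = dd r (dd (v, 0) (dd (v, 0) F)) z + dd r (dd (a, 0) F) z" if "z \<in> W" for r z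
    unfolding G_def using diffF that by (intro dd_add) auto
  have dddG: "dd s (dd r G) z = dd s (dd r (dd (v, 0) (dd (v, 0) F))) z + dd s (dd r (dd (a, 0) F)) z"
    if z: "z \<in> W" for s r z
  proof -
    have "Ck_on (Suc 0) W (dd r (dd (v, 0) (dd (v, 0) F)))" by (intro Ck_on_dd[OF W(1)] C2'' )
    then have df: "dd r (dd (v, 0) (dd (v, 0) F)) differentiable at z"
      using z Ck_on_differentiable by blast
    have "dd s (dd r G) z = dd s (\<lambda>z. dd r (dd (v, 0) (dd (v, 0) F)) z + dd r (dd (a, 0) F) z) z"
      by (rule dd_cong[OF W(1) z]) (use Ck_on_differentiable[OF Ck_on_dd[OF W(1) GCk] _ z] ddG in auto)
    then show ?thesis using dd_add[OF df diffF(3)[OF z]] by simp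
  qed
  have d1: "((\<lambda>t. G (x, c t)) has_real_derivative dd (0, c' t) G (x, c t)) (at t)" if "t \<in> C" for t
    using Ck_on_differentiable[OF GCk _ cW[OF that]] by (intro dd_curve dz that) auto
  have d2: "((\<lambda>t. dd (0, c' t) G (x, c t)) has_real_derivative
      dd (0, c'' t) G (x, c t) + dd (0, c' t) (dd (0, c' t) G) (x, c t)) (at t)" if "t \<in> C" for t
    by (rule dd_curve2[OF W(1) GCk C that cW dz dz'[OF that]])
  \<comment> \<open>\<open>a\<close> is the acceleration belonging to \<open>y0\<close>, not to
    \<open>c t\<close>. This does no harm: the terms with \<open>a\<close> cancel by
    \<open>accY\<close>, and what remains is the cross-curvature at \<open>c t\<close>, to which
    \<open>cross\<close> applies with the acceleration \<open>a'\<close> found there.\<close>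
  have nonneg: "0 \<le> dd (0, c'' t) G (x, c t) + dd (0, c' t) (dd (0, c' t) G) (x, c t)" if t: "t \<in> C" for t
  proof -
    have V': "c t \<in> V" and accY: "accY F x (c t) (c' t) (c'' t)" using *[OF t] by auto
    obtain a' where a': "accX F x (c t) v a'" using accX_exists[OF x Vcl[OF V']] by blast
    have "dd (0, c' t) (dd (0, c' t) (dd (a, 0) F)) (x, c t) + dd (0, c'' t) (dd (a, 0) F) (x, c t) = 0"
      using accY by (simp add: accY_def)
    moreover have "0 \<le> dd (0, c' t) (dd (0, c' t) (dd (v, 0) (dd (v, 0) F))) (x, c t) + dd (0, c'' t) (dd (v, 0) (dd (v, 0) F)) (x, c t)"
      using cross[OF x V' a' accY] cross_eq[OF W(1) Ck4 cW[OF t] a' accY] by simp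
    ultimately show ?thesis by (simp add: ddG[OF cW[OF t]] dddG[OF cW[OF t]])
  qed
  have conv: "convex_on C (\<lambda>t. G (x, c t))"
    by (rule f''_ge0_imp_convex[OF Cconv d1 d2 nonneg])
  have z0: "(x, y0) \<in> W" using inW' x y by blast
  have "dd (0, c' 0) G (x, c 0) = 0"
  proof -
    have "dd (0, c' 0) (dd (v, 0) (dd (v, 0) F)) (x, y0) = dd (v, 0) (dd (v, 0) (dd (0, c' 0) F)) (x, y0)"
      using dd_commute[OF W(1) C2' z0, of "(0, c' 0)" "(v, 0)" "(v, 0)"] dd_commute_inner[OF W(1) C3 z0, of "(v, 0)" "(0, c' 0)" "(v, 0)"]
      by simp
    moreover have "dd (0, c' 0) (dd (a, 0) F) (x, y0) = dd (a, 0) (dd (0, c' 0) F) (x, y0)"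
      by (rule dd_commute[OF W(1) C2 z0])
    ultimately show ?thesis using acc unfolding accX_def c0 ddG[OF z0] by simp
  qed
  then have "((\<lambda>t. G (x, c t)) has_real_derivative 0) (at 0 within C)"
    using d1[OF 01(1)] by (simp add: has_field_derivative_at_within)
  from convex_on_imp_above_tangent[OF conv convex_connected[OF Cconv] _ 01(2) this]
  have "G (x, c 0) \<le> G (x, c 1)" using C 01 by (simp add: interior_open)
  then show ?thesis by (simp add: c0 c1 G_def)
qed

text \<open>Along the c-segment with respect to \<open>y0\<close> the second derivative of the
  difference of the two costs is the increment estimated in \<open>second_derivative_mono\<close>,
  for the velocity and acceleration of the segment itself.\<close>

lemma primal_convex_interior:
  assumes x: "x0 \<in> U" "x1 \<in> U" "xr \<in> U" and y: "y0 \<in> V" "y1 \<in> V" and r: "0 \<le> r" "r \<le> 1"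
    and seg: "gY F xr y0 = (1 - r) *\<^sub>R gY F x0 y0 + r *\<^sub>R gY F x1 y0"
  shows "F (xr, y1) - F (xr, y0) \<le> (1 - r) * (F (x0, y1) - F (x0, y0)) + r * (F (x1, y1) - F (x1, y0))"
proof -
  have ycl: "y0 \<in> closure V" using y closure_subset by blast
  define p where "p = gY F x0 y0"
  define q where "q = gY F x1 y0 - p"
  define C where "C = {t. p + t *\<^sub>R q \<in> (\<lambda>x. gY F x y0) ` U}"
  have "open ((\<lambda>t. p + t *\<^sub>R q) -` ((\<lambda>x. gY F x y0) ` U))"
    by (intro open_vimage open_gY_image ycl continuous_intros)
  then have C: "open C" by (simp add: C_def vimage_def)
  have Cconv: "convex C"
  proof (rule convexI)
    fix s t u w :: real assume *: "s \<in> C" "t \<in> C" "0 \<le> u" "0 \<le> w" "u + w = 1"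
    have "u *\<^sub>R (p + s *\<^sub>R q) + w *\<^sub>R (p + t *\<^sub>R q) \<in> (\<lambda>x. gY F x y0) ` U"
      using * by (intro convexD[OF convX[OF ycl]]) (auto simp: C_def)
    moreover have "u *\<^sub>R (p + s *\<^sub>R q) + w *\<^sub>R (p + t *\<^sub>R q) = (u + w) *\<^sub>R p + (u *\<^sub>R s + w *\<^sub>R t) *\<^sub>R q"
      by (simp add: algebra_simps)
    ultimately show "u *\<^sub>R s + w *\<^sub>R t \<in> C" using *(5) by (simp add: C_def)
  qed
  obtain c c' c'' where *: "\<And>t. t \<in> C \<Longrightarrow>
    c t \<in> U \<and> gY F (c t) y0 = p + t *\<^sub>R q \<and> (c has_vector_derivative c' t) (at t) \<and>
    (c' has_vector_derivative c'' t) (at t) \<and> accX F (c t) y0 (c' t) (c'' t)"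
    using segX[OF ycl, of p q] unfolding C_def by (metis mem_Collect_eq)
  have pq: "p + r *\<^sub>R q = gY F xr y0" by (simp add: seg p_def q_def algebra_simps)
  have 01: "0 \<in> C" "1 \<in> C" "r \<in> C" using x pq by (auto simp: C_def p_def q_def)
  have Ucl: "t \<in> U \<Longrightarrow> t \<in> closure U" for t using closure_subset by blast
  have eq: "c t = u" if "t \<in> C" "u \<in> U" "gY F u y0 = p + t *\<^sub>R q" for t u
    using *[OF that(1)] that Ucl inj_onD[OF inj_gY[OF ycl], of "c t" u] by auto
  have c: "c 0 = x0" "c 1 = x1" "c r = xr"
    using 01 x pq by (auto intro!: eq simp: p_def q_def)
  have cW: "(c t, y) \<in> W" if "t \<in> C" "y \<in> V" for t y using * that inW' by blast
  have dz: "((\<lambda>t. (c t, y)) has_vector_derivative (c' t, 0)) (at t)" if "t \<in> C" for t y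
    using *[OF that] by (intro has_vector_derivative_Pair has_vector_derivative_const) auto
  have dz': "((\<lambda>t. (c' t, 0)) has_vector_derivative (c'' t, 0)) (at t)" if "t \<in> C" for t
    using *[OF that] by (intro has_vector_derivative_Pair has_vector_derivative_const) auto
  have d1: "((\<lambda>t. F (c t, y1) - F (c t, y0)) has_real_derivative
      dd (c' t, 0) F (c t, y1) - dd (c' t, 0) F (c t, y0)) (at t)" if "t \<in> C" for t
    by (intro DERIV_diff dd_curve dz that diffF(1) cW y)
  have d2: "((\<lambda>t. dd (c' t, 0) F (c t, y1) - dd (c' t, 0) F (c t, y0)) has_real_derivative
      (dd (c'' t, 0) F (c t, y1) + dd (c' t, 0) (dd (c' t, 0) F) (c t, y1)) -
      (dd (c'' t, 0) F (c t, y0) + dd (c' t, 0) (dd (c' t, 0) F) (c t, y0))) (at t)" if "t \<in> C" for t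
    by (intro DERIV_diff dd_curve2[OF W(1) C2 C that cW dz dz'[OF that]] y)
  have "convex_on C (\<lambda>t. F (c t, y1) - F (c t, y0))"
  proof (rule f''_ge0_imp_convex[OF Cconv d1 d2])
    show "0 \<le> (dd (c'' t, 0) F (c t, y1) + dd (c' t, 0) (dd (c' t, 0) F) (c t, y1)) -
      (dd (c'' t, 0) F (c t, y0) + dd (c' t, 0) (dd (c' t, 0) F) (c t, y0))" if "t \<in> C" for t
      using second_derivative_mono[of "c t" y0 y1 "c' t" "c'' t"] *[OF that] y by simp
  qed
  from convex_onD[OF this, of r 0 1] show ?thesis using r 01 by (simp add: c)
qed

text \<open>All points may lie on the boundary, so they are approximated from inside. The
  intermediate point cannot be approximated freely, since it is determined by the approximating
  segments; a subsequential limit of these points is identified with \<open>xr\<close> by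
  injectivity.\<close>

lemma primal_convex:
  assumes x: "x0 \<in> closure U" "x1 \<in> closure U" "xr \<in> closure U"
    and y: "y0 \<in> closure V" "y1 \<in> closure V" and r: "0 \<le> r" "r \<le> 1"
    and seg: "gY F xr y0 = (1 - r) *\<^sub>R gY F x0 y0 + r *\<^sub>R gY F x1 y0"
  shows "F (xr, y1) - F (xr, y0) \<le> (1 - r) * (F (x0, y1) - F (x0, y0)) + r * (F (x1, y1) - F (x1, y0))"
proof -
  obtain a0 where a0: "\<And>n. a0 n \<in> U" "a0 \<longlonglongrightarrow> x0" using x(1) unfolding closure_sequential by blast
  obtain a1 where a1: "\<And>n. a1 n \<in> U" "a1 \<longlonglongrightarrow> x1" using x(2) unfolding closure_sequential by blast
  obtain b0 where b0: "\<And>n. b0 n \<in> V" "b0 \<longlonglongrightarrow> y0" using y(1) unfolding closure_sequential by blast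
  obtain b1 where b1: "\<And>n. b1 n \<in> V" "b1 \<longlonglongrightarrow> y1" using y(2) unfolding closure_sequential by blast
  have Ucl: "t \<in> U \<Longrightarrow> t \<in> closure U" and Vcl: "t \<in> V \<Longrightarrow> t \<in> closure V" for t using closure_subset by blast+
  have "\<exists>u\<in>U. gY F u (b0 n) = (1 - r) *\<^sub>R gY F (a0 n) (b0 n) + r *\<^sub>R gY F (a1 n) (b0 n)" for n
  proof -
    have "(1 - r) *\<^sub>R gY F (a0 n) (b0 n) + r *\<^sub>R gY F (a1 n) (b0 n) \<in> (\<lambda>x. gY F x (b0 n)) ` U"
      by (rule convexD[OF convX[OF Vcl[OF b0(1)]] imageI[OF a0(1)] imageI[OF a1(1)]]) (use r in auto)
    then show ?thesis unfolding image_iff by (metis (no_types))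
  qed
  then obtain ar where ar: "\<And>n. ar n \<in> U"
    "\<And>n. gY F (ar n) (b0 n) = (1 - r) *\<^sub>R gY F (a0 n) (b0 n) + r *\<^sub>R gY F (a1 n) (b0 n)" by metis
  have "compact (closure U)" using U by simp
  then obtain l s where l: "l \<in> closure U" "strict_mono (s :: nat \<Rightarrow> nat)" "(ar \<circ> s) \<longlonglongrightarrow> l"
    using ar(1) Ucl unfolding compact_def by metis
  have lims: "(\<lambda>n. a0 (s n)) \<longlonglongrightarrow> x0" "(\<lambda>n. a1 (s n)) \<longlonglongrightarrow> x1" "(\<lambda>n. b0 (s n)) \<longlonglongrightarrow> y0"
    "(\<lambda>n. b1 (s n)) \<longlonglongrightarrow> y1" "(\<lambda>n. ar (s n)) \<longlonglongrightarrow> l"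
    using LIMSEQ_subseq_LIMSEQ[OF a0(2) l(2)] LIMSEQ_subseq_LIMSEQ[OF a1(2) l(2)]
      LIMSEQ_subseq_LIMSEQ[OF b0(2) l(2)] LIMSEQ_subseq_LIMSEQ[OF b1(2) l(2)] l(3) by (simp_all add: comp_def)
  have limF: "(\<lambda>n. F (f n, g n)) \<longlonglongrightarrow> F (u, w)" and limG: "(\<lambda>n. gY F (f n) (g n)) \<longlonglongrightarrow> gY F u w"
    if "f \<longlonglongrightarrow> u" "g \<longlonglongrightarrow> w" "u \<in> closure U" "w \<in> closure V" for f g :: "nat \<Rightarrow> 'a" and u w
  proof -
    have z: "(\<lambda>n. (f n, g n)) \<longlonglongrightarrow> (u, w)" using that by (intro tendsto_Pair)
    have F: "isCont F (u, w)" and G: "isCont (\<lambda>z. gY F (fst z) (snd z)) (u, w)"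
      using Ck_on_continuous[OF C4] gY_cont inW[OF that(3,4)] W(1) by (simp_all add: continuous_on_eq_continuous_at)
    show "(\<lambda>n. F (f n, g n)) \<longlonglongrightarrow> F (u, w)"
      using isCont_tendsto_compose[OF F z] .
    show "(\<lambda>n. gY F (f n) (g n)) \<longlonglongrightarrow> gY F u w"
      using isCont_tendsto_compose[OF G z] by simp
  qed
  have "gY F l y0 = (1 - r) *\<^sub>R gY F x0 y0 + r *\<^sub>R gY F x1 y0"
  proof (rule LIMSEQ_unique)
    show "(\<lambda>n. gY F (ar (s n)) (b0 (s n))) \<longlonglongrightarrow> gY F l y0" by (intro limG lims l y)
    show "(\<lambda>n. gY F (ar (s n)) (b0 (s n))) \<longlonglongrightarrow> (1 - r) *\<^sub>R gY F x0 y0 + r *\<^sub>R gY F x1 y0"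
      unfolding ar(2) by (intro tendsto_intros limG lims x y)
  qed
  then have "l = xr" using seg l(1) x(3) inj_onD[OF inj_gY[OF y(1)], of l xr] by simp
  show ?thesis
  proof (rule LIMSEQ_le)
    show "(\<lambda>n. F (ar (s n), b1 (s n)) - F (ar (s n), b0 (s n))) \<longlonglongrightarrow> F (xr, y1) - F (xr, y0)"
      using lims \<open>l = xr\<close> by (intro tendsto_intros limF x y) auto
    show "(\<lambda>n. (1 - r) * (F (a0 (s n), b1 (s n)) - F (a0 (s n), b0 (s n))) + r * (F (a1 (s n), b1 (s n)) - F (a1 (s n), b0 (s n))))
      \<longlonglongrightarrow> (1 - r) * (F (x0, y1) - F (x0, y0)) + r * (F (x1, y1) - F (x1, y0))"
      by (intro tendsto_intros limF x y lims)
    show "\<exists>N. \<forall>n\<ge>N. F (ar (s n), b1 (s n)) - F (ar (s n), b0 (s n)) \<le>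
      (1 - r) * (F (a0 (s n), b1 (s n)) - F (a0 (s n), b0 (s n))) + r * (F (a1 (s n), b1 (s n)) - F (a1 (s n), b0 (s n)))"
      by (intro exI allI impI primal_convex_interior a0 a1 b0 b1 ar r)
  qed
qed

lemma dual_convex:
  assumes y: "y0 \<in> closure V" "y1 \<in> closure V" "yr \<in> closure V"
    and x: "x0 \<in> closure U" "x1 \<in> closure U" and r: "0 \<le> r" "r \<le> 1"
    and seg: "gX F x0 yr = (1 - r) *\<^sub>R gX F x0 y0 + r *\<^sub>R gX F x0 y1"
  shows "F (x1, yr) - F (x0, yr) \<le> (1 - r) * (F (x1, y0) - F (x0, y0)) + r * (F (x1, y1) - F (x0, y1))"
proof -
  have "gY Fs yr x0 = (1 - r) *\<^sub>R gY Fs y0 x0 + r *\<^sub>R gY Fs y1 x0"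
    using seg by (simp only: gY_Fs[OF inW[OF x(1) y(1)]] gY_Fs[OF inW[OF x(1) y(2)]] gY_Fs[OF inW[OF x(1) y(3)]])
  from cost.primal_convex[OF cost_swap y x r this] show ?thesis by (simp only: comp_apply swap_simp)
qed

end

section \<open>Orthonormal frames adapted to a compact set\<close>

lemma det_row_linear:
  fixes B :: "'n \<Rightarrow> real^'n"
  shows "linear (\<lambda>v. det (\<chi> k. if k = i then v else B k))"
proof (rule linearI)
  show "det (\<chi> k. if k = i then v + w else B k) = det (\<chi> k. if k = i then v else B k) + det (\<chi> k. if k = i then w else B k)" for v w
    using det_row_add[of i "\<lambda>_. v" "\<lambda>_. w" B] .
  show "det (\<chi> k. if k = i then c *\<^sub>R v else B k) = c *\<^sub>R det (\<chi> k. if k = i then v else B k)" for c v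
    using det_row_mul[of i c "\<lambda>_. v" B] unfolding scalar_mult_eq_scaleR real_scaleR_def .
qed

text \<open>\<open>w\<close> is the largest distance of a point of \<open>Z\<close> from the span of
  the earlier \<open>e j\<close>, attained at \<open>z\<close>, and \<open>a\<close> is the unit
  vector of that component of \<open>z\<close>.\<close>

lemma greedy_frame_step:
  fixes Z :: "(real^'n) set"
  assumes Z: "compact Z" "0 < r" "cball 0 r \<subseteq> Z"
    and J: "(i :: 'n) \<notin> J" "\<And>j k. j \<in> J \<Longrightarrow> k \<in> J \<Longrightarrow> e j \<bullet> e k = (if j = k then 1 else 0)"
  obtains a z w where "norm a = 1" "\<And>j. j \<in> J \<Longrightarrow> a \<bullet> e j = 0" "z \<in> Z" "\<And>x. x \<in> Z \<Longrightarrow> \<bar>a \<bullet> x\<bar> \<le> w"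
    "z = w *\<^sub>R a + (\<Sum>j\<in>J. (z \<bullet> e j) *\<^sub>R e j)" 
proof -
  define pr where "pr x = x - (\<Sum>j\<in>J. (x \<bullet> e j) *\<^sub>R e j)" for x
  have orth: "pr x \<bullet> e k = 0" if "k \<in> J" for x k
  proof -
    have "(\<Sum>j\<in>J. (x \<bullet> e j) * (e j \<bullet> e k)) = (\<Sum>j\<in>J. if j = k then x \<bullet> e k else 0)"
      by (rule sum.cong) (use J that in auto)
    also have "\<dots> = x \<bullet> e k" using that sum.delta[of J k "\<lambda>_. x \<bullet> e k"] by simp
    finally show ?thesis by (simp add: pr_def inner_diff_left inner_sum_left)
  qed
  have "continuous_on Z (\<lambda>x. norm (pr x))"
    unfolding pr_def by (intro continuous_intros)
  moreover have "Z \<noteq> {}" using Z(2,3) by auto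
  ultimately obtain z where z: "z \<in> Z" "\<And>x. x \<in> Z \<Longrightarrow> norm (pr x) \<le> norm (pr z)"
    using continuous_attains_sup[OF Z(1)] by blast
  define w where "w = norm (pr z)"
  have "w > 0"
  proof -
    \<comment> \<open>Fewer than n directions have been used, so some vector of the ball in
      \<open>Z\<close> is orthogonal to all of them; the normalisation by \<open>w\<close> is
      therefore possible.\<close>
    have "dim (e ` J) \<le> card (e ` J)" by (rule dim_le_card') simp
    also have "\<dots> \<le> card J" by (rule card_image_le) simp
    also have "\<dots> < CARD('n)" using J(1) by (intro psubset_card_mono) auto
    finally have "dim (e ` J) < DIM(real^'n)" by simp
    then obtain x where x: "x \<noteq> 0" "\<And>y. y \<in> span (e ` J) \<Longrightarrow> orthogonal x y"
      using orthogonal_to_subspace_exists by blast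
    define x' where "x' = (r / norm x) *\<^sub>R x"
    have "norm x' = r" using x(1) Z(2) by (simp add: x'_def)
    then have "x' \<in> Z" using Z(3) by (auto simp: subset_iff)
    have "x \<bullet> e j = 0" if "j \<in> J" for j
      using x(2)[OF span_base] that by (auto simp: orthogonal_def)
    then have "pr x' = x'" by (simp add: pr_def x'_def)
    then have "r \<le> w" using z(2)[OF \<open>x' \<in> Z\<close>] \<open>norm x' = r\<close> by (simp add: w_def)
    then show ?thesis using Z(2) by linarith
  qed
  define a where "a = (1 / w) *\<^sub>R pr z"
  have a1: "norm a = 1" using \<open>w > 0\<close> by (simp add: a_def w_def)
  have a0: "a \<bullet> e j = 0" if "j \<in> J" for j using orth[OF that] by (simp add: a_def)
  have aw: "\<bar>a \<bullet> x\<bar> \<le> w" if "x \<in> Z" for x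
  proof -
    have "a \<bullet> pr x = a \<bullet> x" using a0 by (simp add: pr_def inner_diff_right inner_sum_right)
    moreover have "\<bar>a \<bullet> pr x\<bar> \<le> norm a * norm (pr x)" by (rule Cauchy_Schwarz_ineq2)
    ultimately show ?thesis using z(2)[OF that] a1 by (simp add: w_def)
  qed
  have "z = w *\<^sub>R a + (\<Sum>j\<in>J. (z \<bullet> e j) *\<^sub>R e j)"
    using \<open>w > 0\<close> by (simp add: a_def pr_def)
  with a1 a0 z(1) aw show ?thesis by (rule that)
qed

text \<open>The points \<open>z i\<close> are triangular with respect to the frame, so the simplex
  they span inside \<open>Z\<close> has a volume controlled by the very widths that confine
  \<open>Z\<close> from outside. The direction \<open>e1\<close> and the length \<open>c\<close> are
  prescribed rather than greedy, and no width is claimed there.\<close>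

lemma greedy_frame:
  fixes Z :: "(real^'n) set" and i0 :: 'n
  assumes Z: "compact Z" "0 < r" "cball 0 r \<subseteq> Z"
    and e1: "norm e1 = 1" "c *\<^sub>R e1 \<in> Z"
  shows "\<exists>e z w. (\<forall>i j. e i \<bullet> e j = (if i = j then 1 else 0)) \<and> e i0 = e1 \<and> (\<forall>i. z i \<in> Z) \<and>
    (\<forall>i x. i \<noteq> i0 \<longrightarrow> x \<in> Z \<longrightarrow> \<bar>e i \<bullet> x\<bar> \<le> w i) \<and>
    \<bar>det (\<chi> i. z i)\<bar> = \<bar>c\<bar> * (\<Prod>i\<in>UNIV - {i0}. \<bar>w i\<bar>)"
proof -
  \<comment> \<open>Induction over the rows already chosen. The determinant identity is stated for
    arbitrary rows \<open>r\<close> outside \<open>J\<close>, so that the next row can be exchanged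
    in it.\<close>
  have "\<exists>e z w. (\<forall>j\<in>J. \<forall>k\<in>J. e j \<bullet> e k = (if j = k then 1 else 0)) \<and> e i0 = e1 \<and> w i0 = c \<and> (\<forall>i\<in>J. z i \<in> Z) \<and>
      (\<forall>i\<in>J - {i0}. \<forall>x\<in>Z. \<bar>e i \<bullet> x\<bar> \<le> w i) \<and>
      (\<forall>r. det (\<chi> i. if i \<in> J then z i else r i) = (\<Prod>i\<in>J. w i) * det (\<chi> i. if i \<in> J then e i else r i))"
    if "i0 \<in> J" for J :: "'n set"
    using finite[of "J - {i0}"] that
  proof (induction "J - {i0}" arbitrary: J rule: finite_induct)
    case empty
    then have J: "J = {i0}" by auto
    have "det (\<chi> i. if i \<in> J then c *\<^sub>R e1 else r i) = c * det (\<chi> i. if i \<in> J then e1 else r i)" for r :: "'n \<Rightarrow> real^'n"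
      using linear_cmul[OF det_row_linear[of i0 r]] by (simp add: J)
    then show ?case
      using e1 by (intro exI[of _ "\<lambda>_. e1"] exI[of _ "\<lambda>_. c *\<^sub>R e1"] exI[of _ "\<lambda>_. c"])
        (auto simp: J dot_square_norm)
  next
    case (insert i F)
    define J' where "J' = J - {i}"
    have i: "i \<in> J" "i \<noteq> i0" using insert.hyps(4) by auto
    have F: "F = J' - {i0}" using insert.hyps(2,4) by (auto simp: J'_def)
    have J': "finite J'" "i0 \<in> J'" "i \<notin> J'" using insert.prems i by (auto simp: J'_def)
    have JJ': "J = insert i J'" using i by (auto simp: J'_def)
    obtain e z w where *: "\<And>j k. j \<in> J' \<Longrightarrow> k \<in> J' \<Longrightarrow> e j \<bullet> e k = (if j = k then 1 else 0)" "e i0 = e1" "w i0 = c"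
      "\<And>i. i \<in> J' \<Longrightarrow> z i \<in> Z" "\<And>i x. i \<in> J' \<Longrightarrow> i \<noteq> i0 \<Longrightarrow> x \<in> Z \<Longrightarrow> \<bar>e i \<bullet> x\<bar> \<le> w i"
      "\<And>r. det (\<chi> i. if i \<in> J' then z i else r i) = (\<Prod>i\<in>J'. w i) * det (\<chi> i. if i \<in> J' then e i else r i)"
      using insert.hyps(3)[OF F J'(2)] by blast
    obtain a zi wi where st: "norm a = 1" "\<And>j. j \<in> J' \<Longrightarrow> a \<bullet> e j = 0" "zi \<in> Z" "\<And>x. x \<in> Z \<Longrightarrow> \<bar>a \<bullet> x\<bar> \<le> wi"
      "zi = wi *\<^sub>R a + (\<Sum>j\<in>J'. (zi \<bullet> e j) *\<^sub>R e j)"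
      using greedy_frame_step[OF Z J'(3) *(1)] by blast
    have det: "det (\<chi> k. if k \<in> J then (z(i := zi)) k else r k)
        = (\<Prod>k\<in>J. (w(i := wi)) k) * det (\<chi> k. if k \<in> J then (e(i := a)) k else r k)" for r
    proof -
      let ?D = "\<lambda>v. det (\<chi> k. if k = i then v else if k \<in> J' then e k else r k)"
      note lin = det_row_linear[of i "\<lambda>k. if k \<in> J' then e k else r k"]
      have z0: "?D (e j) = 0" if j: "j \<in> J'" for j
      proof (rule det_identical_rows[of i j])
        show "i \<noteq> j" using j J'(3) by auto
        then show "row i (\<chi> k. if k = i then e j else if k \<in> J' then e k else r k) = row j (\<chi> k. if k = i then e j else if k \<in> J' then e k else r k)"
          using j by (simp add: row_def)
      qed
      have "det (\<chi> k. if k \<in> J then (z(i := zi)) k else r k) = det (\<chi> k. if k \<in> J' then z k else (r(i := zi)) k)"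
        using J'(3) by (intro arg_cong[of _ _ det]) (auto simp: vec_eq_iff JJ')
      also have "\<dots> = (\<Prod>k\<in>J'. w k) * det (\<chi> k. if k \<in> J' then e k else (r(i := zi)) k)" by (rule *(6))
      also have "det (\<chi> k. if k \<in> J' then e k else (r(i := zi)) k) = ?D zi"
        using J'(3) by (intro arg_cong[of _ _ det]) (auto simp: vec_eq_iff)
      also have "?D zi = ?D (wi *\<^sub>R a + (\<Sum>j\<in>J'. (zi \<bullet> e j) *\<^sub>R e j))"
        by (rule arg_cong[OF st(5)])
      also have "\<dots> = wi * ?D a + (\<Sum>j\<in>J'. (zi \<bullet> e j) * ?D (e j))"
        unfolding linear_add[OF lin] linear_sum[OF lin] linear_cmul[OF lin] by simp
      also have "\<dots> = wi * ?D a" using z0 by simp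
      also have "?D a = det (\<chi> k. if k \<in> J then (e(i := a)) k else r k)"
        by (intro arg_cong[of _ _ det]) (auto simp: vec_eq_iff JJ')
      also have "(\<Prod>k\<in>J'. w k) * (wi * det (\<chi> k. if k \<in> J then (e(i := a)) k else r k))
          = (\<Prod>k\<in>J. (w(i := wi)) k) * det (\<chi> k. if k \<in> J then (e(i := a)) k else r k)"
      proof -
        have "(\<Prod>k\<in>J'. (w(i := wi)) k) = (\<Prod>k\<in>J'. w k)" using J'(3) by (intro prod.cong) auto
        then show ?thesis using J'(1,3) by (simp add: JJ')
      qed
      finally show ?thesis .
    qed
    have neq: "k \<noteq> i" if "k \<in> J'" for k using that J'(3) by blast
    have orth: "(e(i := a)) j \<bullet> (e(i := a)) k = (if j = k then 1 else 0)" if "j \<in> J" "k \<in> J" for j k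
      using that *(1)[of j k] st(1) st(2)[of j] st(2)[of k] neq[of j] neq[of k]
      by (cases "j = i"; cases "k = i") (simp_all add: JJ' dot_square_norm inner_commute)
    have bnd: "\<bar>(e(i := a)) k \<bullet> x\<bar> \<le> (w(i := wi)) k" if "k \<in> J - {i0}" "x \<in> Z" for k x
      using that *(5)[of k x] st(4)[of x] by (cases "k = i") (simp_all add: JJ')
    have inZ: "(z(i := zi)) k \<in> Z" if "k \<in> J" for k
      using that *(4)[of k] st(3) by (cases "k = i") (simp_all add: JJ')
    have i0: "(e(i := a)) i0 = e1" "(w(i := wi)) i0 = c" using i *(2,3) by simp_all
    show ?case
      by (rule exI[of _ "e(i := a)"], rule exI[of _ "z(i := zi)"], rule exI[of _ "w(i := wi)"],
          intro conjI ballI allI)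
         ((rule orth bnd inZ det i0; assumption?)+)
  qed
  from this[OF UNIV_I] obtain e z w where *: "\<And>j k. e j \<bullet> e k = (if j = k then 1 else 0)" "e i0 = e1" "w i0 = c"
      "\<And>i. z i \<in> Z" "\<And>i x. i \<noteq> i0 \<Longrightarrow> x \<in> Z \<Longrightarrow> \<bar>e i \<bullet> x\<bar> \<le> w i"
      "det (\<chi> i. z i) = (\<Prod>i\<in>UNIV. w i) * det (\<chi> i. e i)"
    by (elim exE conjE) (rule that; simp)
  have "orthogonal_matrix (\<chi> i. e i)"
    unfolding orthogonal_matrix_orthonormal_rows
    by (auto simp: row_def orthogonal_def norm_eq_1 *(1))
  then have "\<bar>det (\<chi> i. e i)\<bar> = 1" using det_orthogonal_matrix by fastforce
  moreover have "(\<Prod>i\<in>UNIV. w i) = c * (\<Prod>i\<in>UNIV - {i0}. w i)"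
    using prod.remove[of UNIV i0 w] *(3) by simp
  ultimately have "\<bar>det (\<chi> i. z i)\<bar> = \<bar>c\<bar> * (\<Prod>i\<in>UNIV - {i0}. \<bar>w i\<bar>)"
    by (simp add: *(6) abs_mult abs_prod)
  with * show ?thesis by blast
qed

lemma continuous_det: "continuous_on UNIV (det :: real^'n^'n \<Rightarrow> real)"
  unfolding det_def
  by (intro continuous_on_sum continuous_on_mult continuous_on_const continuous_on_prod
      continuous_on_component continuous_on_id)

text \<open>One \<eta> has to serve all orthonormal frames at once. Multiplication by the transposed
  frame changes the determinant by a sign at most and brings every case close to the identity
  matrix.\<close>

lemma det_near_orthonormal:
  "\<exists>\<eta>>0. \<forall>e d. (\<forall>i j. e i \<bullet> e j = (if i = j then 1 else 0)) \<longrightarrow> (\<forall>i. norm (d i) \<le> \<eta>) \<longrightarrow>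
     1 / 2 \<le> \<bar>det ((\<chi> i. e i + d i) :: real^'n^'n)\<bar>"
proof -
  have "isCont (det :: real^'n^'n \<Rightarrow> real) (mat 1)"
    using continuous_det[where 'n='n] by (simp add: continuous_on_eq_continuous_at)
  from this[unfolded continuous_at_eps_delta, rule_format, of "1/2"]
  obtain \<delta> where \<delta>: "\<delta> > 0" "\<And>M :: real^'n^'n. dist M (mat 1) < \<delta> \<Longrightarrow> dist (det M) (det (mat 1 :: real^'n^'n)) < 1 / 2" by auto
  \<comment> \<open>There are n^2 entries of size at most \<eta>, so the perturbation of the
    identity has norm at most \<delta>/2.\<close>
  define \<eta> where "\<eta> = \<delta> / (2 * real CARD('n) * real CARD('n))"
  have n0: "real CARD('n) > 0" by simp
  have \<eta>: "\<eta> > 0" using \<delta>(1) n0 by (simp add: \<eta>_def)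
  have "1 / 2 \<le> \<bar>det (\<chi> i. e i + d i)\<bar>"
    if e: "\<forall>i j. e i \<bullet> e j = (if i = j then 1 else 0)" and d: "\<forall>i. norm (d i) \<le> \<eta>" for e d :: "'n \<Rightarrow> real^'n"
  proof -
    let ?A = "\<chi> i. e i" and ?B = "\<chi> i. e i + d i"
    let ?M = "?B ** transpose ?A"
    have M: "?M $ i $ j = (if i = j then 1 else 0) + d i \<bullet> e j" for i j
    proof -
      have "?M $ i $ j = (e i + d i) \<bullet> e j"
        by (simp add: matrix_matrix_mult_def transpose_def inner_vec_def)
      then show ?thesis using e by (simp add: inner_add_left)
    qed
    have "norm ((?M - mat 1) $ i) \<le> real CARD('n) * \<eta>" for i
    proof -
      have "norm ((?M - mat 1) $ i) \<le> (\<Sum>j\<in>UNIV. \<bar>(?M - mat 1) $ i $ j\<bar>)" by (rule norm_le_l1_cart)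
      also have "\<dots> \<le> (\<Sum>j\<in>(UNIV :: 'n set). \<eta>)"
      proof (rule sum_mono)
        fix j
        have "\<bar>(?M - mat 1) $ i $ j\<bar> = \<bar>d i \<bullet> e j\<bar>" using M[of i j] by (simp add: mat_def)
        also have "\<dots> \<le> norm (d i) * norm (e j)" by (rule Cauchy_Schwarz_ineq2)
        also have "norm (e j) = 1" using e by (simp add: norm_eq_1)
        finally show "\<bar>(?M - mat 1) $ i $ j\<bar> \<le> \<eta>" using spec[OF d, of i] by linarith
      qed
      finally show ?thesis by simp
    qed
    then have "(\<Sum>i\<in>UNIV. norm ((?M - mat 1) $ i)) \<le> (\<Sum>i\<in>(UNIV :: 'n set). real CARD('n) * \<eta>)"
      by (rule sum_mono)
    moreover have "norm (?M - mat 1) \<le> (\<Sum>i\<in>UNIV. norm ((?M - mat 1) $ i))"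
      unfolding norm_vec_def[of "?M - mat 1"] by (rule L2_set_le_sum) simp
    moreover have "(\<Sum>i\<in>(UNIV :: 'n set). real CARD('n) * \<eta>) = \<delta> / 2"
      using n0 by (simp add: \<eta>_def)
    ultimately have "dist ?M (mat 1) < \<delta>" using \<delta>(1) by (simp add: dist_norm)
    then have "\<bar>det ?M - 1\<bar> < 1 / 2" using \<delta>(2) by (simp add: dist_real_def)
    moreover have "orthogonal_matrix ?A"
      unfolding orthogonal_matrix_orthonormal_rows
      using e by (auto simp: row_def orthogonal_def norm_eq_1)
    then have "\<bar>det ?A\<bar> = 1" using det_orthogonal_matrix by fastforce
    then have "\<bar>det ?M\<bar> = \<bar>det ?B\<bar>" by (simp add: det_mul abs_mult)
    ultimately show ?thesis by linarith
  qed
  with \<eta> show ?thesis by blast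
qed

section \<open>Contact sets of convex functions\<close>

text \<open>The c-subdifferential at \<open>q\<close> for the cost -\<open>b\<close>. It does not
  change when one function of \<open>q\<close> is subtracted both from \<open>u\<close> and from
  every \<open>b q y\<close>; this allows \<open>u\<close> and \<open>b\<close> to be normalised at
  a base point.\<close>

definition contacts :: "'a set \<Rightarrow> 'b set \<Rightarrow> ('a \<Rightarrow> 'b \<Rightarrow> real) \<Rightarrow> ('a \<Rightarrow> real) \<Rightarrow> 'a \<Rightarrow> 'b set"
  where "contacts K Y b u q = {y \<in> Y. \<forall>q'\<in>K. u q + b q' y - b q y \<le> u q'}"

lemma compact_convergent_subsequence:
  fixes f :: "nat \<Rightarrow> 'a::metric_space"
  assumes "compact S" "\<And>n. f n \<in> S"
  shows "\<exists>l r. l \<in> S \<and> strict_mono r \<and> (f \<circ> r) \<longlonglongrightarrow> l"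
proof -
  have "(\<forall>n. f n \<in> S) \<longrightarrow> (\<exists>l\<in>S. \<exists>r. strict_mono r \<and> (f \<circ> r) \<longlonglongrightarrow> l)"
    using assms(1) unfolding compact_def by (rule spec)
  then have "\<exists>l\<in>S. \<exists>r. strict_mono r \<and> (f \<circ> r) \<longlonglongrightarrow> l"
    by (rule mp) (rule allI, rule assms(2))
  then show ?thesis by (elim bexE exE) (intro exI conjI; elim conjE; assumption)
qed

lemma convex_tangent:
  fixes f :: "'a::real_inner \<Rightarrow> real"
  assumes Q: "open Q" "convex Q" "q \<in> Q" "q' \<in> Q" and f: "convex_on Q f"
    and d: "(f has_derivative (\<lambda>v. p \<bullet> v)) (at q)"
  shows "f q + p \<bullet> (q' - q) \<le> f q'"
proof -
  let ?l = "\<lambda>t::real. q + t *\<^sub>R (q' - q)"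
  define A where "A = ?l -` Q"
  have A: "open A" unfolding A_def by (rule open_vimage[OF Q(1)]) (intro continuous_intros)
  have comb: "?l (u * s + v * t) = u *\<^sub>R ?l s + v *\<^sub>R ?l t" if "u + v = 1" for s t u v
  proof -
    have "u *\<^sub>R ?l s + v *\<^sub>R ?l t = (u + v) *\<^sub>R q + (u * s + v * t) *\<^sub>R (q' - q)"
      by (simp add: algebra_simps)
    then show ?thesis using that by simp
  qed
  have Ac: "convex A"
  proof (rule convexI)
    fix s t u v :: real assume "s \<in> A" "t \<in> A" "0 \<le> u" "0 \<le> v" "u + v = 1"
    then show "u *\<^sub>R s + v *\<^sub>R t \<in> A"
      using convexD[OF Q(2), of "?l s" "?l t" u v] comb[of u v s t] by (simp add: A_def)
  qed
  have "convex_on A (\<lambda>t. f (?l t))"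
  proof (rule convex_onI)
    fix r s t :: real assume *: "0 < r" "r < 1" "s \<in> A" "t \<in> A"
    show "f (?l ((1 - r) *\<^sub>R s + r *\<^sub>R t)) \<le> (1 - r) * f (?l s) + r * f (?l t)"
      using convex_onD[OF f, of r "?l s" "?l t"] comb[of "1 - r" r s t] * by (simp add: A_def)
  qed (rule Ac)
  moreover have "((\<lambda>t. f (?l t)) has_field_derivative p \<bullet> (q' - q)) (at 0 within A)"
  proof -
    have l: "(?l has_derivative (\<lambda>t. t *\<^sub>R (q' - q))) (at 0)" by (auto intro!: derivative_eq_intros)
    have "(f has_derivative (\<lambda>v. p \<bullet> v)) (at (?l 0))" using d by simp
    from diff_chain_at[OF l this]
    have "((\<lambda>t. f (?l t)) has_derivative (\<lambda>t. (p \<bullet> (q' - q)) * t)) (at 0)"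
      by (simp add: comp_def mult.commute)
    then have "((\<lambda>t. f (?l t)) has_field_derivative p \<bullet> (q' - q)) (at 0)"
      unfolding has_field_derivative_def .
    then show ?thesis by (rule has_field_derivative_at_within)
  qed
  moreover have "0 \<in> interior A" using A Q(3) by (simp add: interior_open A_def)
  moreover have "1 \<in> A" using Q(4) by (simp add: A_def)
  ultimately show ?thesis
    using convex_on_imp_above_tangent[of A "\<lambda>t. f (?l t)" 0 1 "p \<bullet> (q' - q)"] convex_connected[OF Ac] by simp
qed

lemma convex_local_support:
  fixes f :: "'a::real_inner \<Rightarrow> real"
  assumes Q: "q \<in> Q" "q' \<in> Q" and f: "convex_on Q f" and r: "0 < r"
    and loc: "\<And>x. x \<in> ball q r \<Longrightarrow> f q + p \<bullet> (x - q) \<le> f x"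
  shows "f q + p \<bullet> (q' - q) \<le> f q'"
proof -
  \<comment> \<open>The point at parameter \<open>t\<close> of the segment from \<open>q\<close> to
    \<open>q'\<close> lies in the ball; the summand 1 covers the case that both ends
    coincide.\<close>
  define t where "t = min 1 (r / (2 * (norm (q' - q) + 1)))"
  have n: "norm (q' - q) + 1 > 0" by (smt (verit) norm_ge_zero)
  have t: "0 < t" "t \<le> 1" using r n by (auto simp: t_def)
  have "t * norm (q' - q) \<le> t * (norm (q' - q) + 1)" using t by simp
  also have "\<dots> \<le> r / (2 * (norm (q' - q) + 1)) * (norm (q' - q) + 1)"
    using n by (intro mult_right_mono) (auto simp: t_def)
  also have "\<dots> = r / 2" using n by (simp add: divide_simps)
  finally have "q + t *\<^sub>R (q' - q) \<in> ball q r" using r t by (simp add: dist_norm)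
  from loc[OF this] have "f q + t * (p \<bullet> (q' - q)) \<le> f (q + t *\<^sub>R (q' - q))" by simp
  also have "q + t *\<^sub>R (q' - q) = (1 - t) *\<^sub>R q + t *\<^sub>R q'" by (simp add: algebra_simps)
  also have "f \<dots> \<le> (1 - t) * f q + t * f q'"
    using convex_onD[OF f, of t q q'] Q t by simp
  finally have "t * (f q + p \<bullet> (q' - q)) \<le> t * f q'" by (simp add: algebra_simps)
  then show ?thesis using t by simp
qed

text \<open>\<open>P q y\<close> is the gradient of \<open>b\<close> in \<open>q\<close>. The assumption \<open>near\<close> says that \<open>P q\<close> is tangent to the
  identity at \<open>y0\<close> for every \<open>q\<close>: this is the effect of the choice of coordinates.\<close>

locale contact_geometry =
  fixes Q K Y :: "(real^'n) set" and b :: "real^'n \<Rightarrow> real^'n \<Rightarrow> real" and P :: "real^'n \<Rightarrow> real^'n \<Rightarrow> real^'n"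
    and y0 :: "real^'n" and u :: "real^'n \<Rightarrow> real" and qt :: "real^'n"
  assumes Q: "open Q" "convex Q" "Q \<subseteq> K" and K: "compact K" and Y: "compact Y" "y0 \<in> Y"
    and b_cont: "continuous_on (K \<times> Y) (\<lambda>z. b (fst z) (snd z))"
    and b_convex: "\<And>y. y \<in> Y \<Longrightarrow> convex_on Q (\<lambda>q. b q y)"
    and b_deriv: "\<And>q y. q \<in> Q \<Longrightarrow> y \<in> Y \<Longrightarrow> ((\<lambda>q. b q y) has_derivative (\<lambda>v. P q y \<bullet> v)) (at q)"
    and P_cont: "continuous_on (Q \<times> Y) (\<lambda>z. P (fst z) (snd z))"
    and P_inj: "\<And>q. q \<in> Q \<Longrightarrow> inj_on (P q) Y"
    and dual: "\<And>q y y' t. q \<in> Q \<Longrightarrow> y \<in> Y \<Longrightarrow> y' \<in> Y \<Longrightarrow> 0 \<le> t \<Longrightarrow> t \<le> 1 \<Longrightarrow>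
      \<exists>y''\<in>Y. P q y'' = (1 - t) *\<^sub>R P q y + t *\<^sub>R P q y' \<and>
        (\<forall>q'\<in>K. b q' y'' - b q y'' \<le> (1 - t) * (b q' y - b q y) + t * (b q' y' - b q y'))"
    and b_base: "\<And>q. q \<in> K \<Longrightarrow> b q y0 = 0"
    and near: "\<And>N \<eta>. compact N \<Longrightarrow> N \<subseteq> Q \<Longrightarrow> 0 < \<eta> \<Longrightarrow>
      \<exists>r>0. \<forall>q\<in>N. \<forall>y\<in>Y. norm (y - y0) \<le> r \<longrightarrow> norm (P q y - (y - y0)) \<le> \<eta> * norm (y - y0)"
    and meas_le: "\<And>q. q \<in> Q \<Longrightarrow> \<exists>B\<ge>0. \<forall>A. compact A \<longrightarrow> A \<subseteq> Y \<longrightarrow>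
      measure lebesgue (P q ` A) \<le> B * measure lebesgue A"
    and meas_ge: "\<And>N. compact N \<Longrightarrow> N \<subseteq> Q \<Longrightarrow> \<exists>B\<ge>0. \<forall>q\<in>N. \<forall>A. compact A \<longrightarrow> A \<subseteq> Y \<longrightarrow>
      measure lebesgue A \<le> B * measure lebesgue (P q ` A)"
    and u_cont: "continuous_on K u"
    and contacts_ne: "\<And>q. q \<in> Q \<Longrightarrow> contacts K Y b u q \<noteq> {}"
    and u_nonneg: "\<And>q. q \<in> K \<Longrightarrow> 0 \<le> u q" and qt: "qt \<in> Q" "u qt = 0"
    and sublevel: "\<exists>\<epsilon>>0. {q \<in> K. u q \<le> \<epsilon>} \<subseteq> Q"
    and MA_upper: "\<exists>B\<ge>0. \<forall>Z. compact Z \<longrightarrow> Z \<subseteq> Q \<longrightarrow>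
      measure lebesgue (\<Union>q\<in>Z. contacts K Y b u q) \<le> B * measure lebesgue Z"
    and MA_lower: "\<exists>l>0. \<exists>r>0. \<forall>E. compact E \<longrightarrow> E \<subseteq> Q \<longrightarrow> E \<subseteq> cball qt r \<longrightarrow>
      l * measure lebesgue E \<le> measure lebesgue (\<Union>q\<in>E. contacts K Y b u q)"
begin

abbreviation "ct \<equiv> contacts K Y b u"

lemma P_base: "q \<in> Q \<Longrightarrow> P q y0 = 0"
  using near[of "{q}" 1] Y(2) by fastforce

lemma b_tangent: "q \<in> Q \<Longrightarrow> q' \<in> Q \<Longrightarrow> y \<in> Y \<Longrightarrow> b q y + P q y \<bullet> (q' - q) \<le> b q' y"
  by (rule convex_tangent[OF Q(1,2) _ _ b_convex b_deriv])

lemma ctD: "y \<in> ct q \<Longrightarrow> y \<in> Y" "y \<in> ct q \<Longrightarrow> q' \<in> K \<Longrightarrow> u q + b q' y - b q y \<le> u q'"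
  by (auto simp: contacts_def)

text \<open>A contact at the intermediate point supports \<open>u\<close> there by a function b(.,y)
  plus a constant, which is itself convex.\<close>

lemma u_convex: "convex_on Q u"
proof (rule convex_onI)
  fix t :: real and x z assume t: "0 < t" "t < 1" and x: "x \<in> Q" "z \<in> Q"
  let ?q = "(1 - t) *\<^sub>R x + t *\<^sub>R z"
  have q: "?q \<in> Q" using convexD[OF Q(2) x, of "1 - t" t] t by simp
  obtain y where y: "y \<in> ct ?q" using contacts_ne[OF q] by blast
  have "u ?q + b x y - b ?q y \<le> u x" "u ?q + b z y - b ?q y \<le> u z"
    using ctD(2)[OF y] x Q(3) by auto
  then have "(1 - t) * (u ?q + b x y - b ?q y) + t * (u ?q + b z y - b ?q y) \<le> (1 - t) * u x + t * u z"
    using t by (intro add_mono mult_left_mono) auto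
  moreover have "b ?q y \<le> (1 - t) * b x y + t * b z y"
    using convex_onD[OF b_convex[OF ctD(1)[OF y]], of t x z] t x by simp
  ultimately show "u ?q \<le> (1 - t) * u x + t * u z" by (simp add: algebra_simps)
qed (rule Q(2))

lemma b_lim:
  assumes "f \<longlonglongrightarrow> q" "g \<longlonglongrightarrow> y" "\<And>n. f n \<in> K" "\<And>n. g n \<in> Y" "q \<in> K" "y \<in> Y"
  shows "(\<lambda>n. b (f n) (g n)) \<longlonglongrightarrow> b q y"
proof -
  have "(\<lambda>n. (f n, g n)) \<longlonglongrightarrow> (q, y)" using assms by (intro tendsto_Pair)
  from continuous_on_tendsto_compose[OF b_cont this] show ?thesis using assms by simp
qed

lemma P_lim:
  assumes "f \<longlonglongrightarrow> q" "g \<longlonglongrightarrow> y" "\<And>n. f n \<in> Q" "\<And>n. g n \<in> Y" "q \<in> Q" "y \<in> Y"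
  shows "(\<lambda>n. P (f n) (g n)) \<longlonglongrightarrow> P q y"
proof -
  have "(\<lambda>n. (f n, g n)) \<longlonglongrightarrow> (q, y)" using assms by (intro tendsto_Pair)
  from continuous_on_tendsto_compose[OF P_cont this] show ?thesis using assms by simp
qed

lemma ct_closed:
  assumes "f \<longlonglongrightarrow> q" "g \<longlonglongrightarrow> y" "\<And>n. f n \<in> K" "\<And>n. g n \<in> ct (f n)" "q \<in> K"
  shows "y \<in> ct q"
proof -
  have gY: "g n \<in> Y" for n using assms(4) ctD(1) by blast
  have y: "y \<in> Y" by (rule closed_sequentially[OF compact_imp_closed[OF Y(1)] gY assms(2)])
  have uf: "(\<lambda>n. u (f n)) \<longlonglongrightarrow> u q"
    using continuous_on_tendsto_compose[OF u_cont assms(1,5)] assms(3) by simp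
  have "u q + b q' y - b q y \<le> u q'" if q': "q' \<in> K" for q'
  proof (rule LIMSEQ_le_const2)
    show "(\<lambda>n. u (f n) + b q' (g n) - b (f n) (g n)) \<longlonglongrightarrow> u q + b q' y - b q y"
      by (rule tendsto_diff[OF tendsto_add[OF uf b_lim[OF tendsto_const assms(2) q' gY q' y]]
            b_lim[OF assms(1,2,3) gY assms(5) y]])
    show "\<exists>N. \<forall>n\<ge>N. u (f n) + b q' (g n) - b (f n) (g n) \<le> u q'"
      using ctD(2)[OF assms(4) q'] by blast
  qed
  with y show ?thesis by (simp add: contacts_def)
qed

text \<open>Compactness makes the contact images measurable with finite measure, so that all volume
  comparisons take place between compact sets.\<close>

lemma ct_union_compact:
  assumes "compact Z" "Z \<subseteq> K"
  shows "compact (\<Union>q\<in>Z. ct q)"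
  unfolding compact_def
proof (intro allI impI)
  fix g :: "nat \<Rightarrow> real^'n" assume "\<forall>n. g n \<in> (\<Union>q\<in>Z. ct q)"
  then have "\<forall>n. \<exists>q. q \<in> Z \<and> g n \<in> ct q" by blast
  from choice[OF this] obtain f where f: "\<And>n. f n \<in> Z" "\<And>n. g n \<in> ct (f n)" by blast
  obtain q s where q: "q \<in> Z" "strict_mono s" "(f \<circ> s) \<longlonglongrightarrow> q"
    using compact_convergent_subsequence[of Z f, OF assms(1) f(1)] by blast
  have "(g \<circ> s) n \<in> Y" for n using ctD(1)[OF f(2), of "s n"] by simp
  from compact_convergent_subsequence[of Y "g \<circ> s", OF Y(1) this]
  obtain y r where y: "y \<in> Y" "strict_mono r" "((g \<circ> s) \<circ> r) \<longlonglongrightarrow> y"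
    by blast
  have "y \<in> ct q"
  proof (rule ct_closed[OF LIMSEQ_subseq_LIMSEQ[OF q(3) y(2)] y(3)])
    show "((f \<circ> s) \<circ> r) n \<in> K" for n using f(1) assms(2) by auto
    show "((g \<circ> s) \<circ> r) n \<in> ct (((f \<circ> s) \<circ> r) n)" for n using f(2) by simp
    show "q \<in> K" using q(1) assms(2) by blast
  qed
  then have "y \<in> (\<Union>q\<in>Z. ct q)" using q(1) by blast
  moreover have "strict_mono (s \<circ> r)" using q(2) y(2) by (rule strict_mono_o)
  moreover have "(g \<circ> (s \<circ> r)) \<longlonglongrightarrow> y" using y(3) by (simp only: comp_assoc)
  ultimately show "\<exists>l\<in>\<Union>q\<in>Z. ct q. \<exists>r. strict_mono r \<and> (g \<circ> r) \<longlonglongrightarrow> l" by blast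
qed

text \<open>By \<open>dual\<close> the gradients of the contacts at \<open>q\<close> form a compact convex set. If \<open>p\<close> were separated
  from it, contacts at points approaching \<open>q\<close> from the separating direction would contradict the
  monotonicity of subgradients in the limit.\<close>

lemma subgradient_contact:
  assumes q: "q \<in> Q" and p: "\<And>q'. q' \<in> Q \<Longrightarrow> u q + p \<bullet> (q' - q) \<le> u q'"
  shows "\<exists>y\<in>ct q. P q y = p"
proof (rule ccontr)
  assume neg: "\<not> (\<exists>y\<in>ct q. P q y = p)"
  define A where "A = P q ` ct q"
  have qK: "q \<in> K" using q Q(3) by blast
  have "compact (ct q)" using ct_union_compact[of "{q}"] qK by simp
  moreover have "continuous_on Y (P q)"
  proof -
    have "continuous_on Y (\<lambda>y. (q, y))" by (intro continuous_intros)
    from continuous_on_compose2[OF P_cont this] q show ?thesis by auto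
  qed
  ultimately have Acl: "closed A"
    unfolding A_def by (intro compact_imp_closed compact_continuous_image) (auto elim: continuous_on_subset dest: ctD(1))
  have Acv: "convex A"
  proof (rule convexI)
    fix x z and s t :: real assume "x \<in> A" "z \<in> A" and st: "0 \<le> s" "0 \<le> t" "s + t = 1"
    then obtain y y' where y: "y \<in> ct q" "x = P q y" and y': "y' \<in> ct q" "z = P q y'" by (auto simp: A_def)
    have s: "s = 1 - t" "t \<le> 1" using st by auto
    obtain y'' where y'': "y'' \<in> Y" "P q y'' = (1 - t) *\<^sub>R P q y + t *\<^sub>R P q y'"
      "\<And>q'. q' \<in> K \<Longrightarrow> b q' y'' - b q y'' \<le> (1 - t) * (b q' y - b q y) + t * (b q' y' - b q y')"
      using dual[OF q ctD(1)[OF y(1)] ctD(1)[OF y'(1)] st(2) s(2)] by blast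
    have "u q + b q' y'' - b q y'' \<le> u q'" if q': "q' \<in> K" for q'
    proof -
      have "(1 - t) * (b q' y - b q y) + t * (b q' y' - b q y') \<le> (1 - t) * (u q' - u q) + t * (u q' - u q)"
        using ctD(2)[OF y(1) q'] ctD(2)[OF y'(1) q'] st s by (intro add_mono mult_left_mono) auto
      also have "\<dots> = u q' - u q" by (simp add: algebra_simps)
      finally show ?thesis using y''(3)[OF q'] by linarith
    qed
    then have "y'' \<in> ct q" using y''(1) by (simp add: contacts_def)
    then show "s *\<^sub>R x + t *\<^sub>R z \<in> A" unfolding A_def y(2) y'(2) s(1) y''(2)[symmetric] by (rule imageI)
  qed
  have "p \<notin> A" using neg by (auto simp: A_def)
  then obtain a \<beta> where a: "a \<bullet> p < \<beta>" "\<And>x. x \<in> A \<Longrightarrow> \<beta> < a \<bullet> x"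
    using separating_hyperplane_closed_point[OF Acv Acl] by blast
  obtain r where r: "r > 0" "ball q r \<subseteq> Q" using Q(1) q open_contains_ball_eq by blast
  define \<tau> where "\<tau> n = r / (2 * (norm a + 1)) * inverse (real (Suc n))" for n :: nat
  have na: "norm a + 1 > 0" by (smt (verit) norm_ge_zero)
  have \<tau>: "\<tau> n > 0" for n using r na by (simp add: \<tau>_def)
  have lim\<tau>: "\<tau> \<longlonglongrightarrow> 0"
    unfolding \<tau>_def by (rule tendsto_mult_right_zero[OF LIMSEQ_inverse_real_of_nat])
  define f where "f n = q - \<tau> n *\<^sub>R a" for n
  have fQ: "f n \<in> Q" for n
  proof -
    have "\<tau> n * norm a \<le> \<tau> n * (norm a + 1)" using \<tau>[of n] by simp
    also have "\<dots> = (r / (2 * (norm a + 1)) * (norm a + 1)) * inverse (real (Suc n))"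
      unfolding \<tau>_def by (simp only: mult_ac)
    also have "r / (2 * (norm a + 1)) * (norm a + 1) = r / 2" using na by (simp add: divide_simps)
    also have "(r / 2) * inverse (real (Suc n)) \<le> (r / 2) * 1" using r(1) by (intro mult_left_mono) (auto simp: inverse_le_1_iff)
    also have "\<dots> < r" using r(1) by simp
    finally show ?thesis using r(2) \<tau>[of n] by (auto simp: f_def dist_norm subset_iff)
  qed
  have limf: "f \<longlonglongrightarrow> q"
    using tendsto_diff[OF tendsto_const tendsto_scaleR[OF lim\<tau> tendsto_const], of q a] by (simp add: f_def[abs_def])
  have "\<exists>y. y \<in> ct (f n)" for n using contacts_ne[OF fQ[of n]] by blast
  then have "\<forall>n. \<exists>y. y \<in> ct (f n)" by (rule allI)
  from choice[OF this] obtain g where g: "\<And>n. g n \<in> ct (f n)" by blast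
  have gY: "g n \<in> Y" for n using g ctD(1) by blast
  have le: "P (f n) (g n) \<bullet> a \<le> p \<bullet> a" for n
  proof -
    have "u (f n) + b q (g n) - b (f n) (g n) \<le> u q" by (rule ctD(2)[OF g qK])
    moreover have "b (f n) (g n) + P (f n) (g n) \<bullet> (q - f n) \<le> b q (g n)" by (rule b_tangent[OF fQ q gY])
    moreover have "u q + p \<bullet> (f n - q) \<le> u (f n)" by (rule p[OF fQ])
    ultimately have "\<tau> n * (P (f n) (g n) \<bullet> a) \<le> \<tau> n * (p \<bullet> a)"
      by (simp add: f_def)
    then show ?thesis using \<tau>[of n] by simp
  qed
  obtain y s where y: "y \<in> Y" "strict_mono s" "(g \<circ> s) \<longlonglongrightarrow> y"
    using compact_convergent_subsequence[of Y g, OF Y(1) gY] by blast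
  note fs = LIMSEQ_subseq_LIMSEQ[OF limf y(2)]
  have "y \<in> ct q"
    by (rule ct_closed[OF fs y(3)]) (use fQ Q(3) g qK in auto)
  then have "\<beta> < a \<bullet> P q y" by (intro a(2)) (simp add: A_def)
  moreover have "P q y \<bullet> a \<le> p \<bullet> a"
  proof (rule LIMSEQ_le_const2)
    show "(\<lambda>n. P ((f \<circ> s) n) ((g \<circ> s) n) \<bullet> a) \<longlonglongrightarrow> P q y \<bullet> a"
      by (rule tendsto_inner[OF P_lim[OF fs y(3)] tendsto_const]) (use fQ gY q y(1) in auto)
    show "\<exists>N. \<forall>n\<ge>N. P ((f \<circ> s) n) ((g \<circ> s) n) \<bullet> a \<le> p \<bullet> a" using le by simp
  qed
  ultimately show False using a(1) by (simp add: inner_commute)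
qed

lemma interior_ball:
  assumes "q \<in> Q" "u q < \<epsilon>"
  obtains r where "r > 0" "ball q r \<subseteq> {x \<in> Q. u x \<le> \<epsilon>}"
proof -
  have "continuous_on Q u" using u_cont Q(3) by (rule continuous_on_subset)
  then have "open (Q \<inter> u -` {..<\<epsilon>})" using Q(1) open_lessThan by (rule continuous_open_preimage)
  moreover have "q \<in> Q \<inter> u -` {..<\<epsilon>}" using assms by simp
  ultimately obtain r where "r > 0" "ball q r \<subseteq> Q \<inter> u -` {..<\<epsilon>}" using open_contains_ball by blast
  then show ?thesis by (intro that[of r]) auto
qed

text \<open>Since \<open>u q < \<epsilon>\<close>, the constraint is inactive at \<open>q\<close>.
  So \<open>p\<close> is a local subgradient, by convexity a global one, and
  \<open>subgradient_contact\<close> applies.\<close>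

lemma min_affine_contact:
  assumes q: "q \<in> Q" "u q < \<epsilon>" and p: "\<And>x. x \<in> Q \<Longrightarrow> u x \<le> \<epsilon> \<Longrightarrow> u q - p \<bullet> q \<le> u x - p \<bullet> x"
  shows "\<exists>y\<in>ct q. P q y = p"
proof (rule subgradient_contact[OF q(1)])
  fix q' assume q': "q' \<in> Q"
  obtain r where r: "r > 0" "ball q r \<subseteq> {x \<in> Q. u x \<le> \<epsilon>}" using interior_ball[OF q] .
  show "u q + p \<bullet> (q' - q) \<le> u q'"
  proof (rule convex_local_support[OF q(1) q' u_convex r(1)])
    fix x assume "x \<in> ball q r"
    then show "u q + p \<bullet> (x - q) \<le> u x" using r(2) p[of x] by (auto simp: inner_diff_right)
  qed
qed

text \<open>A local support by b(.,y) is a global one. Local minimality and \<open>b_tangent\<close>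
  make \<open>P q y\<close> a subgradient; some contact at \<open>q\<close> has this gradient, and
  injectivity of \<open>P q\<close> shows that it is \<open>y\<close>.\<close>

lemma min_contact:
  assumes q: "q \<in> Q" "u q < \<epsilon>" and y: "y \<in> Y" and min: "\<And>x. x \<in> Q \<Longrightarrow> u x \<le> \<epsilon> \<Longrightarrow> u q - b q y \<le> u x - b x y"
  shows "y \<in> ct q"
proof -
  obtain r where r: "r > 0" "ball q r \<subseteq> {x \<in> Q. u x \<le> \<epsilon>}" using interior_ball[OF q] .
  have "\<exists>y'\<in>ct q. P q y' = P q y"
  proof (rule subgradient_contact[OF q(1)])
    fix q' assume q': "q' \<in> Q"
    show "u q + P q y \<bullet> (q' - q) \<le> u q'"
    proof (rule convex_local_support[OF q(1) q' u_convex r(1)])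
      fix x assume "x \<in> ball q r"
      then have x: "x \<in> Q" "u x \<le> \<epsilon>" using r(2) by auto
      show "u q + P q y \<bullet> (x - q) \<le> u x" using b_tangent[OF q(1) x(1) y] min[OF x] by linarith
    qed
  qed
  then obtain y' where y': "y' \<in> ct q" "P q y' = P q y" by blast
  then have "y' = y" using inj_onD[OF P_inj[OF q(1)] y'(2)] ctD(1) y by blast
  with y' show ?thesis by simp
qed

text \<open>The assumption \<open>near\<close> measured by the gradient instead of by the distance
  from \<open>y0\<close>. A small gradient forces \<open>y\<close> close to \<open>y0\<close>,
  because by injectivity and compactness \<open>P\<close> stays away from 0 outside a neighbourhood
  of \<open>y0\<close>.\<close>

lemma P_near:
  assumes N: "compact N" "N \<subseteq> Q" "q0 \<in> N" and \<eta>: "0 < \<eta>"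
  shows "\<exists>\<rho>>0. \<forall>q\<in>N. \<forall>y\<in>Y. norm (P q y) \<le> \<rho> \<longrightarrow> norm (P q0 y - P q y) \<le> \<eta> * norm (P q y)"
proof -
  \<comment> \<open>The bound 1/2 yields \<open>norm (y - y0) \<le> 2 * norm (P q y)\<close>; two
    errors, each doubled by this, account for the quarter of \<eta>.\<close>
  define \<eta>' where "\<eta>' = min (1 / 2) (\<eta> / 4)"
  have \<eta>': "0 < \<eta>'" "\<eta>' \<le> 1 / 2" "4 * \<eta>' \<le> \<eta>" using \<eta> by (auto simp: \<eta>'_def)
  obtain r where r: "r > 0" "\<And>q y. q \<in> N \<Longrightarrow> y \<in> Y \<Longrightarrow> norm (y - y0) \<le> r \<Longrightarrow> norm (P q y - (y - y0)) \<le> \<eta>' * norm (y - y0)"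
    using near[OF N(1,2) \<eta>'(1)] by blast
  have "\<exists>\<rho>>0. \<forall>q\<in>N. \<forall>y\<in>Y. norm (P q y) \<le> \<rho> \<longrightarrow> norm (y - y0) \<le> r"
  proof (cases "N \<times> (Y \<inter> {y. r \<le> norm (y - y0)}) = {}")
    case True
    then have "norm (y - y0) \<le> r" if "q \<in> N" "y \<in> Y" for q y
      using that by (auto simp: not_le)
    then show ?thesis using zero_less_one by blast
  next
    case False
    have "closed {y. r \<le> norm (y - y0)}" by (intro closed_Collect_le continuous_intros)
    then have cp: "compact (N \<times> (Y \<inter> {y. r \<le> norm (y - y0)}))"
      using N(1) Y(1) by (intro compact_Times compact_Int_closed)
    have "continuous_on (N \<times> (Y \<inter> {y. r \<le> norm (y - y0)})) (\<lambda>z. norm (P (fst z) (snd z)))"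
      by (rule continuous_on_norm[OF continuous_on_subset[OF P_cont]]) (use N(2) in auto)
    from continuous_attains_inf[OF cp False this]
    obtain q1 y1 where m: "q1 \<in> N" "y1 \<in> Y" "r \<le> norm (y1 - y0)"
      "\<And>q y. q \<in> N \<Longrightarrow> y \<in> Y \<Longrightarrow> r \<le> norm (y - y0) \<Longrightarrow> norm (P q1 y1) \<le> norm (P q y)" by force
    have q1: "q1 \<in> Q" using m(1) N(2) by blast
    have P1: "P q1 y1 \<noteq> 0"
    proof
      assume "P q1 y1 = 0"
      then have "y1 = y0" using inj_onD[OF P_inj[OF q1], of y1 y0] P_base[OF q1] m(2) Y(2) by simp
      then show False using m(3) r(1) by simp
    qed
    moreover have "norm (y - y0) \<le> r" if "q \<in> N" "y \<in> Y" "norm (P q y) \<le> norm (P q1 y1) / 2" for q y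
    proof (rule ccontr)
      assume "\<not> norm (y - y0) \<le> r"
      then have "norm (P q1 y1) \<le> norm (P q y)" using m(4)[OF that(1,2)] by simp
      moreover have "0 < norm (P q1 y1)" using P1 by simp
      ultimately show False using that(3) by linarith
    qed
    ultimately show ?thesis using P1 by (intro exI[of _ "norm (P q1 y1) / 2"]) auto
  qed
  then obtain \<rho> where \<rho>: "\<rho> > 0" "\<And>q y. q \<in> N \<Longrightarrow> y \<in> Y \<Longrightarrow> norm (P q y) \<le> \<rho> \<Longrightarrow> norm (y - y0) \<le> r" by blast
  have "norm (P q0 y - P q y) \<le> \<eta> * norm (P q y)" if q: "q \<in> N" "y \<in> Y" "norm (P q y) \<le> \<rho>" for q y
  proof -
    have y: "norm (y - y0) \<le> r" by (rule \<rho>(2)[OF q])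
    have 1: "norm (P q y - (y - y0)) \<le> \<eta>' * norm (y - y0)" by (rule r(2)[OF q(1,2) y])
    have 2: "norm (P q0 y - (y - y0)) \<le> \<eta>' * norm (y - y0)" by (rule r(2)[OF N(3) q(2) y])
    have "norm (y - y0) - norm (P q y) \<le> norm (P q y - (y - y0))"
      using norm_triangle_ineq2[of "y - y0" "P q y"] by (simp add: norm_minus_commute)
    also have "\<dots> \<le> (1 / 2) * norm (y - y0)"
      using 1 mult_right_mono[OF \<eta>'(2), of "norm (y - y0)"] by simp
    finally have 3: "norm (y - y0) \<le> 2 * norm (P q y)" by simp
    have "norm (P q0 y - P q y) = norm ((P q0 y - (y - y0)) - (P q y - (y - y0)))" by simp
    also have "\<dots> \<le> \<eta>' * norm (y - y0) + \<eta>' * norm (y - y0)"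
      using norm_triangle_ineq4[of "P q0 y - (y - y0)" "P q y - (y - y0)"] 1 2 by linarith
    also have "\<dots> \<le> \<eta>' * (2 * norm (P q y)) + \<eta>' * (2 * norm (P q y))"
      using 3 \<eta>'(1) by (intro add_mono mult_left_mono) auto
    also have "\<dots> = (4 * \<eta>') * norm (P q y)" by simp
    also have "\<dots> \<le> \<eta> * norm (P q y)" by (rule mult_right_mono[OF \<eta>'(3)]) simp
    finally show ?thesis .
  qed
  with \<rho>(1) show ?thesis by blast
qed

end

section \<open>The Alexandrov estimates\<close>

lemma convex_subsum:
  fixes z :: "'i \<Rightarrow> 'a::real_vector"
  assumes C: "convex C" "0 \<in> C" and I: "finite I" "\<And>i. i \<in> I \<Longrightarrow> z i \<in> C" "\<And>i. i \<in> I \<Longrightarrow> 0 \<le> t i"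
    and s: "(\<Sum>i\<in>I. t i) \<le> 1"
  shows "(\<Sum>i\<in>I. t i *\<^sub>R z i) \<in> C"
proof (cases "(\<Sum>i\<in>I. t i) = 0")
  case True
  then have "t i = 0" if "i \<in> I" for i
    using sum_nonneg_eq_0_iff[OF I(1), of t] I(3) that by blast
  then show ?thesis using C(2) by simp
next
  case False
  define S where "S = (\<Sum>i\<in>I. t i)"
  have S: "0 < S" "S \<le> 1" using False s sum_nonneg[of I t] I(3) unfolding S_def by fastforce+
  have "(\<Sum>i\<in>I. (t i / S) *\<^sub>R z i) \<in> C"
  proof (rule convex_sum[OF I(1) C(1)])
    show "(\<Sum>i\<in>I. t i / S) = 1" using S by (simp add: sum_divide_distrib[symmetric] S_def[symmetric])
    show "0 \<le> t i / S" if "i \<in> I" for i using I(3)[OF that] S by simp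
    show "z i \<in> C" if "i \<in> I" for i using I(2)[OF that] .
  qed
  from convexD[OF C(1) C(2) this, of "1 - S" S] S
  have "S *\<^sub>R (\<Sum>i\<in>I. (t i / S) *\<^sub>R z i) \<in> C" by simp
  then show ?thesis using S by (simp add: scaleR_sum_right)
qed

text \<open>The \<open>g i\<close> are the values of a linear functional at the vertices other than
  0 of a simplex, and \<open>m\<close> is its value at the barycentre. As the vertex values average
  to \<open>m\<close>, one-sided bounds relative to \<open>m\<close> at all vertices become
  two-sided.\<close>

lemma simplex_dual_bound:
  fixes g :: "'n::finite \<Rightarrow> real"
  assumes m: "m = (\<Sum>i\<in>UNIV. g i) / (real CARD('n) + 1)" and le: "- m \<le> H" "\<And>i. g i - m \<le> H"
  shows "\<bar>g i\<bar> \<le> (real CARD('n) + 1) * H"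
proof -
  let ?n = "real CARD('n)"
  have sum: "(\<Sum>i\<in>UNIV. g i) = (?n + 1) * m" unfolding m by simp
  have "(\<Sum>i\<in>UNIV. g i) \<le> (\<Sum>i\<in>(UNIV :: 'n set). H + m)"
    by (rule sum_mono) (use le(2) in \<open>simp add: algebra_simps\<close>)
  then have "(?n + 1) * m \<le> ?n * (H + m)" using sum by simp
  then have m_le: "m \<le> ?n * H" by (simp add: algebra_simps)
  have "(\<Sum>j\<in>UNIV - {i}. g j) \<le> (\<Sum>j\<in>UNIV - {i}. H + m)"
    by (rule sum_mono) (use le(2) in \<open>simp add: algebra_simps\<close>)
  also have "\<dots> = (?n - 1) * (H + m)" by (simp add: of_nat_diff card_Diff_singleton)
  finally have "(?n + 1) * m \<le> g i + (?n - 1) * (H + m)"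
    using sum sum.remove[of UNIV i g] by simp
  then have "2 * m - (?n - 1) * H \<le> g i" by (simp add: algebra_simps)
  moreover have "- 2 * H \<le> 2 * m" using le(1) by simp
  moreover have "g i \<le> H + m" using le(2)[of i] by simp
  ultimately show ?thesis using m_le by (simp add: abs_le_iff algebra_simps)
qed

context contact_geometry
begin

text \<open>Taken inside the convex set \<open>Q\<close>, where \<open>u\<close> is known to be
  convex; for small \<epsilon> it is the full sublevel set in \<open>K\<close> (see
  \<open>sub_compact\<close>).\<close>

definition "sub \<epsilon> = {q \<in> Q. u q \<le> \<epsilon>}"

lemma sub_convex: "convex (sub \<epsilon>)"
proof (rule convexI)
  fix x y and s t :: real assume x: "x \<in> sub \<epsilon>" and y: "y \<in> sub \<epsilon>" and st: "0 \<le> s" "0 \<le> t" "s + t = 1"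
  have s: "s = 1 - t" "t \<le> 1" using st by auto
  have "s *\<^sub>R x + t *\<^sub>R y \<in> Q" using x y st by (intro convexD[OF Q(2)]) (auto simp: sub_def)
  moreover have "u (s *\<^sub>R x + t *\<^sub>R y) \<le> (1 - t) * u x + t * u y"
    using convex_onD[OF u_convex, of t x y] x y st s by (simp add: sub_def)
  moreover have "(1 - t) * u x + t * u y \<le> (1 - t) * \<epsilon> + t * \<epsilon>"
    using x y st s by (intro add_mono mult_left_mono) (auto simp: sub_def)
  ultimately show "s *\<^sub>R x + t *\<^sub>R y \<in> sub \<epsilon>" by (simp add: sub_def algebra_simps)
qed

lemma sub_compact:
  "\<exists>\<epsilon>0>0. \<forall>\<epsilon>\<le>\<epsilon>0. compact (sub \<epsilon>) \<and> sub \<epsilon> = {q \<in> K. u q \<le> \<epsilon>}"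
proof -
  obtain \<epsilon>0 where e: "0 < \<epsilon>0" "{q \<in> K. u q \<le> \<epsilon>0} \<subseteq> Q" using sublevel by blast
  have eq: "sub \<epsilon> = {q \<in> K. u q \<le> \<epsilon>}" if "\<epsilon> \<le> \<epsilon>0" for \<epsilon>
    using e(2) that Q(3) by (auto simp: sub_def)
  have "compact (sub \<epsilon>)" if "\<epsilon> \<le> \<epsilon>0" for \<epsilon>
  proof -
    have "closed (K \<inter> u -` {..\<epsilon>})"
      by (rule continuous_closed_preimage[OF u_cont compact_imp_closed[OF K] closed_atMost])
    then have "compact (K \<inter> (K \<inter> u -` {..\<epsilon>}))" using K by (intro compact_Int_closed)
    moreover have "K \<inter> (K \<inter> u -` {..\<epsilon>}) = sub \<epsilon>" unfolding eq[OF that] by auto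
    ultimately show ?thesis by simp
  qed
  with e(1) eq show ?thesis by (intro exI[of _ \<epsilon>0]) simp
qed

lemma sub_simplex:
  fixes z :: "'n \<Rightarrow> real^'n"
  assumes "q0 \<in> sub \<epsilon>" "\<And>i. q0 + z i \<in> sub \<epsilon>" "\<And>i. 0 \<le> t i" "(\<Sum>i\<in>UNIV. t i) \<le> 1"
  shows "q0 + (\<Sum>i\<in>UNIV. t i *\<^sub>R z i) \<in> sub \<epsilon>"
proof -
  have mem: "x \<in> (+) (- q0) ` sub \<epsilon> \<longleftrightarrow> q0 + x \<in> sub \<epsilon>" for x
    by (force simp: image_iff)
  have "(\<Sum>i\<in>UNIV. t i *\<^sub>R z i) \<in> (+) (- q0) ` sub \<epsilon>"
    by (rule convex_subsum[OF convex_translation[OF sub_convex]]) (use assms in \<open>simp_all only: mem add_0_right finite\<close>)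
  then show ?thesis unfolding mem .
qed

text \<open>A contact \<open>y\<close> at a point \<open>x\<close> that sees \<open>q\<close> with a fixed weight gives a function of height at most
  a multiple of \<open>\<epsilon>\<close> above its value at \<open>q\<close>; so the gradients can all be taken at the same \<open>q\<close>.\<close>

lemma contact_gradient_bound:
  assumes m: "x \<in> sub \<epsilon>" "q \<in> sub \<epsilon>" "z \<in> sub \<epsilon>" and \<tau>: "0 < \<tau>" "\<tau> \<le> 1"
    and x: "x = (1 - \<tau>) *\<^sub>R qt + (\<tau> / 2) *\<^sub>R q + (\<tau> / 2) *\<^sub>R z" and y: "y \<in> ct x" and v: "v \<in> sub \<epsilon>"
  shows "P q y \<bullet> (v - q) \<le> (1 + 2 / \<tau>) * \<epsilon>"
proof -
  have Qm: "x \<in> Q" "q \<in> Q" "z \<in> Q" "v \<in> Q" using m v by (auto simp: sub_def)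
  have eps: "0 \<le> \<epsilon>" using m(1) u_nonneg[of x] Qm(1) Q(3) by (auto simp: sub_def)
  have \<phi>: "b w y - b x y \<le> \<epsilon>" if "w \<in> Q" "u w \<le> \<epsilon>" for w
  proof -
    have "w \<in> K" "x \<in> K" using that(1) Qm(1) Q(3) by auto
    then show ?thesis using ctD(2)[OF y, of w] u_nonneg[of x] that(2) by linarith
  qed
  let ?m = "(1 - 1/2) *\<^sub>R q + (1/2) *\<^sub>R z"
  have mQ: "?m \<in> Q" using convexD[OF Q(2) Qm(2,3), of "1/2" "1/2"] by simp
  have "b ?m y \<le> (1 - 1/2) * b q y + (1/2) * b z y"
    by (rule convex_onD[OF b_convex[OF ctD(1)[OF y]]]) (use Qm in auto)
  moreover have "b ((1 - \<tau>) *\<^sub>R qt + \<tau> *\<^sub>R ?m) y \<le> (1 - \<tau>) * b qt y + \<tau> * b ?m y"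
    by (rule convex_onD[OF b_convex[OF ctD(1)[OF y]]]) (use \<tau> qt mQ in auto)
  moreover have "(1 - \<tau>) *\<^sub>R qt + \<tau> *\<^sub>R ?m = x"
    by (simp add: x algebra_simps)
  ultimately have "b x y \<le> (1 - \<tau>) * b qt y + \<tau> * ((1 - 1/2) * b q y + (1/2) * b z y)"
    using \<tau> by (smt (verit) mult_left_mono)
  \<comment> \<open>The weights add up to 1, and every difference is at most \<epsilon>. Hence the
    one at \<open>q\<close>, which carries the weight \<tau>/2, cannot be far below 0.\<close>
  then have "0 \<le> (1 - \<tau>) * (b qt y - b x y) + \<tau> / 2 * (b q y - b x y) + \<tau> / 2 * (b z y - b x y)"
    by (simp add: algebra_simps)
  moreover have "(1 - \<tau>) * (b qt y - b x y) \<le> (1 - \<tau>) * \<epsilon>"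
    using \<tau> \<phi>[of qt] qt eps by (intro mult_left_mono) auto
  moreover have "\<tau> / 2 * (b z y - b x y) \<le> \<tau> / 2 * \<epsilon>"
    using \<tau> \<phi>[of z] m(3) by (intro mult_left_mono) (auto simp: sub_def)
  ultimately have "0 \<le> (1 - \<tau>) * \<epsilon> + \<tau> / 2 * (b q y - b x y) + \<tau> / 2 * \<epsilon>" by linarith
  moreover have "(1 - \<tau>) * \<epsilon> + \<tau> / 2 * \<epsilon> \<le> \<epsilon>" using \<tau> eps by (simp add: algebra_simps)
  ultimately have "0 \<le> \<epsilon> + \<tau> / 2 * (b q y - b x y)" by linarith
  then have "- (2 / \<tau>) * \<epsilon> \<le> b q y - b x y" using \<tau>(1) by (simp add: field_simps)
  moreover have "P q y \<bullet> (v - q) \<le> b v y - b q y"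
    using b_tangent[OF Qm(2,4) ctD(1)[OF y]] by linarith
  moreover have "b v y - b x y \<le> \<epsilon>" using \<phi>[of v] v by (auto simp: sub_def)
  ultimately show ?thesis by (simp add: distrib_right)
qed

text \<open>A parallelepiped \<open>E\<close> in the sublevel set has volume proportional to the
  determinant of the \<open>z i\<close>; the gradients at \<open>qc\<close> of contacts over
  \<open>E\<close> lie in slabs dual to the \<open>z i\<close>, whose volume is \<epsilon>^n over
  that determinant. The lower bound on the measure holds only near \<open>qt\<close>, so
  \<open>E\<close> is contracted towards \<open>qt\<close> by a factor \<tau> that does not depend
  on \<epsilon>.\<close>

lemma lower_estimate:
  "\<exists>\<epsilon>1>0. \<exists>C\<ge>0. \<forall>\<epsilon> q0 z. 0 < \<epsilon> \<longrightarrow> \<epsilon> \<le> \<epsilon>1 \<longrightarrow> q0 \<in> sub \<epsilon> \<longrightarrow> (\<forall>i. q0 + z i \<in> sub \<epsilon>) \<longrightarrow>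
      (det (\<chi> i. z i))\<^sup>2 \<le> C * \<epsilon> ^ CARD('n)"
proof -
  let ?n = "real CARD('n)"
  have n: "?n > 0" by simp
  obtain \<epsilon>0 where e0: "0 < \<epsilon>0" "\<And>\<epsilon>. \<epsilon> \<le> \<epsilon>0 \<Longrightarrow> compact (sub \<epsilon>)" using sub_compact by blast
  obtain l r where l: "l > 0" "r > 0" and low: "\<And>E. compact E \<Longrightarrow> E \<subseteq> Q \<Longrightarrow> E \<subseteq> cball qt r \<Longrightarrow>
      l * measure lebesgue E \<le> measure lebesgue (\<Union>q\<in>E. ct q)" using MA_lower by blast
  have "sub \<epsilon>0 \<subseteq> Q" by (auto simp: sub_def)
  from meas_ge[OF e0(2)[OF order_refl] this] obtain B where B: "B \<ge> 0"
    and ge: "\<And>q A. q \<in> sub \<epsilon>0 \<Longrightarrow> compact A \<Longrightarrow> A \<subseteq> Y \<Longrightarrow> measure lebesgue A \<le> B * measure lebesgue (P q ` A)"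
    by blast
  obtain M where M: "M > 0" "\<And>q. q \<in> K \<Longrightarrow> norm (q - qt) \<le> M"
  proof -
    have "bounded ((\<lambda>q. q - qt) ` K)" using compact_imp_bounded[OF K] by (rule bounded_translation_minus)
    then show ?thesis using that unfolding bounded_pos by blast
  qed
  \<comment> \<open>\<open>M\<close> bounds the distance of points of \<open>K\<close> from
    \<open>qt\<close>, so contraction by \<tau> moves all of \<open>K\<close> to within
    \<open>r\<close> of \<open>qt\<close>.\<close>
  define \<tau> where "\<tau> = min 1 (r / M)"
  have \<tau>: "0 < \<tau>" "\<tau> \<le> 1" "\<tau> * M \<le> r"
  proof -
    show "0 < \<tau>" "\<tau> \<le> 1" using l M by (auto simp: \<tau>_def)
    have "\<tau> * M \<le> r / M * M" using M by (intro mult_right_mono) (auto simp: \<tau>_def)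
    then show "\<tau> * M \<le> r" using M by simp
  qed
  define c where "c = l * (\<tau> / (2 * ?n)) ^ CARD('n)"
  \<comment> \<open>Twice the half-width of the slabs, divided by \<epsilon>: the factor ?n + 1 is
    from \<open>simplex_dual_bound\<close>, the factor 1 + 2/\<tau> from
    \<open>contact_gradient_bound\<close>.\<close>
  define h where "h = 2 * ((?n + 1) * (1 + 2 / \<tau>))"
  have c: "c > 0" using l \<tau> n by (simp add: c_def)
  have h: "h > 0" using \<tau> n by (simp add: h_def add_pos_pos)
  have C0: "0 \<le> B * h ^ CARD('n) / c" using B h c by simp
  have "\<forall>\<epsilon> q0 z. 0 < \<epsilon> \<longrightarrow> \<epsilon> \<le> \<epsilon>0 \<longrightarrow> q0 \<in> sub \<epsilon> \<longrightarrow> (\<forall>i. q0 + z i \<in> sub \<epsilon>) \<longrightarrow>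
      (det (\<chi> i. z i))\<^sup>2 \<le> B * h ^ CARD('n) / c * \<epsilon> ^ CARD('n)"
  proof (intro allI impI)
    fix \<epsilon> q0 and z :: "'n \<Rightarrow> real^'n"
    assume \<epsilon>: "0 < \<epsilon>" "\<epsilon> \<le> \<epsilon>0" and q0: "q0 \<in> sub \<epsilon>" and z': "\<forall>i. q0 + z i \<in> sub \<epsilon>"
    have z: "q0 + z i \<in> sub \<epsilon>" for i using z' by blast
    let ?D = "\<bar>det (\<chi> i. z i)\<bar>"
    show "(det (\<chi> i. z i))\<^sup>2 \<le> B * h ^ CARD('n) / c * \<epsilon> ^ CARD('n)"
    proof (cases "det (\<chi> i. z i) = 0")
      case True
      then show ?thesis using B h c \<epsilon> by simp
    next
      case False
      \<comment> \<open>The barycentre of the simplex with vertices \<open>q0\<close> and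
        \<open>q0 + z i\<close>; only there do the one-sided gradient bounds become
        two-sided.\<close>
      define qc where "qc = q0 + (\<Sum>i\<in>UNIV. (1 / (?n + 1)) *\<^sub>R z i)"
      have qc: "qc \<in> sub \<epsilon>" unfolding qc_def by (rule sub_simplex[OF q0 z]) auto
      \<comment> \<open>After division by \<tau>/2 the coefficients add up to at most 1, so the
        points of \<open>E\<close> are combinations of \<open>qt\<close>, \<open>qc\<close> and a
        point of the simplex with weights 1 - \<tau>, \<tau>/2 and \<tau>/2.\<close>
      define Pi where "Pi = {\<Sum>i\<in>UNIV. t $ i *\<^sub>R z i |t. \<forall>i. 0 \<le> t $ i \<and> t $ i \<le> \<tau> / (2 * ?n)}"
      define E where "E = (+) ((1 - \<tau>) *\<^sub>R qt + (\<tau> / 2) *\<^sub>R qc + (\<tau> / 2) *\<^sub>R q0) ` Pi"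
      have r0: "0 \<le> \<tau> / (2 * ?n)" using \<tau> n by simp
      have Pi_c: "compact Pi" unfolding Pi_def by (rule compact_parallelepiped[OF r0])
      have "compact E" unfolding E_def by (rule compact_translation[OF Pi_c])
      have "measure lebesgue E = measure lebesgue Pi" unfolding E_def by (rule measure_translation)
      then have mE: "measure lebesgue E = (\<tau> / (2 * ?n)) ^ CARD('n) * ?D"
        unfolding Pi_def measure_parallelepiped[OF r0] .
      have subQ: "w \<in> sub \<epsilon> \<Longrightarrow> w \<in> Q" "w \<in> sub \<epsilon> \<Longrightarrow> w \<in> K" for w using Q(3) by (auto simp: sub_def)
      have qts: "qt \<in> sub \<epsilon>" using qt \<epsilon> by (simp add: sub_def)
      have Edesc: "\<exists>w. w \<in> sub \<epsilon> \<and> x = (1 - \<tau>) *\<^sub>R qt + (\<tau> / 2) *\<^sub>R qc + (\<tau> / 2) *\<^sub>R w" if x: "x \<in> E" for x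
      proof -
        obtain t where t: "\<And>i. 0 \<le> t $ i" "\<And>i. t $ i \<le> \<tau> / (2 * ?n)"
          and xt: "x = (1 - \<tau>) *\<^sub>R qt + (\<tau> / 2) *\<^sub>R qc + (\<tau> / 2) *\<^sub>R q0 + (\<Sum>i\<in>UNIV. t $ i *\<^sub>R z i)"
          using x unfolding E_def Pi_def by blast
        have w: "q0 + (\<Sum>i\<in>UNIV. (2 / \<tau> * t $ i) *\<^sub>R z i) \<in> sub \<epsilon>" (is "?w \<in> _")
        proof (rule sub_simplex[OF q0 z])
          show "0 \<le> 2 / \<tau> * t $ i" for i using t(1)[of i] \<tau> by simp
          have "(\<Sum>i\<in>UNIV. 2 / \<tau> * t $ i) \<le> (\<Sum>i\<in>(UNIV :: 'n set). 2 / \<tau> * (\<tau> / (2 * ?n)))"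
            using \<tau> t(2) by (intro sum_mono mult_left_mono) auto
          also have "\<dots> = 1" using \<tau> n by simp
          finally show "(\<Sum>i\<in>UNIV. 2 / \<tau> * t $ i) \<le> 1" .
        qed
        have eq: "(\<tau> / 2) *\<^sub>R (q0 + (\<Sum>i\<in>UNIV. (2 / \<tau> * t $ i) *\<^sub>R z i)) = (\<tau> / 2) *\<^sub>R q0 + (\<Sum>i\<in>UNIV. t $ i *\<^sub>R z i)"
          using \<tau>(1) by (simp add: scaleR_add_right scaleR_sum_right)
        show ?thesis
          by (rule exI[of _ ?w], rule conjI[OF w]) (simp only: xt eq add.assoc)
      qed
      have Esub: "x \<in> sub \<epsilon> \<and> dist qt x \<le> r" if x: "x \<in> E" for x
      proof -
        obtain w where w: "w \<in> sub \<epsilon>" "x = (1 - \<tau>) *\<^sub>R qt + (\<tau> / 2) *\<^sub>R qc + (\<tau> / 2) *\<^sub>R w" using Edesc[OF x] by blast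
        have m: "(1/2) *\<^sub>R qc + (1/2) *\<^sub>R w \<in> sub \<epsilon>" (is "?m \<in> _")
          by (rule convexD[OF sub_convex qc w(1)]) auto
        have xm: "x = (1 - \<tau>) *\<^sub>R qt + \<tau> *\<^sub>R ?m" by (simp add: w(2) scaleR_add_right)
        have "x \<in> sub \<epsilon>" unfolding xm by (rule convexD[OF sub_convex qts m]) (use \<tau> in auto)
        moreover have "x - qt = \<tau> *\<^sub>R (?m - qt)" unfolding xm by (simp add: algebra_simps)
        then have "dist qt x = \<tau> * norm (?m - qt)" using \<tau> by (simp add: dist_norm norm_minus_commute[of qt])
        then have "dist qt x \<le> r"
          using order_trans[OF mult_left_mono[OF M(2)[OF subQ(2)[OF m]], of \<tau>] \<tau>(3)] \<tau>(1) by simp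
        ultimately show ?thesis by simp
      qed
      define A where "A = (\<Union>x\<in>E. ct x)"
      have EK: "E \<subseteq> Q" "E \<subseteq> K" "E \<subseteq> cball qt r" using Esub subQ by (auto simp: subset_iff)
      have A: "compact A" "A \<subseteq> Y"
        unfolding A_def using ct_union_compact[OF \<open>compact E\<close> EK(2)] ctD(1) by auto
      define H where "H = (1 + 2 / \<tau>) * \<epsilon>"
      have H: "0 < H" using \<tau> \<epsilon> by (simp add: H_def add_pos_pos)
      let ?S = "{x. \<forall>i. \<bar>z i \<bullet> x\<bar> \<le> (?n + 1) * H}"
      have "P qc ` A \<subseteq> ?S"
      proof safe
        fix y i assume "y \<in> A"
        then obtain x where x: "x \<in> E" "y \<in> ct x" by (auto simp: A_def)
        obtain w where w: "w \<in> sub \<epsilon>" "x = (1 - \<tau>) *\<^sub>R qt + (\<tau> / 2) *\<^sub>R qc + (\<tau> / 2) *\<^sub>R w" using Edesc[OF x(1)] by blast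
        have bnd: "P qc y \<bullet> (v - qc) \<le> H" if "v \<in> sub \<epsilon>" for v
          unfolding H_def using contact_gradient_bound[OF _ qc w(1) \<tau>(1,2) w(2) x(2) that] Esub[OF x(1)] by blast
        define m where "m = (\<Sum>i\<in>UNIV. P qc y \<bullet> z i) / (?n + 1)"
        have mq: "P qc y \<bullet> (qc - q0) = m"
          by (simp add: qc_def m_def inner_sum_right scaleR_sum_right[symmetric] divide_simps)
        have "- m \<le> H" using bnd[OF q0] mq by (simp add: inner_diff_right)
        moreover have "P qc y \<bullet> z i - m \<le> H" for i
        proof -
          show ?thesis using bnd[OF z[of i]] mq by (simp add: inner_diff_right inner_add_right)
        qed
        ultimately show "\<bar>z i \<bullet> P qc y\<bar> \<le> (?n + 1) * H"
          using simplex_dual_bound[OF m_def, of H i] by (simp add: inner_commute)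
      qed
      moreover have qcQ: "qc \<in> Q" using subQ qc by blast
      have "continuous_on A (P qc)"
      proof -
        have "continuous_on A (\<lambda>y. (qc, y))" by (intro continuous_intros)
        from continuous_on_compose2[OF P_cont this] qcQ A(2) show ?thesis by auto
      qed
      then have "compact (P qc ` A)" using A(1) by (rule compact_continuous_image)
      moreover have H0: "0 \<le> (?n + 1) * H" for i :: 'n using H n by simp
      ultimately have "measure lebesgue (P qc ` A) \<le> measure lebesgue ?S"
        using compact_slabs[OF False, of "\<lambda>_. (?n + 1) * H"]
        by (intro measure_mono_fmeasurable fmeasurableD lmeasurable_compact)
      also have "\<dots> = (2 * ((?n + 1) * H)) ^ CARD('n) / ?D"
        using measure_slabs[OF False, of "\<lambda>_. (?n + 1) * H"] H0 by simp
      also have "2 * ((?n + 1) * H) = h * \<epsilon>" by (simp add: h_def H_def)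
      finally have mP: "measure lebesgue (P qc ` A) \<le> (h * \<epsilon>) ^ CARD('n) / ?D" .
      have "c * ?D = l * measure lebesgue E" unfolding mE c_def by simp
      also have "\<dots> \<le> measure lebesgue A" unfolding A_def by (rule low[OF \<open>compact E\<close> EK(1,3)])
      also have "\<dots> \<le> B * measure lebesgue (P qc ` A)"
        using qc \<epsilon> by (intro ge A) (auto simp: sub_def)
      also have "\<dots> \<le> B * ((h * \<epsilon>) ^ CARD('n) / ?D)" by (rule mult_left_mono[OF mP B])
      finally have "c * ?D * ?D \<le> B * (h * \<epsilon>) ^ CARD('n)"
        using False by (simp add: pos_le_divide_eq)
      then have "c * (det (\<chi> i. z i))\<^sup>2 \<le> B * (h * \<epsilon>) ^ CARD('n)"
        by (simp add: power2_eq_square mult.assoc)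
      then show ?thesis using c by (simp add: power_mult_distrib pos_le_divide_eq mult.commute mult.left_commute)
    qed
  qed
  with e0(1) C0 show ?thesis by blast
qed

text \<open>As \<open>u q0 = 0\<close>, a contact \<open>y\<close> at \<open>q\<close> bounds
  \<open>u q\<close> by \<open>b q y - b q0 y\<close>, hence by the length of the gradient at
  \<open>q\<close> times the distance from \<open>q0\<close>; near \<open>q0\<close> all gradients
  are bounded.\<close>

lemma sublevel_ball:
  assumes q0: "q0 \<in> Q" "u q0 = 0"
  shows "\<exists>L>0. \<exists>\<epsilon>1>0. \<forall>\<epsilon>. 0 < \<epsilon> \<longrightarrow> \<epsilon> \<le> \<epsilon>1 \<longrightarrow> cball q0 (\<epsilon> / L) \<subseteq> sub \<epsilon>"
proof -
  obtain r where r: "r > 0" "cball q0 r \<subseteq> Q" using Q(1) q0(1) open_contains_cball_eq by blast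
  have "compact (cball q0 r \<times> Y)" using Y(1) by (intro compact_Times compact_cball)
  moreover have "continuous_on (cball q0 r \<times> Y) (\<lambda>z. P (fst z) (snd z))"
    by (rule continuous_on_subset[OF P_cont]) (use r(2) in auto)
  ultimately have "bounded ((\<lambda>z. P (fst z) (snd z)) ` (cball q0 r \<times> Y))"
    by (intro compact_imp_bounded compact_continuous_image)
  then obtain L where L: "L > 0" and L': "\<forall>p\<in>(\<lambda>z. P (fst z) (snd z)) ` (cball q0 r \<times> Y). norm p \<le> L"
    unfolding bounded_pos by blast
  have PL: "norm (P q y) \<le> L" if "q \<in> cball q0 r" "y \<in> Y" for q y
    using bspec[OF L', of "P q y"] that by force
  have "q \<in> sub \<epsilon>" if \<epsilon>: "0 < \<epsilon>" "\<epsilon> \<le> L * r" and q: "q \<in> cball q0 (\<epsilon> / L)" for \<epsilon> q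
  proof -
    have "\<epsilon> / L \<le> r" using \<epsilon> L by (simp add: divide_simps mult.commute)
    then have qr: "q \<in> cball q0 r" using q by simp
    then have qQ: "q \<in> Q" using r(2) by blast
    obtain y where y: "y \<in> ct q" using contacts_ne[OF qQ] by blast
    have "u q + b q0 y - b q y \<le> 0" using ctD(2)[OF y, of q0] q0 Q(3) by auto
    moreover have "b q y + P q y \<bullet> (q0 - q) \<le> b q0 y" by (rule b_tangent[OF qQ q0(1) ctD(1)[OF y]])
    moreover have "- (P q y \<bullet> (q0 - q)) \<le> L * (\<epsilon> / L)"
    proof -
      have "- (P q y \<bullet> (q0 - q)) \<le> norm (P q y) * norm (q0 - q)"
        using Cauchy_Schwarz_ineq2[of "P q y" "q0 - q"] by linarith
      also have "\<dots> \<le> L * (\<epsilon> / L)"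
        using PL[OF qr ctD(1)[OF y]] q L by (intro mult_mono) (auto simp: dist_norm)
      finally show ?thesis .
    qed
    ultimately have "u q \<le> \<epsilon>" using L by simp
    with qQ show ?thesis by (simp add: sub_def)
  qed
  then show ?thesis using L r(1) by (intro exI[of _ L] conjI exI[of _ "L * r"]) auto
qed

text \<open>By \<open>dual\<close>, the pairs of a gradient at \<open>q0\<close> and a bound on the
  rise over \<open>S\<close> form a convex set. It contains the origin through \<open>y0\<close>, so
  small coefficients scale the rise down together with the gradients.\<close>

lemma contact_shift_hull:
  fixes y :: "'n \<Rightarrow> real^'n"
  assumes q0: "q0 \<in> Q" and S: "S \<subseteq> K" and y: "\<And>i. y i \<in> Y" "\<And>i q. q \<in> S \<Longrightarrow> b q (y i) - b q0 (y i) \<le> r"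
    and t: "\<And>i. 0 \<le> t i" "(\<Sum>i\<in>UNIV. t i) \<le> 1"
  shows "\<exists>y'\<in>Y. P q0 y' = (\<Sum>i\<in>UNIV. t i *\<^sub>R P q0 (y i)) \<and> (\<forall>q\<in>S. b q y' - b q0 y' \<le> (\<Sum>i\<in>UNIV. t i) * r)"
proof -
  define \<Gamma> where "\<Gamma> = {(p, r :: real). \<exists>y\<in>Y. P q0 y = p \<and> (\<forall>q\<in>S. b q y - b q0 y \<le> r)}"
  have "convex \<Gamma>"
  proof (rule convexI)
    fix g g' and s t :: real assume g: "g \<in> \<Gamma>" "g' \<in> \<Gamma>" and st: "0 \<le> s" "0 \<le> t" "s + t = 1"
    obtain p a p' a' where gg: "g = (p, a)" "g' = (p', a')" by fastforce
    obtain z where z: "z \<in> Y" "P q0 z = p" "\<And>q. q \<in> S \<Longrightarrow> b q z - b q0 z \<le> a" using g(1) gg by (auto simp: \<Gamma>_def)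
    obtain z' where z': "z' \<in> Y" "P q0 z' = p'" "\<And>q. q \<in> S \<Longrightarrow> b q z' - b q0 z' \<le> a'" using g(2) gg by (auto simp: \<Gamma>_def)
    have s: "s = 1 - t" "t \<le> 1" using st by auto
    obtain w where w: "w \<in> Y" "P q0 w = (1 - t) *\<^sub>R P q0 z + t *\<^sub>R P q0 z'"
      "\<And>q'. q' \<in> K \<Longrightarrow> b q' w - b q0 w \<le> (1 - t) * (b q' z - b q0 z) + t * (b q' z' - b q0 z')"
      using dual[OF q0 z(1) z'(1) st(2) s(2)] by blast
    have "b q w - b q0 w \<le> s * a + t * a'" if q: "q \<in> S" for q
    proof -
      have "(1 - t) * (b q z - b q0 z) + t * (b q z' - b q0 z') \<le> (1 - t) * a + t * a'"
        using z(3)[OF q] z'(3)[OF q] st s by (intro add_mono mult_left_mono) auto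
      then show ?thesis using w(3)[of q] q S s(1) by force
    qed
    then show "s *\<^sub>R g + t *\<^sub>R g' \<in> \<Gamma>"
      using w(1,2) z(2) z'(2) s(1) unfolding \<Gamma>_def gg by auto
  qed
  moreover have "(0, 0) \<in> \<Gamma>"
  proof -
    have "b q y0 - b q0 y0 \<le> 0" if "q \<in> S" for q
    proof -
      have "q \<in> K" "q0 \<in> K" using that q0 Q(3) S by auto
      then show ?thesis by (simp add: b_base)
    qed
    then show ?thesis using Y(2) P_base[OF q0] unfolding \<Gamma>_def by blast
  qed
  then have "0 \<in> \<Gamma>" by (simp add: zero_prod_def)
  moreover have "(P q0 (y i), r) \<in> \<Gamma>" for i using y by (auto simp: \<Gamma>_def)
  ultimately have "(\<Sum>i\<in>UNIV. t i *\<^sub>R (P q0 (y i), r)) \<in> \<Gamma>"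
    by (intro convex_subsum) (use t in auto)
  moreover have "(\<Sum>i\<in>UNIV. t i *\<^sub>R (P q0 (y i), r)) = (\<Sum>i\<in>UNIV. t i *\<^sub>R P q0 (y i), (\<Sum>i\<in>UNIV. t i) * r)"
    by (simp add: sum_prod sum_distrib_right)
  ultimately show ?thesis by (auto simp: \<Gamma>_def)
qed

text \<open>Small multiples of the \<open>e i\<close>, scaled by the widths, are subgradients of \<open>u\<close> over \<open>sub \<epsilon>\<close>. By
  \<open>P_near\<close> the gradients at \<open>q0\<close> of the corresponding contacts are almost orthogonal, and by
  \<open>contact_shift_hull\<close> their hull, scaled by a quarter, consists of gradients of contacts over
  \<open>sub \<epsilon>\<close>.\<close>

lemma upper_estimate:
  fixes i0 :: 'n
  assumes q0: "q0 \<in> Q" "u q0 = 0" and e1: "\<And>q. q \<in> K \<Longrightarrow> u q = 0 \<Longrightarrow> e1 \<bullet> (q - q0) \<le> 0"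
  shows "\<exists>C\<ge>0. \<forall>d>0. \<exists>\<epsilon>2>0. \<forall>\<epsilon> e w. 0 < \<epsilon> \<longrightarrow> \<epsilon> \<le> \<epsilon>2 \<longrightarrow>
    (\<forall>i j. e i \<bullet> e j = (if i = j then 1 else 0)) \<longrightarrow> e i0 = e1 \<longrightarrow>
    (\<forall>i. i \<noteq> i0 \<longrightarrow> (\<forall>q\<in>sub \<epsilon>. \<bar>e i \<bullet> (q - q0)\<bar> \<le> w i)) \<longrightarrow>
    \<epsilon> ^ CARD('n) \<le> C * d * (\<Prod>i\<in>UNIV - {i0}. w i :: real)\<^sup>2"
proof -
  let ?n = "real CARD('n)"
  have n: "?n > 0" by simp
  obtain \<epsilon>0 where e0: "0 < \<epsilon>0" "\<And>\<epsilon>. \<epsilon> \<le> \<epsilon>0 \<Longrightarrow> compact (sub \<epsilon>)" "\<And>\<epsilon>. \<epsilon> \<le> \<epsilon>0 \<Longrightarrow> sub \<epsilon> = {q \<in> K. u q \<le> \<epsilon>}"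
    using sub_compact by blast
  obtain L \<epsilon>1 where L: "L > 0" "\<epsilon>1 > 0" "\<And>\<epsilon>. 0 < \<epsilon> \<Longrightarrow> \<epsilon> \<le> \<epsilon>1 \<Longrightarrow> cball q0 (\<epsilon> / L) \<subseteq> sub \<epsilon>"
    using sublevel_ball[OF q0] by blast
  obtain \<eta> where \<eta>: "\<eta> > 0" and det\<eta>: "\<And>e d :: 'n \<Rightarrow> real^'n. (\<forall>i j. e i \<bullet> e j = (if i = j then 1 else 0)) \<Longrightarrow> (\<forall>i. norm (d i) \<le> \<eta>) \<Longrightarrow>
     1 / 2 \<le> \<bar>det (\<chi> i. e i + d i)\<bar>"
    using det_near_orthonormal by blast
  have sub0: "sub \<epsilon>0 \<subseteq> Q" "q0 \<in> sub \<epsilon>0" using q0 e0(1) by (auto simp: sub_def)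
  obtain \<rho> where \<rho>: "\<rho> > 0" and near\<rho>: "\<And>q y. q \<in> sub \<epsilon>0 \<Longrightarrow> y \<in> Y \<Longrightarrow> norm (P q y) \<le> \<rho> \<Longrightarrow> norm (P q0 y - P q y) \<le> \<eta> * norm (P q y)"
    using P_near[OF e0(2)[OF order_refl] sub0 \<eta>] by blast
  obtain B0 where B0: "B0 \<ge> 0" "\<And>A. compact A \<Longrightarrow> A \<subseteq> Y \<Longrightarrow> measure lebesgue (P q0 ` A) \<le> B0 * measure lebesgue A"
    using meas_le[OF q0(1)] by blast
  obtain B where B: "B \<ge> 0" "\<And>Z. compact Z \<Longrightarrow> Z \<subseteq> Q \<Longrightarrow> measure lebesgue (\<Union>q\<in>Z. ct q) \<le> B * measure lebesgue Z"
    using MA_upper by blast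
  obtain M where M: "M > 0" "\<And>q. q \<in> K \<Longrightarrow> norm (q - q0) \<le> M"
  proof -
    have "bounded ((\<lambda>q. q - q0) ` K)" using compact_imp_bounded[OF K] by (rule bounded_translation_minus)
    then show ?thesis using that unfolding bounded_pos by blast
  qed
  \<comment> \<open>The bound 1/2 puts the minima of \<open>u\<close> minus a linear function
    strictly below the level \<epsilon>; the bound \<rho>/L keeps the gradients in the range of
    \<open>P_near\<close>.\<close>
  define \<kappa> where "\<kappa> = min (1 / 2) (\<rho> / L)"
  have \<kappa>: "0 < \<kappa>" "\<kappa> \<le> 1 / 2" "\<kappa> * L \<le> \<rho>"
  proof -
    show "0 < \<kappa>" using \<rho> L(1) by (simp add: \<kappa>_def)
    show "\<kappa> \<le> 1 / 2" unfolding \<kappa>_def by (rule min.cobounded1)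
    have "\<kappa> * L \<le> \<rho> / L * L" using L by (intro mult_right_mono) (auto simp: \<kappa>_def)
    then show "\<kappa> * L \<le> \<rho>" using L by simp
  qed
  \<comment> \<open>The factors come from the sides of \<open>Pi\<close>, from
    \<open>det_near_orthonormal\<close> and from the lengths \<open>s i\<close>. Neither
    \<open>c\<close> nor \<open>C\<close> involves \<open>d\<close>.\<close>
  define c where "c = (1 / (4 * ?n)) ^ CARD('n) * (1 / 2) * \<kappa> ^ CARD('n)"
  have c: "c > 0" using \<kappa> n by (simp add: c_def)
  define C where "C = B0 * B * 2 ^ CARD('n) * M / c"
  have C: "C \<ge> 0" using B0 B M c by (simp add: C_def)
  have "\<exists>\<epsilon>2>0. \<forall>\<epsilon> e w. 0 < \<epsilon> \<longrightarrow> \<epsilon> \<le> \<epsilon>2 \<longrightarrow>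
    (\<forall>i j. e i \<bullet> e j = (if i = j then 1 else 0)) \<longrightarrow> e i0 = e1 \<longrightarrow>
    (\<forall>i. i \<noteq> i0 \<longrightarrow> (\<forall>q\<in>sub \<epsilon>. \<bar>e i \<bullet> (q - q0)\<bar> \<le> w i)) \<longrightarrow>
    \<epsilon> ^ CARD('n) \<le> C * d * (\<Prod>i\<in>UNIV - {i0}. w i :: real)\<^sup>2" if d: "d > 0" for d
  proof -
    \<comment> \<open>By \<open>e1\<close> no zero of \<open>u\<close> lies at distance
      \<open>d\<close> or more beyond \<open>q0\<close>, so by compactness \<open>u\<close> has a
      positive minimum there, and small sublevel sets stay within \<open>d\<close>.\<close>
    have "\<exists>m>0. \<forall>q\<in>K. d \<le> e1 \<bullet> (q - q0) \<longrightarrow> m \<le> u q"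
    proof (cases "K \<inter> {q. d \<le> e1 \<bullet> (q - q0)} = {}")
      case True
      then show ?thesis by (intro exI[of _ 1]) auto
    next
      case False
      have "closed {q. d \<le> e1 \<bullet> (q - q0)}" by (intro closed_Collect_le continuous_intros)
      then have "compact (K \<inter> {q. d \<le> e1 \<bullet> (q - q0)})" using K by (rule compact_Int_closed[rotated])
      from continuous_attains_inf[OF this False continuous_on_subset[OF u_cont]]
      obtain q1 where q1: "q1 \<in> K" "d \<le> e1 \<bullet> (q1 - q0)" "\<And>q. q \<in> K \<Longrightarrow> d \<le> e1 \<bullet> (q - q0) \<Longrightarrow> u q1 \<le> u q"
        by auto
      have "u q1 \<noteq> 0" using e1[OF q1(1)] q1(2) d by auto
      then have "u q1 > 0" using u_nonneg[OF q1(1)] by simp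
      with q1(3) show ?thesis by blast
    qed
    then obtain m where m: "m > 0" "\<And>q. q \<in> K \<Longrightarrow> d \<le> e1 \<bullet> (q - q0) \<Longrightarrow> m \<le> u q" by blast
    \<comment> \<open>The bound \<open>d * L\<close> makes \<open>\<epsilon> / L\<close> at most
      \<open>d\<close>, the width used in the direction \<open>i0\<close>; half of \<open>m\<close>
      keeps \<epsilon> strictly below \<open>m\<close>.\<close>
    define \<epsilon>2 where "\<epsilon>2 = min (min \<epsilon>0 \<epsilon>1) (min (m / 2) (d * L))"
    have e2: "\<epsilon>2 > 0" "\<epsilon>2 \<le> \<epsilon>0" "\<epsilon>2 \<le> \<epsilon>1" "\<epsilon>2 < m" "\<epsilon>2 \<le> d * L"
      using e0 L m d by (auto simp: \<epsilon>2_def min_def)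
    have "\<epsilon> ^ CARD('n) \<le> C * d * (\<Prod>i\<in>UNIV - {i0}. w i :: real)\<^sup>2"
      if \<epsilon>: "0 < \<epsilon>" "\<epsilon> \<le> \<epsilon>2" and e: "\<forall>i j. e i \<bullet> e j = (if i = j then 1 else 0)" "e i0 = e1"
        and w: "\<And>i q. i \<noteq> i0 \<Longrightarrow> q \<in> sub \<epsilon> \<Longrightarrow> \<bar>e i \<bullet> (q - q0)\<bar> \<le> w i" for \<epsilon> e and w :: "'n \<Rightarrow> real"
    proof -
      have en: "norm (e i) = 1" for i using e(1) by (simp add: norm_eq_1)
      have \<epsilon>': "\<epsilon> \<le> \<epsilon>0" "\<epsilon> \<le> \<epsilon>1" "\<epsilon> < m" "\<epsilon> \<le> d * L" using \<epsilon> e2 by auto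
      note Zc = e0(2)[OF \<epsilon>'(1)]
      have ZQ: "q \<in> Q" "q \<in> K" "u q \<le> \<epsilon>" if "q \<in> sub \<epsilon>" for q using that Q(3) by (auto simp: sub_def)
      have q0Z: "q0 \<in> sub \<epsilon>" using q0 \<epsilon>(1) by (simp add: sub_def)
      \<comment> \<open>In the direction \<open>e1\<close> the sublevel set is confined to
        \<open>d\<close> on the forward side only. This is enough, since \<open>pZ\<close> bounds
        the rise of a linear function from one side.\<close>
      define W where "W i = (if i = i0 then d else w i)" for i
      have WL: "\<epsilon> / L \<le> W i" for i
      proof (cases "i = i0")
        case True
        then show ?thesis using \<epsilon>'(4) L by (simp add: W_def divide_simps)
      next
        case False
        have "q0 + (\<epsilon> / L) *\<^sub>R e i \<in> cball q0 (\<epsilon> / L)" using en[of i] \<epsilon>(1) L(1) by (simp add: dist_norm)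
        then have "q0 + (\<epsilon> / L) *\<^sub>R e i \<in> sub \<epsilon>" using L(3)[OF \<epsilon>(1) \<epsilon>'(2)] by blast
        from w[OF False this] show ?thesis using e(1) False \<epsilon>(1) L(1) by (simp add: W_def)
      qed
      have W0: "W i > 0" for i using WL[of i] divide_pos_pos[OF \<epsilon>(1) L(1)] by linarith
      \<comment> \<open>Chosen so that the linear function with gradient
        \<open>s i *\<^sub>R e i\<close> rises by at most \<kappa>\<epsilon> above its value at
        \<open>q0\<close>.\<close>
      define s where "s i = \<kappa> * \<epsilon> / W i" for i
      have s: "s i > 0" for i using W0 \<kappa> \<epsilon>(1) by (simp add: s_def)
      have s\<rho>: "s i \<le> \<rho>" for i
      proof -
        have "s i \<le> \<kappa> * \<epsilon> / (\<epsilon> / L)" unfolding s_def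
          using WL[of i] \<kappa> \<epsilon>(1) L(1) by (intro divide_left_mono mult_pos_pos W0) auto
        also have "\<dots> = \<kappa> * L" using \<epsilon>(1) by simp
        finally show ?thesis using \<kappa>(3) by linarith
      qed
      have pZ: "s i *\<^sub>R e i \<bullet> (q - q0) \<le> \<kappa> * \<epsilon>" if q: "q \<in> sub \<epsilon>" for i q
      proof -
        have "e i \<bullet> (q - q0) \<le> W i"
        proof (cases "i = i0")
          case True
          have "\<not> d \<le> e1 \<bullet> (q - q0)"
          proof
            assume "d \<le> e1 \<bullet> (q - q0)"
            from m(2)[OF ZQ(2)[OF q] this] show False using ZQ(3)[OF q] \<epsilon>'(3) by linarith
          qed
          then show ?thesis using True e(2) by (simp add: W_def)
        next
          case False
          from w[OF False q] show ?thesis using False by (simp add: W_def)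
        qed
        then have "s i * (e i \<bullet> (q - q0)) \<le> s i * W i" using s[of i] by (intro mult_left_mono) auto
        also have "s i * W i = \<kappa> * \<epsilon>" using W0[of i] by (simp add: s_def)
        finally show ?thesis by simp
      qed
      have "\<exists>y q. q \<in> sub \<epsilon> \<and> y \<in> ct q \<and> P q y = s i *\<^sub>R e i" for i
      proof -
        let ?p = "s i *\<^sub>R e i"
        have "continuous_on (sub \<epsilon>) u" by (rule continuous_on_subset[OF u_cont]) (use ZQ in auto)
        then have "continuous_on (sub \<epsilon>) (\<lambda>q. u q - ?p \<bullet> q)" by (intro continuous_intros)
        from continuous_attains_inf[OF Zc _ this] q0Z
        obtain q where q: "q \<in> sub \<epsilon>" "\<And>x. x \<in> sub \<epsilon> \<Longrightarrow> u q - ?p \<bullet> q \<le> u x - ?p \<bullet> x" by blast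
        have "u q \<le> \<kappa> * \<epsilon>" using q(2)[OF q0Z] q0(2) pZ[OF q(1), of i] by (simp add: inner_diff_right algebra_simps)
        also have "\<dots> < 1 * \<epsilon>" using \<kappa> \<epsilon>(1) by (intro mult_strict_right_mono) auto
        finally have "u q < \<epsilon>" by simp
        from min_affine_contact[OF ZQ(1)[OF q(1)] this, of ?p] q show ?thesis
          unfolding sub_def by blast
      qed
      then obtain y qq where yq: "\<And>i. qq i \<in> sub \<epsilon>" "\<And>i. y i \<in> ct (qq i)" "\<And>i. P (qq i) (y i) = s i *\<^sub>R e i" by metis
      have yY: "y i \<in> Y" for i using ctD(1)[OF yq(2)[of i]] .
      define k where "k i = P q0 (y i)" for i
      have k: "norm (k i - s i *\<^sub>R e i) \<le> \<eta> * s i" for i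
      proof -
        have sn: "norm (P (qq i) (y i)) = s i" using en[of i] s[of i] by (simp add: yq(3))
        have "qq i \<in> sub \<epsilon>0" using yq(1)[of i] \<epsilon>'(1) by (auto simp: sub_def)
        from near\<rho>[OF this yY, of i] sn s\<rho>[of i] show ?thesis by (simp add: k_def yq(3))
      qed
      \<comment> \<open>One \<epsilon> bounds the rise above the value at the contact point
        \<open>qq i\<close>, the other pays for moving the reference point from \<open>qq i\<close>
        to \<open>q0\<close> with the tangent inequality.\<close>
      have shift: "b q (y i) - b q0 (y i) \<le> 2 * \<epsilon>" if q: "q \<in> sub \<epsilon>" for q i
      proof -
        have "b q (y i) - b (qq i) (y i) \<le> \<epsilon>"
          using ctD(2)[OF yq(2)[of i] ZQ(2)[OF q]] ZQ(3)[OF q] u_nonneg[OF ZQ(2)[OF yq(1)[of i]]] by linarith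
        moreover have "b (qq i) (y i) + P (qq i) (y i) \<bullet> (q0 - qq i) \<le> b q0 (y i)"
          by (rule b_tangent[OF ZQ(1)[OF yq(1)] q0(1) yY])
        moreover have "- (P (qq i) (y i) \<bullet> (q0 - qq i)) \<le> \<kappa> * \<epsilon>"
          using pZ[OF yq(1)[of i], of i] by (simp add: yq(3) inner_diff_right)
        moreover have "\<kappa> * \<epsilon> \<le> 1 * \<epsilon>" using \<kappa> \<epsilon>(1) by (intro mult_right_mono) auto
        ultimately show ?thesis by linarith
      qed
      \<comment> \<open>The coefficients add up to at most 1/4, which brings the rise 2\<epsilon> of
        the single contacts down to \<epsilon>/2, below the level required by
        \<open>min_contact\<close>.\<close>
      define Pi where "Pi = {\<Sum>i\<in>UNIV. t $ i *\<^sub>R k i |t. \<forall>i. 0 \<le> t $ i \<and> t $ i \<le> 1 / (4 * ?n)}"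
      define A where "A = (\<Union>q\<in>sub \<epsilon>. ct q)"
      have subs: "sub \<epsilon> \<subseteq> Q" "sub \<epsilon> \<subseteq> K" using ZQ by auto
      have A: "compact A" "A \<subseteq> Y"
        unfolding A_def using ct_union_compact[OF Zc subs(2)] ctD(1) by auto
      have "Pi \<subseteq> P q0 ` A"
      proof
        fix p assume "p \<in> Pi"
        then obtain t where t: "\<And>i. 0 \<le> t $ i" "\<And>i. t $ i \<le> 1 / (4 * ?n)" "p = (\<Sum>i\<in>UNIV. t $ i *\<^sub>R k i)"
          unfolding Pi_def by blast
        have "(\<Sum>i\<in>UNIV. t $ i) \<le> (\<Sum>i\<in>(UNIV :: 'n set). 1 / (4 * ?n))" by (rule sum_mono) (rule t(2))
        also have "\<dots> = 1 / 4" using n by simp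
        finally have t4: "(\<Sum>i\<in>UNIV. t $ i) \<le> 1 / 4" .
        obtain y' where y': "y' \<in> Y" "P q0 y' = p" and le: "\<And>q. q \<in> sub \<epsilon> \<Longrightarrow> b q y' - b q0 y' \<le> (\<Sum>i\<in>UNIV. t $ i) * (2 * \<epsilon>)"
          using contact_shift_hull[OF q0(1) subs(2) yY shift t(1)] t4 unfolding t(3) k_def by force
        have le2: "b q y' - b q0 y' \<le> \<epsilon> / 2" if "q \<in> sub \<epsilon>" for q
          using le[OF that] mult_right_mono[OF t4, of "2 * \<epsilon>"] \<epsilon>(1) by linarith
        have "continuous_on (sub \<epsilon>) u" by (rule continuous_on_subset[OF u_cont subs(2)])
        moreover have "continuous_on (sub \<epsilon>) (\<lambda>q. b q y')"
        proof -
          have "continuous_on (sub \<epsilon>) (\<lambda>q. (q, y'))" by (intro continuous_intros)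
          from continuous_on_compose2[OF b_cont this] subs(2) y'(1) show ?thesis by auto
        qed
        ultimately have "continuous_on (sub \<epsilon>) (\<lambda>q. u q - b q y')" by (rule continuous_on_diff)
        from continuous_attains_inf[OF Zc _ this] q0Z
        obtain q where q: "q \<in> sub \<epsilon>" "\<And>x. x \<in> sub \<epsilon> \<Longrightarrow> u q - b q y' \<le> u x - b x y'" by blast
        have "u q \<le> \<epsilon> / 2" using q(2)[OF q0Z] q0(2) le2[OF q(1)] by linarith
        then have "u q < \<epsilon>" using \<epsilon>(1) by linarith
        from min_contact[OF ZQ(1)[OF q(1)] this y'(1)] q(2) have "y' \<in> ct q"
          unfolding sub_def by blast
        then have "y' \<in> A" using q(1) by (auto simp: A_def)
        then show "p \<in> P q0 ` A" using y'(2) by blast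
      qed
      moreover have r0: "0 \<le> 1 / (4 * ?n)" by simp
      have "continuous_on A (P q0)"
      proof -
        have "continuous_on A (\<lambda>y. (q0, y))" by (intro continuous_intros)
        from continuous_on_compose2[OF P_cont this] q0 A(2) show ?thesis by auto
      qed
      then have "compact (P q0 ` A)" using A(1) by (rule compact_continuous_image)
      moreover have "compact Pi" unfolding Pi_def by (rule compact_parallelepiped[OF r0])
      ultimately have "measure lebesgue Pi \<le> measure lebesgue (P q0 ` A)"
        by (intro measure_mono_fmeasurable fmeasurableD lmeasurable_compact)
      also have "\<dots> \<le> B0 * measure lebesgue A" by (rule B0(2)[OF A])
      also have "\<dots> \<le> B0 * (B * measure lebesgue (sub \<epsilon>))"
        unfolding A_def by (intro mult_left_mono B Zc subs B0)
      finally have up: "measure lebesgue Pi \<le> B0 * (B * measure lebesgue (sub \<epsilon>))" .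
      let ?w = "\<Prod>i\<in>UNIV - {i0}. w i"
      have w0: "w i > 0" if "i \<noteq> i0" for i using W0[of i] that by (simp add: W_def)
      then have wpos: "?w > 0" by (intro prod_pos) auto
      \<comment> \<open>The row lengths \<open>s i\<close> may be of very different size; they are
        taken out row by row, and only the relative errors have to be small.\<close>
      have "1 / 2 \<le> \<bar>det (\<chi> i. e i + (1 / s i) *\<^sub>R (k i - s i *\<^sub>R e i))\<bar>"
      proof (rule det\<eta>[OF e(1)], intro allI)
        fix i
        have "(1 / s i) * norm (k i - s i *\<^sub>R e i) \<le> (1 / s i) * (\<eta> * s i)"
          using s[of i] by (intro mult_left_mono k) auto
        then show "norm ((1 / s i) *\<^sub>R (k i - s i *\<^sub>R e i)) \<le> \<eta>" using s[of i] by simp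
      qed
      moreover have ks: "k i = s i *s (e i + (1 / s i) *\<^sub>R (k i - s i *\<^sub>R e i))" for i
        using s[of i] by (simp add: scalar_mult_eq_scaleR scaleR_add_right)
      have "det (\<chi> i. k i) = (\<Prod>i\<in>UNIV. s i) * det (\<chi> i. e i + (1 / s i) *\<^sub>R (k i - s i *\<^sub>R e i))"
        using det_rows_mul[of s "\<lambda>i. e i + (1 / s i) *\<^sub>R (k i - s i *\<^sub>R e i)"] unfolding ks[symmetric] .
      moreover have sprod: "(\<Prod>i\<in>UNIV. s i) > 0" using s by (intro prod_pos) auto
      ultimately have detk: "(\<Prod>i\<in>UNIV. s i) * (1 / 2) \<le> \<bar>det (\<chi> i. k i)\<bar>"
        by (simp add: abs_mult)
      have Wprod: "(\<Prod>i\<in>UNIV. W i) = d * ?w"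
      proof -
        have "(\<Prod>i\<in>UNIV. W i) = W i0 * (\<Prod>i\<in>UNIV - {i0}. W i)" by (rule prod.remove) auto
        moreover have "(\<Prod>i\<in>UNIV - {i0}. W i) = ?w" by (rule prod.cong) (auto simp: W_def)
        ultimately show ?thesis by (simp add: W_def)
      qed
      have "(\<Prod>i\<in>UNIV. s i) = (\<kappa> * \<epsilon>) ^ CARD('n) / (d * ?w)"
        by (simp add: s_def prod_dividef Wprod)
      then have "(1 / (4 * ?n)) ^ CARD('n) * ((\<kappa> * \<epsilon>) ^ CARD('n) / (d * ?w) * (1 / 2)) \<le> (1 / (4 * ?n)) ^ CARD('n) * \<bar>det (\<chi> i. k i)\<bar>"
        using detk by (intro mult_left_mono) auto
      also have "\<dots> = measure lebesgue Pi"
        unfolding Pi_def measure_parallelepiped[OF r0] ..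
      finally have low: "c * \<epsilon> ^ CARD('n) / (d * ?w) \<le> measure lebesgue Pi"
        by (simp add: c_def power_mult_distrib mult_ac)
      have "orthogonal_matrix (\<chi> i. e i)"
        unfolding orthogonal_matrix_orthonormal_rows
        using e(1) by (auto simp: row_def orthogonal_def norm_eq_1)
      then have det1: "\<bar>det (\<chi> i. e i)\<bar> = 1" using det_orthogonal_matrix by fastforce
      then have det0: "det (\<chi> i. e i) \<noteq> 0" by auto
      \<comment> \<open>Backwards along \<open>e1\<close> the sublevel set need not be thin, so
        there the outer box uses the bound \<open>M\<close> for all of \<open>K\<close>.\<close>
      define h where "h i = (if i = i0 then M else w i)" for i
      have h: "0 \<le> h i" for i using M(1) w0[of i] by (simp add: h_def less_imp_le)
      have "sub \<epsilon> \<subseteq> (+) q0 ` {x. \<forall>i. \<bar>e i \<bullet> x\<bar> \<le> h i}"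
      proof
        fix q assume q: "q \<in> sub \<epsilon>"
        have "\<bar>e i \<bullet> (q - q0)\<bar> \<le> h i" for i
        proof (cases "i = i0")
          case True
          have "\<bar>e i \<bullet> (q - q0)\<bar> \<le> norm (e i) * norm (q - q0)" by (rule Cauchy_Schwarz_ineq2)
          then show ?thesis using en[of i] M(2)[OF ZQ(2)[OF q]] True by (simp add: h_def)
        next
          case False
          then show ?thesis using w[OF False q] by (simp add: h_def)
        qed
        then have "q - q0 \<in> {x. \<forall>i. \<bar>e i \<bullet> x\<bar> \<le> h i}" by blast
        moreover have "q = q0 + (q - q0)" by simp
        ultimately show "q \<in> (+) q0 ` {x. \<forall>i. \<bar>e i \<bullet> x\<bar> \<le> h i}" by blast
      qed
      moreover have "compact ((+) q0 ` {x. \<forall>i. \<bar>e i \<bullet> x\<bar> \<le> h i})"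
        by (rule compact_translation[OF compact_slabs[OF det0 h]])
      ultimately have "measure lebesgue (sub \<epsilon>) \<le> measure lebesgue ((+) q0 ` {x. \<forall>i. \<bar>e i \<bullet> x\<bar> \<le> h i})"
        using Zc by (intro measure_mono_fmeasurable fmeasurableD lmeasurable_compact)
      also have "\<dots> = (\<Prod>i\<in>UNIV. 2 * h i)"
        unfolding measure_translation measure_slabs[OF det0 h] det1 by simp
      also have "\<dots> = 2 ^ CARD('n) * (\<Prod>i\<in>UNIV. h i)" by (simp add: prod.distrib)
      also have "(\<Prod>i\<in>UNIV. h i) = M * ?w"
      proof -
        have "(\<Prod>i\<in>UNIV. h i) = h i0 * (\<Prod>i\<in>UNIV - {i0}. h i)" by (rule prod.remove) auto
        moreover have "(\<Prod>i\<in>UNIV - {i0}. h i) = ?w" by (rule prod.cong) (auto simp: h_def)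
        ultimately show ?thesis by (simp add: h_def)
      qed
      finally have "B0 * (B * measure lebesgue (sub \<epsilon>)) \<le> B0 * (B * (2 ^ CARD('n) * (M * ?w)))"
        using B0(1) B(1) by (intro mult_left_mono)
      then have "c * \<epsilon> ^ CARD('n) / (d * ?w) \<le> B0 * (B * (2 ^ CARD('n) * (M * ?w)))" using low up by linarith
      then have "c * \<epsilon> ^ CARD('n) \<le> B0 * (B * (2 ^ CARD('n) * (M * ?w))) * (d * ?w)"
        using d wpos by (simp add: pos_divide_le_eq)
      also have "\<dots> = (B0 * B * 2 ^ CARD('n) * M) * (d * ?w\<^sup>2)" by (simp only: power2_eq_square mult_ac)
      also have "B0 * B * 2 ^ CARD('n) * M = C * c" using c by (simp add: C_def)
      finally have "c * \<epsilon> ^ CARD('n) \<le> c * (C * d * ?w\<^sup>2)" by (simp only: mult_ac)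
      then show ?thesis using c by simp
    qed
    then show ?thesis using e2(1) by blast
  qed
  then show ?thesis using C by blast
qed

theorem zero_set_singleton: "{q \<in> K. u q = 0} = {qt}"
proof (rule ccontr)
  let ?S = "{q \<in> K. u q = 0}" and ?n = "CARD('n)"
  assume ne: "?S \<noteq> {qt}"
  have qtK: "qt \<in> K" using qt Q(3) by blast
  obtain \<epsilon>0 where e0: "0 < \<epsilon>0" "\<And>\<epsilon>. \<epsilon> \<le> \<epsilon>0 \<Longrightarrow> compact (sub \<epsilon>)" "\<And>\<epsilon>. \<epsilon> \<le> \<epsilon>0 \<Longrightarrow> sub \<epsilon> = {q \<in> K. u q \<le> \<epsilon>}"
    using sub_compact by blast
  have S0: "?S = sub 0" using e0(3)[of 0] e0(1) u_nonneg by force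
  then have Sc: "compact ?S" using e0(2)[of 0] e0(1) by simp
  have "continuous_on ?S (\<lambda>q. norm (q - qt))" by (intro continuous_intros)
  moreover have "?S \<noteq> {}" using qtK qt(2) by blast
  ultimately obtain q0 where q0: "q0 \<in> ?S" "\<And>q. q \<in> ?S \<Longrightarrow> norm (q - qt) \<le> norm (q0 - qt)"
    using continuous_attains_sup[OF Sc] by blast
  define R where "R = norm (q0 - qt)"
  have R: "R > 0"
  proof -
    obtain q where "q \<in> ?S" "q \<noteq> qt" using ne qtK qt(2) by blast
    then show ?thesis using q0(2)[of q] unfolding R_def by (smt (verit) zero_less_norm_iff right_minus_eq)
  qed
  define e1 where "e1 = (1 / R) *\<^sub>R (q0 - qt)"
  have e1: "norm e1 = 1" using R by (simp add: e1_def R_def)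
  have q0Q: "q0 \<in> Q" "u q0 = 0" using q0(1) unfolding S0 by (auto simp: sub_def) (use q0(1) in auto)
  have e1S: "e1 \<bullet> (q - q0) \<le> 0" if "q \<in> K" "u q = 0" for q
  proof -
    have "e1 \<bullet> (q - qt) \<le> norm e1 * norm (q - qt)" by (rule norm_cauchy_schwarz)
    also have "\<dots> \<le> R" using e1 q0(2)[of q] that by (simp add: R_def)
    finally have "e1 \<bullet> (q - qt) \<le> R" .
    moreover have "e1 \<bullet> (q0 - qt) = R"
      using R by (simp add: e1_def R_def dot_square_norm power2_eq_square)
    ultimately show ?thesis by (simp add: inner_diff_right)
  qed
  \<comment> \<open>Any index may carry the prescribed direction.\<close>
  define i0 where "i0 = (undefined :: 'n)"
  obtain C1 \<epsilon>1 where C1: "0 < \<epsilon>1" "0 \<le> C1"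
    "\<And>\<epsilon> q0 z. 0 < \<epsilon> \<Longrightarrow> \<epsilon> \<le> \<epsilon>1 \<Longrightarrow> q0 \<in> sub \<epsilon> \<Longrightarrow> \<forall>i. q0 + z i \<in> sub \<epsilon> \<Longrightarrow> (det (\<chi> i. z i))\<^sup>2 \<le> C1 * \<epsilon> ^ ?n"
    using lower_estimate by blast
  obtain C2 where C2: "C2 \<ge> 0" "\<And>d. d > 0 \<Longrightarrow> \<exists>\<epsilon>2>0. \<forall>\<epsilon> e w. 0 < \<epsilon> \<longrightarrow> \<epsilon> \<le> \<epsilon>2 \<longrightarrow>
    (\<forall>i j. e i \<bullet> e j = (if i = j then 1 else 0)) \<longrightarrow> e i0 = e1 \<longrightarrow>
    (\<forall>i. i \<noteq> i0 \<longrightarrow> (\<forall>q\<in>sub \<epsilon>. \<bar>e i \<bullet> (q - q0)\<bar> \<le> w i)) \<longrightarrow>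
    \<epsilon> ^ ?n \<le> C2 * d * (\<Prod>i\<in>UNIV - {i0}. w i :: real)\<^sup>2"
    using upper_estimate[OF q0Q e1S, of i0] by blast
  obtain L \<epsilon>3 where L: "L > 0" "\<epsilon>3 > 0" "\<And>\<epsilon>. 0 < \<epsilon> \<Longrightarrow> \<epsilon> \<le> \<epsilon>3 \<Longrightarrow> cball q0 (\<epsilon> / L) \<subseteq> sub \<epsilon>"
    using sublevel_ball[OF q0Q] by blast
  \<comment> \<open>The two estimates combine to R^2 \<le> C1 C2 d, while this choice makes (C1 C2 +
    1) d equal to R^2 / 2. It is admissible because \<open>C2\<close> was fixed before
    \<open>d\<close>.\<close>
  define d where "d = R\<^sup>2 / (2 * (C1 * C2 + 1))"
  have CC: "C1 * C2 + 1 > 0" using C1(2) C2(1) by (simp add: add_nonneg_pos)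
  have d: "d > 0" using R CC by (simp add: d_def)
  obtain \<epsilon>2 where e2: "\<epsilon>2 > 0" "\<And>\<epsilon> e w. 0 < \<epsilon> \<Longrightarrow> \<epsilon> \<le> \<epsilon>2 \<Longrightarrow>
    (\<forall>i j. e i \<bullet> e j = (if i = j then 1 else 0)) \<Longrightarrow> e i0 = e1 \<Longrightarrow>
    (\<forall>i. i \<noteq> i0 \<longrightarrow> (\<forall>q\<in>sub \<epsilon>. \<bar>e i \<bullet> (q - q0)\<bar> \<le> w i)) \<Longrightarrow>
    \<epsilon> ^ ?n \<le> C2 * d * (\<Prod>i\<in>UNIV - {i0}. w i :: real)\<^sup>2"
    using C2(2)[OF d] by blast
  define \<epsilon> where "\<epsilon> = min (min \<epsilon>0 \<epsilon>1) (min \<epsilon>2 \<epsilon>3)"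
  have \<epsilon>: "0 < \<epsilon>" "\<epsilon> \<le> \<epsilon>0" "\<epsilon> \<le> \<epsilon>1" "\<epsilon> \<le> \<epsilon>2" "\<epsilon> \<le> \<epsilon>3"
    using e0 C1 e2 L by (auto simp: \<epsilon>_def)
  define Z where "Z = (\<lambda>q. q - q0) ` sub \<epsilon>"
  have memZ: "x \<in> Z \<longleftrightarrow> q0 + x \<in> sub \<epsilon>" for x by (force simp: Z_def image_iff)
  have Zc: "compact Z" unfolding Z_def
    by (rule compact_continuous_image[OF _ e0(2)[OF \<epsilon>(2)]]) (intro continuous_intros)
  have Zb: "cball 0 (\<epsilon> / L) \<subseteq> Z"
  proof
    fix x assume "x \<in> cball (0 :: real^'n) (\<epsilon> / L)"
    then have "q0 + x \<in> cball q0 (\<epsilon> / L)" by (simp add: dist_norm)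
    then show "x \<in> Z" using L(3)[OF \<epsilon>(1,5)] memZ by blast
  qed
  \<comment> \<open>Seen from \<open>q0\<close>, the point \<open>qt\<close> supplies the row of
    length \<open>R\<close> in the direction \<open>e1\<close>, so the determinant of the inner
    simplex does not degenerate in that direction.\<close>
  have "(- R) *\<^sub>R e1 = qt - q0" using R by (simp add: e1_def)
  then have eZ: "(- R) *\<^sub>R e1 \<in> Z" using qt \<epsilon>(1) by (simp add: memZ sub_def)
  obtain e z w where fr: "\<And>i j. e i \<bullet> e j = (if i = j then 1 else 0)" "e i0 = e1" "\<And>i. z i \<in> Z"
    "\<And>i x. i \<noteq> i0 \<Longrightarrow> x \<in> Z \<Longrightarrow> \<bar>e i \<bullet> x\<bar> \<le> w i" 
    "\<bar>det (\<chi> i. z i)\<bar> = \<bar>- R\<bar> * (\<Prod>i\<in>UNIV - {i0}. \<bar>w i\<bar>)"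
    using greedy_frame[OF Zc divide_pos_pos[OF \<epsilon>(1) L(1)] Zb e1 eZ, of i0] by blast
  let ?w = "\<Prod>i\<in>UNIV - {i0}. w i"
  have up: "\<epsilon> ^ ?n \<le> C2 * d * ?w\<^sup>2"
  proof (rule e2(2)[OF \<epsilon>(1,4)])
    show "\<forall>i j. e i \<bullet> e j = (if i = j then 1 else 0)" using fr(1) by blast
    show "e i0 = e1" by (rule fr(2))
    show "\<forall>i. i \<noteq> i0 \<longrightarrow> (\<forall>q\<in>sub \<epsilon>. \<bar>e i \<bullet> (q - q0)\<bar> \<le> w i)"
      using fr(4) by (auto simp: Z_def)
  qed
  have "(det (\<chi> i. z i))\<^sup>2 \<le> C1 * \<epsilon> ^ ?n"
    using C1(3)[OF \<epsilon>(1,3), of q0 z] fr(3) q0Q \<epsilon>(1) memZ by (simp add: sub_def)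
  moreover have "(det (\<chi> i. z i))\<^sup>2 = R\<^sup>2 * ?w\<^sup>2"
  proof -
    have "\<bar>det (\<chi> i. z i)\<bar>\<^sup>2 = (\<bar>R\<bar> * \<bar>?w\<bar>)\<^sup>2" unfolding fr(5) by (simp add: abs_prod)
    then show ?thesis by (simp add: power_mult_distrib)
  qed
  ultimately have lo: "R\<^sup>2 * ?w\<^sup>2 \<le> C1 * \<epsilon> ^ ?n" by simp
  have "R\<^sup>2 * \<epsilon> ^ ?n \<le> R\<^sup>2 * (C2 * d * ?w\<^sup>2)" using up by (rule mult_left_mono) simp
  also have "\<dots> = (C2 * d) * (R\<^sup>2 * ?w\<^sup>2)" by (simp only: mult_ac)
  also have "\<dots> \<le> (C2 * d) * (C1 * \<epsilon> ^ ?n)" using lo C2(1) d by (intro mult_left_mono) auto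
  finally have "R\<^sup>2 * \<epsilon> ^ ?n \<le> (C1 * C2 * d) * \<epsilon> ^ ?n" by (simp only: mult_ac)
  then have "R\<^sup>2 \<le> C1 * C2 * d" using \<epsilon>(1) by simp
  also have "\<dots> \<le> (C1 * C2 + 1) * d" using d by (simp add: algebra_simps)
  also have "\<dots> = R\<^sup>2 / 2" using CC by (simp add: d_def divide_simps)
  finally show False using R by simp
qed

end

section \<open>The cross-curvature condition\<close>

lemma deriv_deriv_eq:
  fixes f :: "real \<Rightarrow> real"
  assumes T: "open T" "t0 \<in> T" and d: "\<And>t. t \<in> T \<Longrightarrow> (f has_real_derivative f' t) (at t)"
    and d': "(f' has_real_derivative f'') (at t0)"
  shows "deriv (deriv f) t0 = f''"
proof (rule DERIV_imp_deriv)
  show "(deriv f has_real_derivative f'') (at t0)"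
    by (rule has_field_derivative_transform_within_open[OF d' T]) (simp add: DERIV_imp_deriv[OF d])
qed

lemma dd_cong_cmult:
  assumes S: "open S" "Ck_on (Suc k) S H" "z \<in> S" and eq: "\<And>z. z \<in> S \<Longrightarrow> G z = a * H z"
  shows "dd p G z = a * dd p H z"
proof -
  have df: "H differentiable (at z)" using Ck_on_differentiable[OF S(2) _ S(3)] by simp
  then have "(\<lambda>z. a * H z) differentiable (at z)" by (intro differentiable_mult) auto
  then have "dd p (\<lambda>z. a * H z) z = dd p G z"
    by (rule dd_cong[OF S(1,3)]) (simp add: eq)
  then show ?thesis using dd_cmult[OF df, of p a] by simp
qed

lemma dd_scale2:
  assumes S: "open S" "Ck_on (Suc (Suc k)) S H" "z \<in> S"
  shows "dd (a *\<^sub>R p) (dd (a *\<^sub>R p) H) z = a\<^sup>2 * dd p (dd p H) z"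
proof -
  have "dd (a *\<^sub>R p) H differentiable (at z)"
    using Ck_on_differentiable[OF Ck_on_dd[OF S(1,2)] _ S(3)] by simp
  from linear_cmul[OF linear_dd[OF this], of a p]
  have "dd (a *\<^sub>R p) (dd (a *\<^sub>R p) H) z = a * dd p (dd (a *\<^sub>R p) H) z" by simp
  also have "dd p (dd (a *\<^sub>R p) H) z = a * dd p (dd p H) z"
    using linear_cmul[OF linear_dd_inner[OF S, of p], of a p] by simp
  finally show ?thesis by (simp add: power2_eq_square)
qed

lemma gX_eq_gradx:
  assumes F: "F = (\<lambda>p. - c (fst p) (snd p))" and d: "F differentiable (at (x, y))"
  shows "gX F x y = - gradx c x y"
proof (rule vec_eq_iff[THEN iffD2], rule allI)
  fix i
  have "((\<lambda>x. (x, y)) has_derivative (\<lambda>v. (v, 0))) (at x)" by (auto intro!: derivative_eq_intros)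
  from diff_chain_at[OF this has_derivative_dd[OF d]]
  have "((\<lambda>x. - F (x, y)) has_derivative (\<lambda>v. - dd (v, 0) F (x, y))) (at x)"
    by (intro has_derivative_minus) (simp add: comp_def)
  then have "frechet_derivative (\<lambda>x. - F (x, y)) (at x) = (\<lambda>v. - dd (v, 0) F (x, y))"
    using frechet_derivative_at by metis
  moreover have "(\<lambda>x. - F (x, y)) = (\<lambda>x. c x y)" by (simp add: F)
  ultimately have "gradx c x y $ i = - (gX F x y \<bullet> axis i 1)"
    by (simp add: gradx_def gX_inner[OF d])
  then show "gX F x y $ i = (- gradx c x y) $ i" by (simp add: inner_axis)
qed

lemma gY_eq_grady:
  assumes F: "F = (\<lambda>p. - c (fst p) (snd p))" and d: "F differentiable (at (x, y))"
  shows "gY F x y = - grady c x y"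
proof (rule vec_eq_iff[THEN iffD2], rule allI)
  fix i
  have "((\<lambda>y. (x, y)) has_derivative (\<lambda>v. (0, v))) (at y)" by (auto intro!: derivative_eq_intros)
  from diff_chain_at[OF this has_derivative_dd[OF d]]
  have "((\<lambda>y. - F (x, y)) has_derivative (\<lambda>v. - dd (0, v) F (x, y))) (at y)"
    by (intro has_derivative_minus) (simp add: comp_def)
  then have "frechet_derivative (\<lambda>y. - F (x, y)) (at y) = (\<lambda>v. - dd (0, v) F (x, y))"
    using frechet_derivative_at by metis
  moreover have "(\<lambda>y. - F (x, y)) = (\<lambda>y. c x y)" by (simp add: F)
  ultimately have "grady c x y $ i = - (gY F x y \<bullet> axis i 1)"
    by (simp add: grady_def gY_inner[OF d])
  then show "gY F x y $ i = (- grady c x y) $ i" by (simp add: inner_axis)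
qed

context cost_pre
begin

text \<open>The initial velocity is prescribed through the direction of the line,
  \<open>hXY F x y v\<close>. The initial acceleration then has to be \<open>a\<close>, because
  \<open>accX\<close> determines it by injectivity of \<open>hXY\<close>.\<close>

lemma segX_velocity:
  assumes x: "x \<in> U" and y: "y \<in> closure V" and acc: "accX F x y v a"
  shows "\<exists>C c c' c''. open C \<and> 0 \<in> C \<and> c 0 = x \<and> c' 0 = v \<and> c'' 0 = a \<and>
    (\<forall>t\<in>C. c t \<in> U \<and> gY F (c t) y = gY F x y + t *\<^sub>R hXY F x y v \<and>
      (c has_vector_derivative c' t) (at t) \<and> (c' has_vector_derivative c'' t) (at t))"
proof -
  let ?p = "gY F x y" and ?q = "hXY F x y v"
  have xcl: "x \<in> closure U" using x closure_subset by blast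
  obtain c c' c'' where *: "\<And>t. ?p + t *\<^sub>R ?q \<in> (\<lambda>x. gY F x y) ` U \<Longrightarrow>
    c t \<in> U \<and> gY F (c t) y = ?p + t *\<^sub>R ?q \<and> (c has_vector_derivative c' t) (at t) \<and>
    (c' has_vector_derivative c'' t) (at t) \<and> hXY F (c t) y (c' t) = ?q \<and> accX F (c t) y (c' t) (c'' t)"
    using segX[OF y, of ?p ?q] by metis
  define C where "C = (\<lambda>t. ?p + t *\<^sub>R ?q) -` ((\<lambda>x. gY F x y) ` U)"
  have "open C" unfolding C_def by (rule open_vimage[OF open_gY_image[OF y]]) (intro continuous_intros)
  moreover have 0: "0 \<in> C" using x by (simp add: C_def)
  have in0: "?p + 0 *\<^sub>R ?q \<in> (\<lambda>x. gY F x y) ` U" using x by simp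
  note c0 = *[OF in0]
  have "c 0 \<in> closure U" using c0 closure_subset by blast
  then have "c 0 = x" using inj_onD[OF inj_gY[OF y], of "c 0" x] c0 xcl by simp
  moreover have "c' 0 = v" using hXY_inj[OF xcl y, of "c' 0" v] c0 \<open>c 0 = x\<close> by simp
  moreover have "c'' 0 = a"
  proof (rule hXY_inj[OF xcl y], rule vec_eq_inner)
    fix w
    have "accX F x y v (c'' 0)" using c0 \<open>c 0 = x\<close> \<open>c' 0 = v\<close> by simp
    then have "dd (c'' 0, 0) (dd (0, w) F) (x, y) = dd (a, 0) (dd (0, w) F) (x, y)"
      using acc unfolding accX_def by (smt (verit))
    then show "hXY F x y (c'' 0) \<bullet> w = hXY F x y a \<bullet> w"
      by (simp add: hXY_inner[OF W(1) C2 inW[OF xcl y]])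
  qed
  moreover have "c t \<in> U \<and> gY F (c t) y = ?p + t *\<^sub>R ?q \<and> (c has_vector_derivative c' t) (at t) \<and>
    (c' has_vector_derivative c'' t) (at t)" if "t \<in> C" for t
    using *[of t] that unfolding C_def vimage_def by blast
  ultimately show ?thesis using 0 by blast
qed

end

lemma has_vector_derivative_rescale:
  fixes c :: "real \<Rightarrow> 'a::real_normed_vector"
  assumes "(c has_vector_derivative d) (at (k * t))"
  shows "((\<lambda>t. c (k * t)) has_vector_derivative k *\<^sub>R d) (at t)"
proof -
  have "((\<lambda>t. k * t) has_vector_derivative k) (at t)"
    by (auto intro!: derivative_eq_intros simp: has_real_derivative_iff_has_vector_derivative[symmetric])
  from vector_diff_chain_at[OF this assms] show ?thesis by (simp add: comp_def)
qed

text \<open>(B3) wants curves on all of [-1,1], whereas c-segments with given velocities exist only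
  near time 0. Both are slowed down by a factor \<open>k\<close>, which multiplies the fourth
  derivative by k^4.\<close>

lemma cross_of_B3:
  fixes U V :: "(real^'n) set" and c :: "real^'n \<Rightarrow> real^'n \<Rightarrow> real"
  assumes pre: "cost_pre U V W F" and F: "F = (\<lambda>p. - c (fst p) (snd p))" and B3: "B3 U V c"
    and x: "x \<in> U" and y: "y \<in> V" and acc: "accX F x y v a" "accY F x y w b"
  shows "0 \<le> dd (v, 0) (dd (v, 0) (dd (0, w) (dd (0, w) F))) (x, y) + dd (a, 0) (dd (0, w) (dd (0, w) F)) (x, y)"
proof -
  interpret cost_pre U V W F by (rule pre)
  have xcl: "x \<in> closure U" and ycl: "y \<in> closure V" using x y closure_subset by blast+
  have zW: "(x, y) \<in> W" by (rule inW[OF xcl ycl])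
  have accs: "accX Fs y x w b" using acc(2) accX_Fs[OF zW] by simp
  obtain C1 f f' f'' where C1: "open C1" "0 \<in> C1" "f 0 = x" "f' 0 = v" "f'' 0 = a"
    and f: "\<forall>t\<in>C1. f t \<in> U \<and> gY F (f t) y = gY F x y + t *\<^sub>R hXY F x y v \<and>
      (f has_vector_derivative f' t) (at t) \<and> (f' has_vector_derivative f'' t) (at t)"
    using segX_velocity[OF x ycl acc(1)] by blast
  obtain C2 g g' g'' where Cg: "open C2" "0 \<in> C2" "g 0 = y" "g' 0 = w" "g'' 0 = b"
    and g: "\<forall>t\<in>C2. g t \<in> V \<and> gY Fs (g t) x = gY Fs y x + t *\<^sub>R hXY Fs y x w \<and>
      (g has_vector_derivative g' t) (at t) \<and> (g' has_vector_derivative g'' t) (at t)"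
    using cost_pre.segX_velocity[OF cost_pre_swap y xcl accs] by blast
  have "open (C1 \<inter> C2)" "0 \<in> C1 \<inter> C2" using C1 Cg by auto
  then obtain k where k: "k > 0" "cball 0 k \<subseteq> C1 \<inter> C2" unfolding open_contains_cball by blast
  have kt: "k * t \<in> C1" "k * t \<in> C2" if "\<bar>t\<bar> \<le> 1" for t
  proof -
    have "\<bar>k * t\<bar> \<le> k" using that k(1) by (simp add: abs_mult mult_left_le)
    then have "k * t \<in> cball 0 k" by (simp add: dist_real_def)
    then show "k * t \<in> C1" "k * t \<in> C2" using k(2) by auto
  qed
  define x1 where "x1 t = f (k * t)" for t
  define y1 where "y1 t = g (k * t)" for t
  have xU: "x1 t \<in> U" if "\<bar>t\<bar> \<le> 1" for t using f kt(1)[OF that] by (simp add: x1_def)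
  have yV: "y1 t \<in> V" if "\<bar>t\<bar> \<le> 1" for t using g kt(2)[OF that] by (simp add: y1_def)
  have x10: "x1 0 = x" and y10: "y1 0 = y" using C1 Cg by (simp_all add: x1_def y1_def)
  have dx: "(x1 has_vector_derivative k *\<^sub>R f' (k * t)) (at t)" if "\<bar>t\<bar> \<le> 1" for t
    unfolding x1_def[abs_def] using f kt(1)[OF that] by (intro has_vector_derivative_rescale) simp
  have dx': "((\<lambda>t. k *\<^sub>R f' (k * t)) has_vector_derivative k *\<^sub>R k *\<^sub>R f'' (k * t)) (at t)" if "\<bar>t\<bar> \<le> 1" for t
    using f kt(1)[OF that]
    by (intro bounded_linear.has_vector_derivative[OF bounded_linear_scaleR_right] has_vector_derivative_rescale) simp
  have dy: "(y1 has_vector_derivative k *\<^sub>R g' (k * t)) (at t)" if "\<bar>t\<bar> \<le> 1" for t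
    unfolding y1_def[abs_def] using g kt(2)[OF that] by (intro has_vector_derivative_rescale) simp
  have dy': "((\<lambda>t. k *\<^sub>R g' (k * t)) has_vector_derivative k *\<^sub>R k *\<^sub>R g'' (k * t)) (at t)" if "\<bar>t\<bar> \<le> 1" for t
    using g kt(2)[OF that]
    by (intro bounded_linear.has_vector_derivative[OF bounded_linear_scaleR_right] has_vector_derivative_rescale) simp
  let ?T = "ball (0::real) 1"
  have T: "open ?T" "0 \<in> ?T" "\<And>t. t \<in> ?T \<Longrightarrow> \<bar>t\<bar> \<le> 1" by (auto simp: dist_real_def)
  define b1 w1 a1 v1 where "b1 = (0 :: real^'n, k\<^sup>2 *\<^sub>R b)" and "w1 = (0 :: real^'n, k *\<^sub>R w)"
    and "a1 = (k\<^sup>2 *\<^sub>R a, 0 :: real^'n)" and "v1 = (k *\<^sub>R v, 0 :: real^'n)"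
  \<comment> \<open>The second derivative of \<open>F\<close> along the curve in \<open>y\<close> at
    time 0, as a function of the point; it is then differentiated twice along the curve in
    \<open>x\<close>.\<close>
  define G where "G z = dd b1 F z + dd w1 (dd w1 F) z" for z
  have inner: "deriv (deriv (\<lambda>t. c (x1 s) (y1 t))) 0 = - G (x1 s, y)" if s: "\<bar>s\<bar> \<le> 1" for s
  proof (rule deriv_deriv_eq[OF T(1,2)])
    have z: "(x1 s, y1 t) \<in> W" if "t \<in> ?T" for t using inW'[OF xU[OF s] yV[OF T(3)[OF that]]] .
    have dz: "((\<lambda>t. (x1 s, y1 t)) has_vector_derivative (0, k *\<^sub>R g' (k * t))) (at t)" if "t \<in> ?T" for t
      by (intro has_vector_derivative_Pair has_vector_derivative_const dy T(3) that)
    have "((\<lambda>t. - F (x1 s, y1 t)) has_real_derivative - dd (0, k *\<^sub>R g' (k * t)) F (x1 s, y1 t)) (at t)"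
      if "t \<in> ?T" for t
      by (intro DERIV_minus dd_curve diffF(1) z dz that)
    then show "((\<lambda>t. c (x1 s) (y1 t)) has_real_derivative - dd (0, k *\<^sub>R g' (k * t)) F (x1 s, y1 t)) (at t)"
      if "t \<in> ?T" for t
      using that by (simp add: F)
    have dz': "((\<lambda>t. (0 :: real^'n, k *\<^sub>R g' (k * t))) has_vector_derivative (0, k *\<^sub>R k *\<^sub>R g'' (k * 0))) (at 0)"
      by (intro has_vector_derivative_Pair has_vector_derivative_const dy' T(3) T(2))
    have "((\<lambda>t. dd (0, k *\<^sub>R g' (k * t)) F (x1 s, y1 t)) has_real_derivative G (x1 s, y)) (at 0)"
      using dd_curve2[OF W(1) C2 T(1,2) z dz dz'] Cg
      by (simp add: G_def b1_def w1_def y10 power2_eq_square)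
    then show "((\<lambda>t. - dd (0, k *\<^sub>R g' (k * t)) F (x1 s, y1 t)) has_real_derivative - G (x1 s, y)) (at 0)"
      by (rule DERIV_minus)
  qed
  have GCk: "Ck_on (Suc (Suc 0)) W G"
    unfolding G_def by (intro Ck_on_add W(1) Ck_on_dd[OF W(1) C3'] C2')
  have outer: "deriv (deriv (\<lambda>s. deriv (deriv (\<lambda>t. c (x1 s) (y1 t))) 0)) 0 = - (dd a1 G (x, y) + dd v1 (dd v1 G) (x, y))"
  proof (rule deriv_deriv_eq[OF T(1,2)])
    have z: "(x1 t, y) \<in> W" if "t \<in> ?T" for t using inW'[OF xU[OF T(3)[OF that]] y] .
    have dz: "((\<lambda>t. (x1 t, y)) has_vector_derivative (k *\<^sub>R f' (k * t), 0)) (at t)" if "t \<in> ?T" for t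
      by (intro has_vector_derivative_Pair has_vector_derivative_const dx T(3) that)
    show "((\<lambda>s. deriv (deriv (\<lambda>t. c (x1 s) (y1 t))) 0) has_real_derivative - dd (k *\<^sub>R f' (k * t), 0) G (x1 t, y)) (at t)"
      if t: "t \<in> ?T" for t
    proof (rule has_field_derivative_transform_within_open[OF _ T(1) t])
      show "((\<lambda>s. - G (x1 s, y)) has_real_derivative - dd (k *\<^sub>R f' (k * t), 0) G (x1 t, y)) (at t)"
        using Ck_on_differentiable[OF GCk _ z[OF t]] by (intro DERIV_minus dd_curve dz t) simp
      show "- G (x1 s, y) = deriv (deriv (\<lambda>t. c (x1 s) (y1 t))) 0" if "s \<in> ?T" for s
        using inner[OF T(3)[OF that]] by simp
    qed
    have dz': "((\<lambda>t. (k *\<^sub>R f' (k * t), 0 :: real^'n)) has_vector_derivative (k *\<^sub>R k *\<^sub>R f'' (k * 0), 0)) (at 0)"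
      by (intro has_vector_derivative_Pair has_vector_derivative_const dx' T(3) T(2))
    have "((\<lambda>t. dd (k *\<^sub>R f' (k * t), 0) G (x1 t, y)) has_real_derivative dd a1 G (x, y) + dd v1 (dd v1 G) (x, y)) (at 0)"
      using dd_curve2[OF W(1) GCk T(1,2) z dz dz'] C1
      by (simp add: a1_def v1_def x10 power2_eq_square)
    then show "((\<lambda>t. - dd (k *\<^sub>R f' (k * t), 0) G (x1 t, y)) has_real_derivative
        - (dd a1 G (x, y) + dd v1 (dd v1 G) (x, y))) (at 0)"
      by (rule DERIV_minus)
  qed
  have in1: "\<bar>t\<bar> \<le> 1" if "t \<in> {-1..1}" for t :: real using that by auto
  have clU: "x1 t \<in> closure U" and clV: "y1 t \<in> closure V" if "t \<in> {-1..1}" for t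
    using xU[OF in1[OF that]] yV[OF in1[OF that]] closure_subset by blast+
  have segx: "\<exists>p q. \<forall>t\<in>{-1..1}. grady c (x1 t) (y1 0) = p + t *\<^sub>R q"
  proof (rule exI[of _ "- gY F x y"], rule exI[of _ "- k *\<^sub>R hXY F x y v"], rule ballI)
    fix t :: real assume t: "t \<in> {-1..1}"
    have "grady c (x1 t) y = - gY F (x1 t) y" using gY_eq_grady[OF F diffF(1)[OF inW[OF clU[OF t] ycl]]] by simp
    also have "gY F (x1 t) y = gY F x y + (k * t) *\<^sub>R hXY F x y v" using f kt(1)[OF in1[OF t]] by (simp add: x1_def)
    finally show "grady c (x1 t) (y1 0) = - gY F x y + t *\<^sub>R (- k *\<^sub>R hXY F x y v)" by (simp add: y10)
  qed
  have segy: "\<exists>p q. \<forall>t\<in>{-1..1}. gradx c (x1 0) (y1 t) = p + t *\<^sub>R q"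
  proof (rule exI[of _ "- gX F x y"], rule exI[of _ "- k *\<^sub>R hXY Fs y x w"], rule ballI)
    fix t :: real assume t: "t \<in> {-1..1}"
    have zt: "(x, y1 t) \<in> W" by (rule inW[OF xcl clV[OF t]])
    have "gradx c x (y1 t) = - gX F x (y1 t)" using gX_eq_gradx[OF F diffF(1)[OF zt]] by simp
    also have "gX F x (y1 t) = gX F x y + (k * t) *\<^sub>R hXY Fs y x w"
      using g kt(2)[OF in1[OF t]] gY_Fs[OF zt] gY_Fs[OF zW] by (simp add: y1_def)
    finally show "gradx c (x1 0) (y1 t) = - gX F x y + t *\<^sub>R (- k *\<^sub>R hXY Fs y x w)" by (simp add: x10)
  qed
  have "- deriv (deriv (\<lambda>s. deriv (deriv (\<lambda>t. c (x1 s) (y1 t))) 0)) 0 \<ge> 0"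
    using B3[unfolded B3_def, rule_format, of x1 y1] clU clV segx segy by blast
  then have nonneg: "0 \<le> dd a1 G (x, y) + dd v1 (dd v1 G) (x, y)" unfolding outer by simp
  let ?H = "dd (0, w) (dd (0, w) F)" and ?z = "(x, y)"
  have ddG: "dd r G z = dd r (dd b1 F) z + k\<^sup>2 * dd r ?H z" if z: "z \<in> W" for r z
  proof -
    have eq: "dd w1 (dd w1 F) z = k\<^sup>2 * ?H z" if "z \<in> W" for z
      using dd_scale2[OF W(1) C2 that, of k "(0, w)"] by (simp add: w1_def)
    have "dd r (dd w1 (dd w1 F)) z = k\<^sup>2 * dd r ?H z"
      by (rule dd_cong_cmult[OF W(1) C2'' z eq])
    then show ?thesis unfolding G_def using diffF z by (subst dd_add) auto
  qed
  have dddG: "dd s (dd r G) z = dd s (dd r (dd b1 F)) z + k\<^sup>2 * dd s (dd r ?H) z" if z: "z \<in> W" for s r z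
  proof -
    have C1r: "Ck_on (Suc 0) W (dd r ?H)" by (intro Ck_on_dd[OF W(1)] C2'')
    have df: "dd r ?H differentiable at z" using z C1r Ck_on_differentiable by blast
    then have df': "(\<lambda>z. k\<^sup>2 * dd r ?H z) differentiable at z" by (intro differentiable_mult) auto
    have "dd s (dd r G) z = dd s (\<lambda>z. dd r (dd b1 F) z + k\<^sup>2 * dd r ?H z) z"
      by (rule dd_cong[OF W(1) z]) (use Ck_on_differentiable[OF Ck_on_dd[OF W(1) GCk] _ z] ddG in auto)
    then show ?thesis using dd_add[OF diffF(3)[OF z] df', of s r b1] dd_cmult[OF df, of s "k\<^sup>2"] by simp
  qed
  have l: "linear (\<lambda>v. dd v G' ?z)" if "G' differentiable (at ?z)" for G' by (rule linear_dd[OF that])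
  have dH: "?H differentiable (at ?z)" using Ck_on_differentiable[OF C2'' _ zW] by simp
  have a1: "a1 = k\<^sup>2 *\<^sub>R (a, 0)" and v1: "v1 = k *\<^sub>R (v, 0)" by (simp_all add: a1_def v1_def)
  have 1: "dd a1 ?H ?z = k\<^sup>2 * dd (a, 0) ?H ?z" 
    using linear_cmul[OF l[OF dH], of "k\<^sup>2" "(a, 0)"] unfolding a1 real_scaleR_def .
  have 2: "dd v1 (dd v1 ?H) ?z = k\<^sup>2 * dd (v, 0) (dd (v, 0) ?H) ?z"
    unfolding v1 by (rule dd_scale2[OF W(1) C2'' zW])
  have "dd a1 (dd b1 F) ?z = k\<^sup>2 * dd (a, 0) (dd b1 F) ?z"
    using linear_cmul[OF l[OF diffF(2)[OF zW]], of "k\<^sup>2" "(a, 0)"] unfolding a1 real_scaleR_def .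
  moreover have "dd v1 (dd v1 (dd b1 F)) ?z = k\<^sup>2 * dd (v, 0) (dd (v, 0) (dd b1 F)) ?z"
    unfolding v1 by (rule dd_scale2[OF W(1) C3' zW])
  moreover have "dd (v, 0) (dd (v, 0) (dd b1 F)) ?z + dd (a, 0) (dd b1 F) ?z = 0"
    using acc(1) unfolding accX_def b1_def by blast
  \<comment> \<open>The terms with the acceleration \<open>b\<close> drop out because
    \<open>a\<close> satisfies \<open>accX\<close>.\<close>
  ultimately have 3: "dd a1 (dd b1 F) ?z + dd v1 (dd v1 (dd b1 F)) ?z = 0"
    by (simp add: distrib_left[symmetric] add.commute)
  have "0 \<le> k\<^sup>2 * (dd a1 ?H ?z + dd v1 (dd v1 ?H) ?z)"
    using nonneg 3 unfolding ddG[OF zW] dddG[OF zW] by (simp add: algebra_simps)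
  then have "0 \<le> k\<^sup>2 * (k\<^sup>2 * (dd (a, 0) ?H ?z + dd (v, 0) (dd (v, 0) ?H) ?z))"
    unfolding 1 2 by (simp add: algebra_simps)
  then show ?thesis using k(1) by (simp add: zero_le_mult_iff add.commute)
qed

text \<open>The adjoint of a linear map (see \<open>adj_sum_inner\<close>), written as a sum so that
  it is linear in \<open>p\<close> for every function \<open>L\<close>.\<close>

definition adj_sum :: "('a::euclidean_space \<Rightarrow> 'a) \<Rightarrow> 'a \<Rightarrow> 'a"
  where "adj_sum L p = (\<Sum>e\<in>Basis. (p \<bullet> L e) *\<^sub>R e)"

lemma adj_sum_inner: "linear L \<Longrightarrow> adj_sum L p \<bullet> v = p \<bullet> L v"
  unfolding adj_sum_def
  by (rule inner_Basis_sum[of "\<lambda>e. p \<bullet> L e"]) (auto intro!: linearI simp: linear_add linear_cmul inner_add_right)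

lemma linear_adj_sum: "linear (adj_sum L)"
  by (auto intro!: linearI simp: adj_sum_def inner_add_left scaleR_add_left sum.distrib scaleR_sum_right)

section \<open>Closures of images and compact families of linear maps\<close>

lemma closure_image_compact:
  fixes f :: "'a::euclidean_space \<Rightarrow> 'b::euclidean_space"
  assumes "bounded S" "continuous_on (closure S) f"
  shows "f ` closure S = closure (f ` S)"
proof
  show "f ` closure S \<subseteq> closure (f ` S)"
    by (rule image_closure_subset[OF assms(2) closed_closure closure_subset])
  have "compact (f ` closure S)" using assms by (intro compact_continuous_image) auto
  then show "closure (f ` S) \<subseteq> f ` closure S"
    by (intro closure_minimal image_mono closure_subset compact_imp_closed)
qed

lemma linear_inverse_right:
  fixes A B :: "'a::euclidean_space \<Rightarrow> 'a"
  assumes "linear A" "\<And>v. B (A v) = v"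
  shows "A (B v) = v"
proof -
  have "inj A" using assms(2) by (metis injI)
  then have "surj A" using assms(1) by (simp add: linear_injective_imp_surjective)
  then obtain w where "v = A w" by (metis surjD)
  then show ?thesis using assms(2) by simp
qed

lemma continuous_linear_family:
  fixes T :: "'a::topological_space \<Rightarrow> 'b::euclidean_space \<Rightarrow> 'c::real_normed_vector"
  assumes T: "\<And>x. x \<in> S \<Longrightarrow> linear (T x)" "\<And>v. continuous_on S (\<lambda>x. T x v)" and h: "continuous_on S h"
  shows "continuous_on S (\<lambda>x. T x (h x))"
proof -
  have "continuous_on S (\<lambda>x. \<Sum>b\<in>Basis. (h x \<bullet> b) *\<^sub>R T x b)" by (intro continuous_intros T(2) h)
  moreover have "(\<Sum>b\<in>Basis. (h x \<bullet> b) *\<^sub>R T x b) = T x (h x)" if "x \<in> S" for x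
  proof -
    have "T x (h x) = T x (\<Sum>b\<in>Basis. (h x \<bullet> b) *\<^sub>R b)" by (simp add: euclidean_representation)
    then show ?thesis by (simp add: linear_sum[OF T(1)[OF that]] linear_cmul[OF T(1)[OF that]])
  qed
  ultimately show ?thesis by (rule continuous_on_eq)
qed

text \<open>The minimum over the product of \<open>S\<close> with the unit sphere is positive, and
  homogeneity extends the bound to all vectors.\<close>

lemma unit_sphere_lower_bound:
  fixes T :: "'a::euclidean_space \<Rightarrow> 'b::euclidean_space \<Rightarrow> 'c::real_normed_vector"
  assumes S: "compact S" and T: "\<And>x. x \<in> S \<Longrightarrow> linear (T x)" "\<And>v. continuous_on S (\<lambda>x. T x v)"
    and nz: "\<And>x v. x \<in> S \<Longrightarrow> T x v = 0 \<Longrightarrow> v = 0"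
  shows "\<exists>c>0. \<forall>x\<in>S. \<forall>v. c * norm v \<le> norm (T x v)"
proof (cases "S = {}")
  case True
  then show ?thesis by (intro exI[of _ 1]) simp
next
  case False
  let ?X = "S \<times> sphere (0 :: 'b) 1"
  have ne: "?X \<noteq> {}" using False by simp
  have c1: "continuous_on ?X (\<lambda>z. T (fst z) v)" for v
    by (rule continuous_on_compose2[OF T(2) continuous_on_fst[OF continuous_on_id]]) auto
  have lin: "linear (T (fst z))" if "z \<in> ?X" for z using T(1) that by auto
  have "continuous_on ?X (\<lambda>z. T (fst z) (snd z))"
    using continuous_linear_family[of ?X "\<lambda>z. T (fst z)" snd, OF lin c1 continuous_on_snd[OF continuous_on_id]] .
  then have cont: "continuous_on ?X (\<lambda>z. norm (T (fst z) (snd z)))" by (rule continuous_on_norm)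
  have "compact ?X" using S by (intro compact_Times) auto
  from continuous_attains_inf[OF this ne cont]
  obtain x0 v0 where m: "x0 \<in> S" "norm v0 = 1" "\<And>x v. x \<in> S \<Longrightarrow> norm v = 1 \<Longrightarrow> norm (T x0 v0) \<le> norm (T x v)"
    by auto
  have "T x0 v0 \<noteq> 0" using nz[OF m(1), of v0] m(2) by auto
  moreover have "norm (T x0 v0) * norm v \<le> norm (T x v)" if x: "x \<in> S" for x v
  proof (cases "v = 0")
    case False
    have "norm (T x0 v0) \<le> norm (T x ((1 / norm v) *\<^sub>R v))" using m(3)[OF x] False by simp
    also have "\<dots> = norm (T x v) / norm v" using linear_cmul[OF T(1)[OF x]] by simp
    finally show ?thesis using False by (simp add: pos_le_divide_eq)
  qed simp
  ultimately show ?thesis by (intro exI[of _ "norm (T x0 v0)"]) auto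
qed

lemma linear_family_bound:
  fixes T :: "'a::topological_space \<Rightarrow> 'b::euclidean_space \<Rightarrow> 'c::real_normed_vector"
  assumes S: "compact S" and T: "\<And>x. x \<in> S \<Longrightarrow> linear (T x)" "\<And>v. continuous_on S (\<lambda>x. T x v)"
  shows "\<exists>B>0. \<forall>x\<in>S. \<forall>v. norm (T x v) \<le> B * norm v"
proof -
  have "\<exists>B. \<forall>x\<in>S. norm (T x b) \<le> B" for b
    using compact_imp_bounded[OF compact_continuous_image[OF T(2)[of b] S]] by (auto simp: bounded_iff)
  then obtain B where B: "\<And>b x. x \<in> S \<Longrightarrow> norm (T x b) \<le> B b" by metis
  have "norm (T x v) \<le> (1 + (\<Sum>b\<in>Basis. \<bar>B b\<bar>)) * norm v" if x: "x \<in> S" for x v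
  proof -
    have "T x v = T x (\<Sum>b\<in>Basis. (v \<bullet> b) *\<^sub>R b)" by (simp add: euclidean_representation)
    also have "\<dots> = (\<Sum>b\<in>Basis. (v \<bullet> b) *\<^sub>R T x b)" by (simp add: linear_sum[OF T(1)[OF x]] linear_cmul[OF T(1)[OF x]])
    finally have "norm (T x v) \<le> (\<Sum>b\<in>Basis. norm ((v \<bullet> b) *\<^sub>R T x b))" by (metis norm_sum)
    also have "\<dots> \<le> (\<Sum>b\<in>Basis. norm v * \<bar>B b\<bar>)"
    proof (rule sum_mono)
      fix b :: 'b assume b: "b \<in> Basis"
      have "norm (T x b) \<le> \<bar>B b\<bar>" using B[OF x, of b] by linarith
      then show "norm ((v \<bullet> b) *\<^sub>R T x b) \<le> norm v * \<bar>B b\<bar>"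
        using Basis_le_norm[OF b, of v] by (simp add: mult_mono)
    qed
    also have "\<dots> \<le> (1 + (\<Sum>b\<in>Basis. \<bar>B b\<bar>)) * norm v"
      by (simp add: algebra_simps sum_distrib_left)
    finally show ?thesis .
  qed
  moreover have "1 + (\<Sum>b\<in>Basis. \<bar>B b\<bar>) > 0" by (simp add: add_pos_nonneg sum_nonneg)
  ultimately show ?thesis by blast
qed

context cost_pre
begin

text \<open>The adjoint of the mixed Hessian \<open>hXY F x y\<close> (see \<open>hYX_hXY\<close>),
  and the derivative of \<open>gX F x y\<close> in \<open>y\<close>. Defining it through the swapped
  cost lets results on \<open>hXY\<close> carry over.\<close>

definition hYX :: "'a \<Rightarrow> 'a \<Rightarrow> 'a \<Rightarrow> 'a" where "hYX x y = hXY Fs y x"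

lemma gX_has_derivative: "(x, y) \<in> W \<Longrightarrow> ((\<lambda>y. gX F x y) has_derivative hYX x y) (at y)"
proof -
  assume z: "(x, y) \<in> W"
  have "(y, x) \<in> prod.swap ` W" using z by force
  from gY_has_derivative[OF open_swap_image[OF W(1)] Ck_on_swap[OF W(1) C2] this]
  have d: "((\<lambda>y. gY Fs y x) has_derivative hYX x y) (at y)" by (simp add: hYX_def)
  have "open ((\<lambda>y. (x, y)) -` W)" by (rule open_vimage[OF W(1)]) (intro continuous_intros)
  from has_derivative_transform_within_open[OF d this, of "\<lambda>y. gX F x y"] z show ?thesis
    using gY_Fs by simp
qed

lemma hYX_inner: "(x, y) \<in> W \<Longrightarrow> hYX x y w \<bullet> v = dd (0, w) (dd (v, 0) F) (x, y)"
proof -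
  assume z: "(x, y) \<in> W"
  then have "(y, x) \<in> prod.swap ` W" by force
  from hXY_inner[OF open_swap_image[OF W(1)] Ck_on_swap[OF W(1) C2] this, of w v]
  show ?thesis using dd_Fs(2)[OF z] by (simp add: hYX_def)
qed

lemma hYX_hXY: "(x, y) \<in> W \<Longrightarrow> hYX x y w \<bullet> v = w \<bullet> hXY F x y v"
  using hYX_inner[of x y w v] hXY_inner[OF W(1) C2, of x y v w] dd_commute[OF W(1) C2, of "(x, y)"]
  by (simp add: inner_commute)

lemma linear_hYX: "(x, y) \<in> W \<Longrightarrow> linear (hYX x y)"
  using gX_has_derivative has_derivative_linear by blast

lemma hYX_cont: "continuous_on W (\<lambda>z. hYX (fst z) (snd z) w)"
proof -
  have "hYX (fst z) (snd z) w = (\<Sum>e\<in>Basis. dd (0, w) (dd (e, 0) F) z *\<^sub>R e)" if "z \<in> W" for z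
  proof (rule vec_eq_inner)
    fix v
    have z: "(fst z, snd z) \<in> W" using that by simp
    have lin: "linear (\<lambda>v. dd (0, w) (dd (v, 0) F) z)"
      using linear_compose[OF linear_Pair_right linear_dd_inner[OF W(1) C2 that]] by (simp add: comp_def)
    show "hYX (fst z) (snd z) w \<bullet> v = (\<Sum>e\<in>Basis. dd (0, w) (dd (e, 0) F) z *\<^sub>R e) \<bullet> v"
      using hYX_inner[OF z, of w v] inner_Basis_sum[OF lin, of v] by simp
  qed
  moreover have "continuous_on W (\<lambda>z. \<Sum>e\<in>Basis. dd (0, w) (dd (e, 0) F) z *\<^sub>R e)"
    by (intro continuous_intros Ck_on_continuous[OF C2''])
  ultimately show ?thesis by (auto elim: continuous_on_eq)
qed

lemma hXY_cont: "continuous_on W (\<lambda>z. hXY F (fst z) (snd z) v)"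
  unfolding hXY_def using Ck_on_continuous[OF C2''] by (auto intro!: continuous_intros)

lemma hYX_inj: "x \<in> closure U \<Longrightarrow> y \<in> closure V \<Longrightarrow> hYX x y w = 0 \<Longrightarrow> w = 0"
  using cost_pre.hXY_inj[OF cost_pre_swap, of y x w 0] linear_0[OF linear_hYX[OF inW]]
  by (simp add: hYX_def)

lemma invY_deriv:
  assumes x: "x \<in> closure U"
  shows "\<exists>k k'. (\<forall>y\<in>closure V. k (gX F x y) = y) \<and>
    (\<forall>y\<in>closure V. (k has_derivative k' (gX F x y)) (at (gX F x y))) \<and>
    (\<forall>y\<in>closure V. \<forall>v. hYX x y (k' (gX F x y) v) = v) \<and>
    (\<forall>v. continuous_on (gX F x ` closure V) (\<lambda>q. k' q v))"
proof -
  obtain k k' where k: "\<And>y. y \<in> closure V \<Longrightarrow> k (gY Fs y x) = y"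
    "\<And>y. y \<in> closure V \<Longrightarrow> (k has_derivative k' (gY Fs y x)) (at (gY Fs y x))"
    "\<And>y v. y \<in> closure V \<Longrightarrow> k' (gY Fs y x) (hXY Fs y x v) = v"
    "\<And>v. continuous_on ((\<lambda>y. gY Fs y x) ` closure V) (\<lambda>q. k' q v)"
    by (rule cost_pre.invX_deriv[OF cost_pre_swap x]) blast
  have eq: "gY Fs y x = gX F x y" if "y \<in> closure V" for y using gY_Fs[OF inW[OF x that]] .
  have "(\<lambda>y. gY Fs y x) ` closure V = gX F x ` closure V" using eq by (intro image_cong) auto
  moreover have "hYX x y (k' (gX F x y) v) = v" if "y \<in> closure V" for y v
    by (rule linear_inverse_right[OF linear_hYX[OF inW[OF x that]]])
       (use k(3)[OF that] eq[OF that] in \<open>simp add: hYX_def\<close>)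
  ultimately show ?thesis using k(1,2,4) eq by (intro exI[of _ k] exI[of _ k']) simp
qed

lemma convex_gX_image_closure:
  assumes x: "x \<in> closure U" shows "convex (gX F x ` closure V)"
  unfolding closure_image_compact[OF V(2) gX_cont_y[OF x]] by (intro convex_closure convY x)

end

section \<open>Cost-exponential coordinates\<close>

text \<open>An instance of \<open>contact_geometry\<close> in the coordinate \<phi>, with base point
  \<open>yt\<close> and with F(.,yt) subtracted both from the cost and from \<open>u\<close>. The
  inverse chart \<open>g\<close> is C^1 with bounded derivative, and so is \<phi>, so the measure
  bounds survive with other constants.\<close>

lemma contacts_singleton:
  fixes U V :: "(real^'n) set" and F :: "(real^'n) \<times> (real^'n) \<Rightarrow> real"
  assumes cost: "cost U V W F"
    and xt: "xt \<in> U" and u_cont: "continuous_on (closure U) u"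
    and yt: "yt \<in> contacts (closure U) (closure V) (\<lambda>x y. F (x, y)) u xt"
    and ne: "\<And>x. x \<in> U \<Longrightarrow> contacts (closure U) (closure V) (\<lambda>x y. F (x, y)) u x \<noteq> {}"
    and upper: "0 \<le> \<Lambda>" "\<And>X. compact X \<Longrightarrow> X \<subseteq> U \<Longrightarrow>
      measure lebesgue (\<Union>x\<in>X. contacts (closure U) (closure V) (\<lambda>x y. F (x, y)) u x) \<le> \<Lambda> * measure lebesgue X"
    and lower: "0 < l" "0 < \<delta>" "\<And>X. compact X \<Longrightarrow> X \<subseteq> ball xt \<delta> \<Longrightarrow>
      l * measure lebesgue X \<le> measure lebesgue (\<Union>x\<in>X. contacts (closure U) (closure V) (\<lambda>x y. F (x, y)) u x)"
    and inner: "\<And>x. x \<in> closure U - U \<Longrightarrow> u x - F (x, yt) \<noteq> u xt - F (xt, yt)"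
  shows "{x \<in> closure U. u x - F (x, yt) = u xt - F (xt, yt)} = {xt}"
proof -
  interpret cost U V W F by (rule cost)
  let ?C = "closure U" and ?Y = "closure V"
  let ?con = "contacts ?C ?Y (\<lambda>x y. F (x, y)) u"
  have ytY: "yt \<in> ?Y" and yt_le: "\<And>x. x \<in> ?C \<Longrightarrow> u xt + F (x, yt) - F (xt, yt) \<le> u x"
    using yt by (auto simp: contacts_def)
  have UC: "x \<in> ?C" if "x \<in> U" for x using that closure_subset by blast
  have Cc: "compact ?C" and Yc: "compact ?Y" using U V by auto
  define \<phi> where "\<phi> x = gY F x yt" for x
  obtain g g' where g: "\<And>x. x \<in> ?C \<Longrightarrow> g (\<phi> x) = x"
    and dg0: "\<And>x. x \<in> ?C \<Longrightarrow> (g has_derivative g' (\<phi> x)) (at (\<phi> x))"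
    and inv0: "\<And>x v. x \<in> ?C \<Longrightarrow> g' (\<phi> x) (hXY F x yt v) = v"
    and gcont0: "\<And>v. continuous_on (\<phi> ` ?C) (\<lambda>q. g' q v)"
    unfolding \<phi>_def by (rule invX_deriv[OF ytY]) blast
  define Q where "Q = \<phi> ` U"
  define K where "K = \<phi> ` ?C"
  have QK: "Q \<subseteq> K" using UC by (auto simp: Q_def K_def)
  have gK: "g q \<in> ?C" "\<phi> (g q) = q" if "q \<in> K" for q using that g by (auto simp: K_def)
  have gQ: "g q \<in> U" if "q \<in> Q" for q using that g[OF UC] by (auto simp: Q_def)
  have dg: "(g has_derivative g' q) (at q)" if "q \<in> K" for q using dg0[OF gK(1)[OF that]] gK(2)[OF that] by simp
  have ling: "linear (g' q)" if "q \<in> K" for q using has_derivative_linear[OF dg[OF that]] .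
  have zW: "(g q, y) \<in> W" if "q \<in> K" "y \<in> ?Y" for q y by (rule inW[OF gK(1)[OF that(1)] that(2)])
  have inv: "g' q (hXY F (g q) yt v) = v" if "q \<in> K" for q v
    using inv0[OF gK(1)[OF that], of v] gK(2)[OF that] by simp
  have inv': "hXY F (g q) yt (g' q v) = v" if q: "q \<in> K" for q v
    by (rule linear_inverse_right[OF linear_hXY[OF W(1) C2 zW[OF q ytY]] inv[OF q]])
  have gcont: "continuous_on K g"
    using dg by (meson continuous_at_imp_continuous_on has_derivative_continuous)
  have g'cont: "continuous_on K (\<lambda>q. g' q v)" for v using gcont0 by (simp add: K_def)
  have \<phi>cont: "continuous_on ?C \<phi>" using gY_cont_x[OF ytY] by (simp add: \<phi>_def[abs_def])
  have Kc: "compact K" unfolding K_def by (rule compact_continuous_image[OF \<phi>cont Cc])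
  define b where "b q y = F (g q, y) - F (g q, yt)" for q y
  define P where "P q y = adj_sum (g' q) (gX F (g q) y - gX F (g q) yt)" for q y
  define T where "T q y w = adj_sum (g' q) (hYX (g q) y w)" for q y w
  have P_inner: "P q y \<bullet> v = (gX F (g q) y - gX F (g q) yt) \<bullet> g' q v" if "q \<in> K" for q y v
    unfolding P_def by (rule adj_sum_inner[OF ling[OF that]])
  have T_inner: "T q y w \<bullet> v = hYX (g q) y w \<bullet> g' q v" if "q \<in> K" for q y v w
    unfolding T_def by (rule adj_sum_inner[OF ling[OF that]])
  have linT: "linear (T q y)" if "(g q, y) \<in> W" for q y
    using linear_compose[OF linear_hYX[OF that] linear_adj_sum[of "g' q"]] by (simp add: T_def[abs_def] comp_def)
  have dP: "(P q has_derivative T q y) (at y)" if "(g q, y) \<in> W" for q y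
  proof -
    have "((\<lambda>y. gX F (g q) y - gX F (g q) yt) has_derivative (\<lambda>w. hYX (g q) y w - 0)) (at y)"
      by (intro has_derivative_diff gX_has_derivative[OF that] has_derivative_const)
    from bounded_linear.has_derivative[OF linear_adj_sum[of "g' q", unfolded linear_conv_bounded_linear] this]
    show ?thesis by (simp add: P_def[abs_def] T_def[abs_def])
  qed
  \<comment> \<open>At \<open>yt\<close> the derivative of \<open>P q\<close> is the adjoint of
    \<open>g' q\<close> after the adjoint of \<open>hXY\<close>, and these two linear maps are
    mutually inverse. Hence all \<open>P q\<close> are tangent to the identity at the same
    point.\<close>
  have T_id: "T q yt w = w" if q: "q \<in> K" for q w
    by (rule vec_eq_inner) (simp add: T_inner[OF q] hYX_hXY[OF zW[OF q ytY]] inv'[OF q])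
  have T_inj: "w = 0" if q: "q \<in> K" "y \<in> ?Y" and 0: "T q y w = 0" for q y w
  proof -
    have "hYX (g q) y w = 0"
    proof (rule vec_eq_inner)
      fix v
      have "hYX (g q) y w \<bullet> v = T q y w \<bullet> hXY F (g q) yt v" by (simp add: T_inner[OF q(1)] inv[OF q(1)])
      then show "hYX (g q) y w \<bullet> v = 0 \<bullet> v" by (simp add: 0)
    qed
    then show ?thesis by (rule hYX_inj[OF gK(1)[OF q(1)] q(2)])
  qed
  have Tcont: "continuous_on S (\<lambda>z. T (fst z) (snd z) w)"
    if S: "\<And>z. z \<in> S \<Longrightarrow> fst z \<in> K" "\<And>z. z \<in> S \<Longrightarrow> (g (fst z), snd z) \<in> W" for S w
  proof -
    have cf: "continuous_on S fst" and cs: "continuous_on S snd" by (intro continuous_intros)+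
    have c: "continuous_on S (\<lambda>z. (g (fst z), snd z))"
      by (rule continuous_on_Pair[OF continuous_on_compose2[OF gcont cf] cs]) (use S in auto)
    have "(\<lambda>z. (g (fst z), snd z)) ` S \<subseteq> W" by (rule image_subsetI) (rule S(2))
    from continuous_on_compose2[OF hYX_cont c this]
    have h: "continuous_on S (\<lambda>z. hYX (g (fst z)) (snd z) w)" by (simp only: fst_conv snd_conv)
    have "continuous_on S (\<lambda>z. g' (fst z) e)" for e
      by (rule continuous_on_compose2[OF g'cont cf]) (use S in auto)
    with h show ?thesis unfolding T_def adj_sum_def by (intro continuous_intros) auto
  qed
  have comp_g: "continuous_on (K \<times> ?Y) (\<lambda>z. G (g (fst z), snd z))"
    "continuous_on (K \<times> ?Y) (\<lambda>z. G (g (fst z), yt))"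
    if G: "continuous_on W G" for G :: "_ \<Rightarrow> 'z::topological_space"
  proof -
    let ?S = "K \<times> ?Y"
    have cf: "continuous_on ?S fst" and cs: "continuous_on ?S snd" by (intro continuous_intros)+
    have cg: "continuous_on ?S (\<lambda>z. g (fst z))" by (rule continuous_on_compose2[OF gcont cf]) auto
    show "continuous_on ?S (\<lambda>z. G (g (fst z), snd z))"
      by (rule continuous_on_compose2[OF G continuous_on_Pair[OF cg cs]]) (use zW in auto)
    show "continuous_on ?S (\<lambda>z. G (g (fst z), yt))"
      by (rule continuous_on_compose2[OF G continuous_on_Pair[OF cg continuous_on_const]]) (use zW ytY in auto)
  qed
  have Pcont: "continuous_on (K \<times> ?Y) (\<lambda>z. P (fst z) (snd z))"
  proof -
    have "continuous_on (K \<times> ?Y) (\<lambda>z. g' (fst z) e)" for e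
      by (rule continuous_on_compose2[OF g'cont continuous_on_fst[OF continuous_on_id]]) auto
    moreover have "continuous_on (K \<times> ?Y) (\<lambda>z. gX F (g (fst z)) (snd z))" "continuous_on (K \<times> ?Y) (\<lambda>z. gX F (g (fst z)) yt)"
      using comp_g[OF gX_cont] by simp_all
    ultimately show ?thesis unfolding P_def adj_sum_def by (intro continuous_intros)
  qed
  have P0: "P q yt = 0" for q by (simp add: P_def adj_sum_def)
  define \<kappa> where "\<kappa> = u xt - F (xt, yt)"
  define h where "h x = u x - F (x, yt) - \<kappa>" for x
  define v where "v q = h (g q)" for q
  have hcont: "continuous_on ?C h"
    unfolding h_def using continuous_on_slice_x[OF ytY Ck_on_continuous[OF C4]] u_cont by (intro continuous_intros)
  have h0: "0 \<le> h x" if "x \<in> ?C" for x using yt_le[OF that] by (simp add: h_def \<kappa>_def)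
  have hxt: "h xt = 0" by (simp add: h_def \<kappa>_def)
  have con: "contacts K ?Y b v q = ?con (g q)" if q: "q \<in> K" for q
  proof -
    have "(\<forall>q'\<in>K. v q + b q' y - b q y \<le> v q') \<longleftrightarrow> (\<forall>x'\<in>?C. v q + b (\<phi> x') y - b q y \<le> v (\<phi> x'))" for y
      unfolding K_def by blast
    moreover have "v q + b (\<phi> x') y - b q y \<le> v (\<phi> x') \<longleftrightarrow> u (g q) + F (x', y) - F (g q, y) \<le> u x'" if "x' \<in> ?C" for x' y
      using g[OF that] by (auto simp: v_def h_def b_def)
    ultimately show ?thesis unfolding contacts_def by auto
  qed
  have conU: "(\<Union>q\<in>Z. contacts K ?Y b v q) = (\<Union>x\<in>g ` Z. ?con x)" if "Z \<subseteq> Q" for Z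
    using con that QK by auto
  obtain Bg where Bg: "Bg > 0" "\<forall>q\<in>K. \<forall>v. norm (g' q v) \<le> Bg * norm v"
    using linear_family_bound[OF Kc ling g'cont] by blast
  have lin\<phi>: "linear (hXY F x yt)" if "x \<in> ?C" for x by (rule linear_hXY[OF W(1) C2 inW[OF that ytY]])
  have cont\<phi>': "continuous_on ?C (\<lambda>x. hXY F x yt v)" for v
    using continuous_on_slice_x[OF ytY hXY_cont] by simp
  obtain B\<phi> where B\<phi>: "B\<phi> > 0" "\<forall>x\<in>?C. \<forall>v. norm (hXY F x yt v) \<le> B\<phi> * norm v"
    using linear_family_bound[OF Cc lin\<phi> cont\<phi>'] by blast
  have geo: "contact_geometry Q K ?Y b P yt v (\<phi> xt)"
  proof
    show "open Q" using open_gY_image[OF ytY] by (simp add: Q_def \<phi>_def)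
    show "convex Q" using convX[OF ytY] by (simp add: Q_def \<phi>_def)
    show "Q \<subseteq> K" "compact K" "compact ?Y" "yt \<in> ?Y" by (rule QK Kc Yc ytY)+
    show "continuous_on (K \<times> ?Y) (\<lambda>z. b (fst z) (snd z))"
      unfolding b_def by (rule continuous_on_diff[OF comp_g[OF Ck_on_continuous[OF C4]]])
    show "convex_on Q (\<lambda>q. b q y)" if y: "y \<in> ?Y" for y
    proof (rule convex_onI)
      fix t :: real and p q assume t: "0 < t" "t < 1" and pq: "p \<in> Q" "q \<in> Q"
      let ?r = "(1 - t) *\<^sub>R p + t *\<^sub>R q"
      have rQ: "?r \<in> Q" using convexD[OF \<open>convex Q\<close> pq, of "1 - t" t] t by simp
      have K': "p \<in> K" "q \<in> K" "?r \<in> K" using pq rQ QK by auto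
      have "gY F (g ?r) yt = (1 - t) *\<^sub>R gY F (g p) yt + t *\<^sub>R gY F (g q) yt"
        using gK(2)[OF K'(1)] gK(2)[OF K'(2)] gK(2)[OF K'(3)] by (simp add: \<phi>_def)
      from primal_convex[OF gK(1)[OF K'(1)] gK(1)[OF K'(2)] gK(1)[OF K'(3)] ytY y _ _ this] t
      show "b ?r y \<le> (1 - t) * b p y + t * b q y" by (simp add: b_def)
    qed (rule \<open>convex Q\<close>)
    show "((\<lambda>q. b q y) has_derivative (\<lambda>v. P q y \<bullet> v)) (at q)" if q: "q \<in> Q" and y: "y \<in> ?Y" for q y
    proof -
      have qK: "q \<in> K" using q QK by blast
      have d: "((\<lambda>q. F (g q, y)) has_derivative (\<lambda>v. gX F (g q) y \<bullet> g' q v)) (at q)" if y: "y \<in> ?Y" for y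
      proof -
        have "((\<lambda>q. (g q, y)) has_derivative (\<lambda>v. (g' q v, 0))) (at q)"
          by (intro has_derivative_Pair dg[OF qK] has_derivative_const)
        from diff_chain_at[OF this has_derivative_dd[OF diffF(1)[OF zW[OF qK y]]]]
        show ?thesis by (simp add: comp_def gX_inner[OF diffF(1)[OF zW[OF qK y]]])
      qed
      show ?thesis unfolding b_def
        using has_derivative_diff[OF d[OF y] d[OF ytY]] by (simp add: P_inner[OF qK] inner_diff_left)
    qed
    show "continuous_on (Q \<times> ?Y) (\<lambda>z. P (fst z) (snd z))"
      by (rule continuous_on_subset[OF Pcont]) (use QK in auto)
    show "inj_on (P q) ?Y" if q: "q \<in> Q" for q
    proof (rule inj_onI)
      fix y y' assume y: "y \<in> ?Y" "y' \<in> ?Y" and eq: "P q y = P q y'"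
      have qK: "q \<in> K" using q QK by blast
      have "gX F (g q) y = gX F (g q) y'"
      proof (rule vec_eq_inner)
        fix w
        have "P q y \<bullet> hXY F (g q) yt w = P q y' \<bullet> hXY F (g q) yt w" using eq by simp
        then show "gX F (g q) y \<bullet> w = gX F (g q) y' \<bullet> w"
          unfolding P_inner[OF qK] inv[OF qK] by (simp add: inner_diff_left)
      qed
      then show "y = y'" by (rule inj_onD[OF inj_gX[OF gK(1)[OF qK]] _ y])
    qed
    show "\<exists>y''\<in>?Y. P q y'' = (1 - t) *\<^sub>R P q y + t *\<^sub>R P q y' \<and>
        (\<forall>q'\<in>K. b q' y'' - b q y'' \<le> (1 - t) * (b q' y - b q y) + t * (b q' y' - b q y'))"
      if q: "q \<in> Q" and y: "y \<in> ?Y" "y' \<in> ?Y" and t: "0 \<le> t" "t \<le> 1" for q y y' and t :: real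
    proof -
      have qK: "q \<in> K" using q QK by blast
      have "(1 - t) *\<^sub>R gX F (g q) y + t *\<^sub>R gX F (g q) y' \<in> gX F (g q) ` ?Y"
        by (rule convexD[OF convex_gX_image_closure[OF gK(1)[OF qK]] imageI[OF y(1)] imageI[OF y(2)]]) (use t in auto)
      then obtain z where z: "z \<in> ?Y" "gX F (g q) z = (1 - t) *\<^sub>R gX F (g q) y + t *\<^sub>R gX F (g q) y'" by force
      have "P q z = (1 - t) *\<^sub>R P q y + t *\<^sub>R P q y'"
        by (rule vec_eq_inner) (simp add: inner_add_left P_inner[OF qK] z(2) inner_diff_left algebra_simps)
      moreover have "b q' z - b q z \<le> (1 - t) * (b q' y - b q y) + t * (b q' y' - b q y')" if q': "q' \<in> K" for q'
        using dual_convex[OF y z(1) gK(1)[OF qK] gK(1)[OF q'] t z(2)] by (simp add: b_def algebra_simps)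
      ultimately show ?thesis using z(1) by blast
    qed
    show "b q yt = 0" for q by (simp add: b_def)
    show "\<exists>r>0. \<forall>q\<in>N. \<forall>y\<in>?Y. norm (y - yt) \<le> r \<longrightarrow> norm (P q y - (y - yt)) \<le> \<eta> * norm (y - yt)"
      if N: "compact N" "N \<subseteq> Q" and \<eta>: "0 < \<eta>" for N and \<eta> :: real
    proof -
      have NK: "N \<subseteq> K" using N(2) QK by blast
      have "compact (g ` N)" by (rule compact_continuous_image[OF continuous_on_subset[OF gcont NK] N(1)])
      then have "compact (g ` N \<times> {yt})" by (intro compact_Times) auto
      moreover have "g ` N \<times> {yt} \<subseteq> W" using zW NK ytY by auto
      ultimately obtain e where e: "e > 0" "(\<Union>z\<in>g ` N \<times> {yt}. ball z e) \<subseteq> W"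
        using compact_subset_open_imp_ball_epsilon_subset W(1) by blast
      define r0 where "r0 = e / 2"
      have inW0: "(g q, y) \<in> W" if "q \<in> N" "y \<in> cball yt r0" for q y
      proof -
        have "dist (g q, yt) (g q, y) = dist yt y" by (simp add: dist_Pair_Pair)
        then have "(g q, y) \<in> ball (g q, yt) e" using that(2) e(1) by (simp add: r0_def)
        then show ?thesis using e(2) that(1) by blast
      qed
      define S where "S = N \<times> cball yt r0"
      define X where "X = S \<times> sphere (0 :: real^'n) 1"
      have Xc: "compact X" unfolding X_def S_def using N(1) by (intro compact_Times) auto
      have cT: "continuous_on X (\<lambda>z. T (fst (fst z)) (snd (fst z)) w)" for w
      proof -
        have "continuous_on S (\<lambda>z. T (fst z) (snd z) w)"
          by (rule Tcont) (use NK inW0 in \<open>auto simp: S_def\<close>)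
        then show ?thesis
          by (rule continuous_on_compose2[OF _ continuous_on_fst[OF continuous_on_id]]) (auto simp: X_def)
      qed
      have lT: "linear (T (fst (fst z)) (snd (fst z)))" if "z \<in> X" for z
        using that inW0 by (intro linT) (auto simp: X_def S_def)
      have "continuous_on X (\<lambda>z. T (fst (fst z)) (snd (fst z)) (snd z))"
        using continuous_linear_family[of X "\<lambda>z. T (fst (fst z)) (snd (fst z))" snd, OF lT cT continuous_on_snd[OF continuous_on_id]] .
      then have "continuous_on X (\<lambda>z. T (fst (fst z)) (snd (fst z)) (snd z) - snd z)"
        by (intro continuous_on_diff continuous_on_snd continuous_on_id)
      then have "uniformly_continuous_on X (\<lambda>z. T (fst (fst z)) (snd (fst z)) (snd z) - snd z)"
        using Xc by (rule compact_uniformly_continuous)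
      then obtain d where d: "d > 0" "\<And>z z'. z \<in> X \<Longrightarrow> z' \<in> X \<Longrightarrow> dist z' z < d \<Longrightarrow>
        dist (T (fst (fst z')) (snd (fst z')) (snd z') - snd z') (T (fst (fst z)) (snd (fst z)) (snd z) - snd z) < \<eta>"
        using \<eta> unfolding uniformly_continuous_on_def by metis
      define r where "r = min r0 (d / 2)"
      have r: "0 < r" "r \<le> r0" "r < d" using e(1) d(1) by (auto simp: r_def r0_def)
      have T_near: "norm (T q y w - w) \<le> \<eta> * norm w" if q: "q \<in> N" and y: "y \<in> cball yt r" for q y w
      proof (cases "w = 0")
        case True
        have "(g q, y) \<in> W" using inW0[OF q] y r by auto
        then show ?thesis using True linear_0[OF linT] by simp
      next
        case False
        define w' where "w' = (1 / norm w) *\<^sub>R w"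
        have w': "norm w' = 1" "w = norm w *\<^sub>R w'" using False by (simp_all add: w'_def)
        have yr: "y \<in> cball yt r0" "yt \<in> cball yt r0" using y r by auto
        have "dist ((q, y), w') ((q, yt), w') < d" using y r by (simp add: dist_Pair_Pair dist_commute)
        moreover have "((q, y), w') \<in> X" "((q, yt), w') \<in> X" using q yr w' by (auto simp: X_def S_def)
        ultimately have "dist (T q y w' - w') (T q yt w' - w') < \<eta>" using d(2)[of "((q, yt), w')" "((q, y), w')"] by simp
        moreover have "T q yt w' = w'" using T_id q NK by blast
        ultimately have "norm (T q y w' - w') < \<eta>" by (simp add: dist_norm)
        moreover have "T q y w - w = norm w *\<^sub>R (T q y w' - w')"
          using linear_cmul[OF linT[OF inW0[OF q yr(1)]], of "norm w" w'] w'(2) by (simp add: scaleR_diff_right)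
        ultimately show ?thesis
          using mult_left_mono[of "norm (T q y w' - w')" \<eta> "norm w"] by (simp add: mult.commute)
      qed
      have "norm (P q y - (y - yt)) \<le> \<eta> * norm (y - yt)" if q: "q \<in> N" and y: "norm (y - yt) \<le> r" for q y
      proof -
        have "norm ((P q y - y) - (P q yt - yt)) \<le> \<eta> * norm (y - yt)"
        proof (rule differentiable_bound[of "cball yt r" "\<lambda>y. P q y - y" "\<lambda>y w. T q y w - w"])
          show "convex (cball yt r)" by simp
          fix y' assume y': "y' \<in> cball yt r"
          have "(g q, y') \<in> W" using inW0[OF q] y' r by auto
          then have "((\<lambda>y. P q y - y) has_derivative (\<lambda>w. T q y' w - w)) (at y')"
            by (intro has_derivative_diff dP has_derivative_ident)
          then show "((\<lambda>y. P q y - y) has_derivative (\<lambda>w. T q y' w - w)) (at y' within cball yt r)"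
            by (rule has_derivative_at_withinI)
          show "onorm (\<lambda>w. T q y' w - w) \<le> \<eta>"
            by (rule onorm_le) (rule T_near[OF q y'])
        qed (use y r in \<open>auto simp: dist_norm norm_minus_commute\<close>)
        then show ?thesis using P0 by (simp add: algebra_simps)
      qed
      then show ?thesis using r(1) by blast
    qed
    show "\<exists>B\<ge>0. \<forall>A. compact A \<longrightarrow> A \<subseteq> ?Y \<longrightarrow> measure lebesgue (P q ` A) \<le> B * measure lebesgue A"
      if q: "q \<in> Q" for q
    proof -
      have qK: "q \<in> K" using q QK by blast
      have cT: "continuous_on ?Y (\<lambda>y. T q y w)" for w
      proof -
        have "continuous_on ({q} \<times> ?Y) (\<lambda>z. T (fst z) (snd z) w)" by (rule Tcont) (use qK zW in auto)
        moreover have "continuous_on ?Y (\<lambda>y. (q, y))" by (intro continuous_intros)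
        ultimately have "continuous_on ?Y (\<lambda>y. T (fst (q, y)) (snd (q, y)) w)"
          by (rule continuous_on_compose2) auto
        then show ?thesis by simp
      qed
      obtain B where B: "B > 0" "\<forall>y\<in>?Y. \<forall>w. norm (T q y w) \<le> B * norm w"
        using linear_family_bound[of ?Y "T q", OF Yc linT[OF zW[OF qK]] cT] by blast
      have "measure lebesgue (P q ` A) \<le> fact CARD('n) * B ^ CARD('n) * measure lebesgue A"
        if A: "compact A" "A \<subseteq> ?Y" for A
      proof (rule measure_C1_image_le[where f = "P q" and f' = "T q", OF A(1)])
        show "(P q has_derivative T q y) (at y within A)" if "y \<in> A" for y
          by (rule has_derivative_at_withinI[OF dP[OF zW[OF qK subsetD[OF A(2) that]]]])
        show "continuous_on A (\<lambda>y. T q y w)" for w by (rule continuous_on_subset[OF cT A(2)])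
        show "norm (T q y w) \<le> B * norm w" if "y \<in> A" for y w using B(2) that A(2) by blast
      qed
      then show ?thesis using B(1) by (intro exI[of _ "fact CARD('n) * B ^ CARD('n)"]) simp
    qed
    show "\<exists>B\<ge>0. \<forall>q\<in>N. \<forall>A. compact A \<longrightarrow> A \<subseteq> ?Y \<longrightarrow> measure lebesgue A \<le> B * measure lebesgue (P q ` A)"
      if N: "compact N" "N \<subseteq> Q" for N
    proof -
      have NK: "N \<subseteq> K" using N(2) QK by blast
      have Sc: "compact (N \<times> ?Y)" using N(1) Yc by (rule compact_Times)
      have cT: "continuous_on (N \<times> ?Y) (\<lambda>z. T (fst z) (snd z) w)" for w
        by (rule Tcont) (use NK zW in auto)
      have lT: "linear (T (fst z) (snd z))" if "z \<in> N \<times> ?Y" for z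
      proof (rule linT[OF zW])
        show "fst z \<in> K" "snd z \<in> ?Y" using that(1) NK by auto
      qed
      have nz: "w = 0" if "z \<in> N \<times> ?Y" "T (fst z) (snd z) w = 0" for z w
      proof (rule T_inj[OF _ _ that(2)])
        show "fst z \<in> K" "snd z \<in> ?Y" using that(1) NK by auto
      qed
      have "\<exists>c>0. \<forall>z\<in>N \<times> ?Y. \<forall>w. c * norm w \<le> norm (T (fst z) (snd z) w)"
      proof (rule unit_sphere_lower_bound[of "N \<times> ?Y" "\<lambda>z. T (fst z) (snd z)"])
        show "w = 0" if "z \<in> N \<times> ?Y" "T (fst z) (snd z) w = 0" for z w by (rule nz[OF that])
      qed (rule Sc, rule lT, assumption, rule cT)
      then obtain c where c: "c > 0" "\<And>q y w. q \<in> N \<Longrightarrow> y \<in> ?Y \<Longrightarrow> c * norm w \<le> norm (T q y w)"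
        by (elim exE conjE) (rule that, assumption, force)
      have "measure lebesgue A \<le> fact CARD('n) * (1 / c) ^ CARD('n) * measure lebesgue (P q ` A)"
        if q: "q \<in> N" and A: "compact A" "A \<subseteq> ?Y" for q A
      proof -
        have qK: "q \<in> K" using q NK by blast
        note x = gK(1)[OF qK]
        obtain k k' where k: "\<forall>y\<in>?Y. k (gX F (g q) y) = y"
          "\<forall>y\<in>?Y. (k has_derivative k' (gX F (g q) y)) (at (gX F (g q) y))"
          "\<forall>y\<in>?Y. \<forall>v. hYX (g q) y (k' (gX F (g q) y) v) = v"
          "\<forall>v. continuous_on (gX F (g q) ` ?Y) (\<lambda>p. k' p v)"
          using invY_deriv[OF x] by blast
        \<comment> \<open>\<open>J\<close> undoes the adjoint of \<open>g' q\<close>. So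
          \<open>J p + a\<close> recovers \<open>gX F (g q) y\<close> from \<open>p = P q y\<close>,
          and \<open>k\<close> recovers \<open>y\<close>: the composition inverts \<open>P q\<close>
          on \<open>closure V\<close>, and its derivative is bounded by 1/c.\<close>
        define J where "J = adj_sum (hXY F (g q) yt)"
        have linJ: "linear J" unfolding J_def by (rule linear_adj_sum)
        have J_inner: "J p \<bullet> w = p \<bullet> hXY F (g q) yt w" for p w
          unfolding J_def by (rule adj_sum_inner[OF lin\<phi>[OF x]])
        define a where "a = gX F (g q) yt"
        have JP: "J (P q y) + a = gX F (g q) y" for y
        proof -
          have "J (P q y) = gX F (g q) y - a"
            by (rule vec_eq_inner) (simp add: J_inner P_inner[OF qK] inv[OF qK] a_def)
          then show ?thesis by simp
        qed
        have "A = (\<lambda>p. k (J p + a)) ` (P q ` A)"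
          using k(1) A(2) by (auto simp: image_image JP subset_iff image_iff)
        then have "measure lebesgue A = measure lebesgue ((\<lambda>p. k (J p + a)) ` (P q ` A))" by simp
        also have "\<dots> \<le> fact CARD('n) * (1 / c) ^ CARD('n) * measure lebesgue (P q ` A)"
        proof (rule measure_C1_image_le[where f = "\<lambda>p. k (J p + a)" and f' = "\<lambda>p v. k' (J p + a) (J v)"])
          have "isCont (P q) y" if "y \<in> A" for y
            by (rule has_derivative_continuous[OF dP[OF zW[OF qK subsetD[OF A(2) that]]]])
          then have "continuous_on A (P q)" by (intro continuous_at_imp_continuous_on ballI)
          then show "compact (P q ` A)" using A(1) by (rule compact_continuous_image)
          fix p assume "p \<in> P q ` A"
          then obtain y where y: "y \<in> A" "p = P q y" by blast
          have yY: "y \<in> ?Y" using y A by blast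
          have Jd: "((\<lambda>p. J p + a) has_derivative (\<lambda>v. J v + 0)) (at p)"
            by (intro has_derivative_add bounded_linear_imp_has_derivative has_derivative_const linJ[unfolded linear_conv_bounded_linear])
          have "(k has_derivative k' (J p + a)) (at (J p + a))" using k(2) yY by (simp add: y(2) JP)
          from diff_chain_at[OF Jd this]
          have "((\<lambda>p. k (J p + a)) has_derivative (\<lambda>v. k' (J p + a) (J v))) (at p)" by (simp add: comp_def)
          then show "((\<lambda>p. k (J p + a)) has_derivative (\<lambda>v. k' (J p + a) (J v))) (at p within P q ` A)"
            by (rule has_derivative_at_withinI)
          fix w
          have "hYX (g q) y (k' (J p + a) (J w)) = J w" using k(3) yY by (simp add: y(2) JP)
          then have "T q y (k' (J p + a) (J w)) = w"
            by - (rule vec_eq_inner, simp add: T_inner[OF qK] J_inner inv'[OF qK])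
          then have "c * norm (k' (J p + a) (J w)) \<le> norm w"
            using c(2)[OF q yY, of "k' (J p + a) (J w)"] by simp
          then show "norm (k' (J p + a) (J w)) \<le> 1 / c * norm w" using c(1) by (simp add: field_simps)
        next
          fix w
          have c1: "continuous_on (P q ` A) (\<lambda>p. J p + a)"
            by (intro continuous_on_add linear_continuous_on continuous_on_const linJ[unfolded linear_conv_bounded_linear])
          have "(\<lambda>p. J p + a) ` P q ` A \<subseteq> gX F (g q) ` ?Y"
            unfolding image_image JP using A(2) by (rule image_mono)
          from continuous_on_compose2[OF k(4)[rule_format, of "J w"] c1 this]
          show "continuous_on (P q ` A) (\<lambda>p. k' (J p + a) (J w))" .
        qed
        finally show ?thesis .
      qed
      then show ?thesis using c(1) by (intro exI[of _ "fact CARD('n) * (1 / c) ^ CARD('n)"]) simp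
    qed
    show "continuous_on K v"
      unfolding v_def by (rule continuous_on_compose2[OF hcont gcont]) (use gK in auto)
    show "contacts K ?Y b v q \<noteq> {}" if "q \<in> Q" for q
      using con[of q] ne[OF gQ[OF that]] that QK by auto
    show "0 \<le> v q" if "q \<in> K" for q unfolding v_def by (rule h0[OF gK(1)[OF that]])
    show "\<phi> xt \<in> Q" using xt by (simp add: Q_def)
    show "v (\<phi> xt) = 0" using g[OF UC[OF xt]] hxt by (simp add: v_def)
    show "\<exists>\<epsilon>>0. {q \<in> K. v q \<le> \<epsilon>} \<subseteq> Q"
    proof -
      \<comment> \<open>Here it enters that the contact set avoids the boundary: \<open>h\<close>
        does not vanish on the compact set \<open>closure U - U\<close>, so it has a positive
        minimum there.\<close>
      have "\<exists>m>0. \<forall>x\<in>?C - U. m \<le> h x"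
      proof (cases "?C - U = {}")
        case True
        then show ?thesis by (intro exI[of _ 1]) auto
      next
        case False
        have "compact (?C - U)" using Cc U(1) by (rule compact_diff)
        from continuous_attains_inf[OF this False continuous_on_subset[OF hcont]]
        obtain x0 where x0: "x0 \<in> ?C - U" "\<And>x. x \<in> ?C - U \<Longrightarrow> h x0 \<le> h x" by auto
        have "h x0 \<noteq> 0" using inner[OF x0(1)] by (simp add: h_def \<kappa>_def)
        then have "h x0 > 0" using h0[of x0] x0(1) by simp
        with x0(2) show ?thesis by blast
      qed
      then obtain m where m: "m > 0" "\<And>x. x \<in> ?C - U \<Longrightarrow> m \<le> h x" by blast
      have "{q \<in> K. v q \<le> m / 2} \<subseteq> Q"
      proof safe
        fix q assume q: "q \<in> K" "v q \<le> m / 2"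
        have "g q \<in> U"
        proof (rule ccontr)
          assume "g q \<notin> U"
          then have "m \<le> v q" unfolding v_def using m(2) gK(1)[OF q(1)] by blast
          then show False using q(2) m(1) by linarith
        qed
        then show "q \<in> Q" unfolding Q_def using gK(2)[OF q(1)] by force
      qed
      then show ?thesis using m(1) by (intro exI[of _ "m / 2"]) simp
    qed
    show "\<exists>B\<ge>0. \<forall>Z. compact Z \<longrightarrow> Z \<subseteq> Q \<longrightarrow>
      measure lebesgue (\<Union>q\<in>Z. contacts K ?Y b v q) \<le> B * measure lebesgue Z"
    proof -
      define c where "c = fact CARD('n) * Bg ^ CARD('n)"
      have "measure lebesgue (\<Union>q\<in>Z. contacts K ?Y b v q) \<le> \<Lambda> * c * measure lebesgue Z"
        if Z: "compact Z" "Z \<subseteq> Q" for Z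
      proof -
        have ZK: "Z \<subseteq> K" using Z QK by blast
        have "compact (g ` Z)" by (rule compact_continuous_image[OF continuous_on_subset[OF gcont ZK] Z(1)])
        moreover have "g ` Z \<subseteq> U" using gQ Z(2) by blast
        ultimately have "measure lebesgue (\<Union>q\<in>Z. contacts K ?Y b v q) \<le> \<Lambda> * measure lebesgue (g ` Z)"
          unfolding conU[OF Z(2)] by (rule upper(2))
        also have "measure lebesgue (g ` Z) \<le> c * measure lebesgue Z"
          unfolding c_def
        proof (rule measure_C1_image_le[where f = g and f' = g', OF Z(1)])
          show "(g has_derivative g' q) (at q within Z)" if "q \<in> Z" for q
            by (rule has_derivative_at_withinI[OF dg[OF subsetD[OF ZK that]]])
          show "continuous_on Z (\<lambda>q. g' q w)" for w by (rule continuous_on_subset[OF g'cont ZK])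
          show "norm (g' q w) \<le> Bg * norm w" if "q \<in> Z" for q w using Bg(2) that ZK by blast
        qed
        then have "\<Lambda> * measure lebesgue (g ` Z) \<le> \<Lambda> * (c * measure lebesgue Z)" by (rule mult_left_mono[OF _ upper(1)])
        finally show ?thesis by (simp add: mult.assoc)
      qed
      moreover have "0 \<le> \<Lambda> * c" using upper(1) Bg(1) by (simp add: c_def)
      ultimately show ?thesis by blast
    qed
    show "\<exists>l>0. \<exists>r>0. \<forall>E. compact E \<longrightarrow> E \<subseteq> Q \<longrightarrow> E \<subseteq> cball (\<phi> xt) r \<longrightarrow>
      l * measure lebesgue E \<le> measure lebesgue (\<Union>q\<in>E. contacts K ?Y b v q)"
    proof -
      define c where "c = fact CARD('n) * B\<phi> ^ CARD('n)"
      have c: "c > 0" using B\<phi>(1) by (simp add: c_def)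
      have xtK: "\<phi> xt \<in> K" using UC[OF xt] by (simp add: K_def)
      have "isCont g (\<phi> xt)" using dg[OF xtK] by (rule has_derivative_continuous)
      from this[unfolded continuous_at_eps_delta, rule_format, OF lower(2)]
      obtain r where r: "r > 0" "\<And>q. dist q (\<phi> xt) < r \<Longrightarrow> dist (g q) (g (\<phi> xt)) < \<delta>" by auto
      have "l / c * measure lebesgue E \<le> measure lebesgue (\<Union>q\<in>E. contacts K ?Y b v q)"
        if E: "compact E" "E \<subseteq> Q" "E \<subseteq> cball (\<phi> xt) (r / 2)" for E
      proof -
        have EK: "E \<subseteq> K" using E QK by blast
        have gE: "compact (g ` E)" by (rule compact_continuous_image[OF continuous_on_subset[OF gcont EK] E(1)])
        have gC: "g ` E \<subseteq> ?C" using gK(1) EK by blast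
        have "g ` E \<subseteq> ball xt \<delta>"
        proof safe
          fix q assume "q \<in> E"
          then have "dist q (\<phi> xt) < r" using E(3) r(1) by (auto simp: dist_commute)
          from r(2)[OF this] show "g q \<in> ball xt \<delta>" using g[OF UC[OF xt]] by (simp add: dist_commute)
        qed
        from lower(3)[OF gE this]
        have "l * measure lebesgue (g ` E) \<le> measure lebesgue (\<Union>q\<in>E. contacts K ?Y b v q)"
          unfolding conU[OF E(2)] .
        moreover have "measure lebesgue E \<le> c * measure lebesgue (g ` E)"
        proof -
          have "measure lebesgue (\<phi> ` g ` E) \<le> c * measure lebesgue (g ` E)"
            unfolding c_def
          proof (rule measure_C1_image_le[where f = \<phi> and f' = "\<lambda>x. hXY F x yt", OF gE])
            show "(\<phi> has_derivative hXY F x yt) (at x within g ` E)" if "x \<in> g ` E" for x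
            proof -
              have "x \<in> ?C" using that gC by blast
              from gY_has_derivative[OF W(1) C2 inW[OF this ytY]]
              show ?thesis unfolding \<phi>_def by (rule has_derivative_at_withinI)
            qed
            show "continuous_on (g ` E) (\<lambda>x. hXY F x yt w)" for w by (rule continuous_on_subset[OF cont\<phi>' gC])
            show "norm (hXY F x yt w) \<le> B\<phi> * norm w" if "x \<in> g ` E" for x w using B\<phi>(2) that gC by blast
          qed
          moreover have "\<phi> ` g ` E = E" using gK(2) EK by (force simp: image_image)
          ultimately show ?thesis by simp
        qed
        then have "l / c * measure lebesgue E \<le> l / c * (c * measure lebesgue (g ` E))"
          using lower(1) c by (intro mult_left_mono) auto
        then have "l / c * measure lebesgue E \<le> l * measure lebesgue (g ` E)" using c by simp
        ultimately show ?thesis by linarith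
      qed
      then show ?thesis using lower(1) c r(1) by (intro exI[of _ "l / c"] conjI exI[of _ "r / 2"]) auto
    qed
  qed
  from contact_geometry.zero_set_singleton[OF geo]
  have zero: "{q \<in> K. v q = 0} = {\<phi> xt}" .
  have uniq: "x = xt" if x: "x \<in> ?C" "h x = 0" for x
  proof -
    have "\<phi> x \<in> K" unfolding K_def using x(1) by (rule imageI)
    moreover have "v (\<phi> x) = 0" unfolding v_def g[OF x(1)] by (rule x(2))
    ultimately have "\<phi> x \<in> {q \<in> K. v q = 0}" by (intro CollectI conjI)
    then have "\<phi> x = \<phi> xt" unfolding zero by (rule singletonD)
    then have "g (\<phi> x) = g (\<phi> xt)" by (rule arg_cong)
    then show ?thesis unfolding g[OF x(1)] g[OF UC[OF xt]] .
  qed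
  have iff: "u x - F (x, yt) = u xt - F (xt, yt) \<longleftrightarrow> h x = 0" for x
    unfolding h_def \<kappa>_def by linarith
  show ?thesis
    unfolding iff using uniq UC[OF xt] hxt by blast
qed

section \<open>c-convex functions\<close>

text \<open>As \<open>u x\<close> and \<open>c x y\<close> are finite, the equation forces
  \<open>cstar U c u y\<close> to be the finite value taken at \<open>x\<close>, that is, the
  supremum is attained there.\<close>

lemma csubdiff_iff:
  "(x, y) \<in> csubdiff U V c u \<longleftrightarrow>
    x \<in> closure U \<and> y \<in> closure V \<and> (\<forall>x'\<in>closure U. u x - c x' y + c x y \<le> u x')"
proof (cases "x \<in> closure U")
  case x: True
  have eq: "ereal (u x) + s + ereal (c x y) = 0 \<longleftrightarrow> s = ereal (- c x y - u x)" for s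
    by (cases s) auto
  have "cstar U c u y = ereal (- c x y - u x) \<longleftrightarrow> (\<forall>x'\<in>closure U. ereal (- c x' y - u x') \<le> ereal (- c x y - u x))"
  proof
    assume le: "cstar U c u y = ereal (- c x y - u x)"
    show "\<forall>x'\<in>closure U. ereal (- c x' y - u x') \<le> ereal (- c x y - u x)"
      unfolding le[symmetric] cstar_def by (intro ballI SUP_upper)
  next
    assume le: "\<forall>x'\<in>closure U. ereal (- c x' y - u x') \<le> ereal (- c x y - u x)"
    show "cstar U c u y = ereal (- c x y - u x)"
      unfolding cstar_def
    proof (rule antisym)
      show "(SUP x\<in>closure U. ereal (- c x y - u x)) \<le> ereal (- c x y - u x)"
        by (rule SUP_least) (rule bspec[OF le])
      show "ereal (- c x y - u x) \<le> (SUP x\<in>closure U. ereal (- c x y - u x))"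
        by (rule SUP_upper[OF x])
    qed
  qed
  moreover have "ereal (- c x' y - u x') \<le> ereal (- c x y - u x) \<longleftrightarrow> u x - c x' y + c x y \<le> u x'" for x'
    unfolding ereal_less_eq by linarith
  ultimately show ?thesis unfolding csubdiff_def mem_Collect_eq case_prod_conv eq by (simp only:)
qed (simp add: csubdiff_def)

lemma csubdiff_img_eq_contacts:
  assumes "X \<subseteq> closure U"
  shows "csubdiff_img U V c u X = (\<Union>x\<in>X. contacts (closure U) (closure V) (\<lambda>x y. - c x y) u x)"
  using assms unfolding csubdiff_img_def csubdiff_iff contacts_def by auto

text \<open>\<open>u\<close> is a supremum of functions -c(.,y) plus constants, which share the
  modulus of continuity of \<open>c\<close> on a compact set.\<close>

lemma c_convex_continuous:
  assumes C: "compact (closure U)" and Y: "compact (closure V)"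
    and c: "continuous_on (closure U \<times> closure V) (\<lambda>p. c (fst p) (snd p))"
    and u: "c_convex U V c u"
  shows "continuous_on (closure U) u"
proof -
  have "uniformly_continuous_on (closure U \<times> closure V) (\<lambda>p. c (fst p) (snd p))"
    using c compact_Times[OF C Y] by (rule compact_uniformly_continuous)
  note uc = this[unfolded uniformly_continuous_on_def, rule_format]
  have "\<exists>d>0. \<forall>x'\<in>closure U. dist x' x < d \<longrightarrow> dist (u x') (u x) < e" if x: "x \<in> closure U" and e: "e > 0" for x e
  proof -
    from e have e2: "e / 2 > 0" by simp
    obtain d where d: "d > 0" "\<And>p p'. p \<in> closure U \<times> closure V \<Longrightarrow> p' \<in> closure U \<times> closure V \<Longrightarrow> dist p' p < d \<Longrightarrow>
      dist (c (fst p') (snd p')) (c (fst p) (snd p)) < e / 2" using uc[OF e2] by blast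
    have le: "u a \<le> u b + e / 2" if a: "a \<in> closure U" and b: "b \<in> closure U" and ab: "dist a b < d" for a b
    proof -
      have "ereal (- c a y) - cstar U c u y \<le> ereal (u b + e / 2)" if y: "y \<in> closure V" for y
      proof -
        have "dist (a, y) (b, y) < d" using ab by (simp add: dist_Pair_Pair)
        then have "\<bar>c a y - c b y\<bar> < e / 2"
          using d(2)[of "(b, y)" "(a, y)"] a b y by (simp add: dist_real_def)
        then have cc: "- c a y \<le> - c b y + e / 2" by linarith
        have "ereal (- c b y) - cstar U c u y \<le> ctrans V c (cstar U c u) b"
          unfolding ctrans_def by (rule SUP_upper[OF y])
        also have "\<dots> = ereal (u b)" using u b by (simp add: c_convex_def)
        finally show ?thesis using cc by (cases "cstar U c u y") auto
      qed
      then have "ctrans V c (cstar U c u) a \<le> ereal (u b + e / 2)"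
        unfolding ctrans_def by (rule SUP_least)
      moreover have "ereal (u a) = ctrans V c (cstar U c u) a" using u a unfolding c_convex_def by blast
      ultimately have "ereal (u a) \<le> ereal (u b + e / 2)" by (simp only:)
      then show ?thesis by (simp only: ereal_less_eq)
    qed
    have "dist (u x') (u x) < e" if x': "x' \<in> closure U" "dist x' x < d" for x'
    proof -
      have "u x' \<le> u x + e / 2" "u x \<le> u x' + e / 2"
        using le[OF x'(1) x x'(2)] le[OF x x'(1)] x'(2) by (simp_all add: dist_commute)
      then show ?thesis using e unfolding dist_real_def by linarith
    qed
    with d(1) show ?thesis by blast
  qed
  then show ?thesis unfolding continuous_on_iff by blast
qed

text \<open>The supremum defining \<open>u x\<close> is approached by points \<open>y\<close> whose
  support inequality fails by at most 1/(n+1). In the limit along a convergent subsequence the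
  defect vanishes; only continuity of \<open>c\<close> enters, none of \<open>cstar\<close>.\<close>

lemma c_convex_contacts_nonempty:
  assumes Y: "compact (closure V)"
    and c: "continuous_on (closure U \<times> closure V) (\<lambda>p. c (fst p) (snd p))"
    and u: "c_convex U V c u" and x: "x \<in> closure U"
  shows "contacts (closure U) (closure V) (\<lambda>x y. - c x y) u x \<noteq> {}"
proof -
  have ux: "ereal (u x) = (SUP y\<in>closure V. ereal (- c x y) - cstar U c u y)"
    using u x by (simp add: c_convex_def ctrans_def)
  have "\<exists>y. y \<in> closure V \<and> (\<forall>x'\<in>closure U. - c x' y - u x' \<le> - c x y - u x + inverse (real (Suc n)))" for n
  proof -
    have "ereal (u x - inverse (real (Suc n))) < (SUP y\<in>closure V. ereal (- c x y) - cstar U c u y)"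
      unfolding ux[symmetric] by simp
    then obtain y where y: "y \<in> closure V" "ereal (u x - inverse (real (Suc n))) < ereal (- c x y) - cstar U c u y"
      unfolding less_SUP_iff by blast
    have "- c x' y - u x' \<le> - c x y - u x + inverse (real (Suc n))" if x': "x' \<in> closure U" for x'
    proof -
      have "ereal (- c x' y - u x') \<le> cstar U c u y" unfolding cstar_def by (rule SUP_upper[OF x'])
      then show ?thesis using y(2) by (cases "cstar U c u y") auto
    qed
    with y(1) show ?thesis by blast
  qed
  then have "\<forall>n. \<exists>y. y \<in> closure V \<and> (\<forall>x'\<in>closure U. - c x' y - u x' \<le> - c x y - u x + inverse (real (Suc n)))" by blast
  from choice[OF this] obtain g where g: "\<And>n. g n \<in> closure V"
    "\<And>n x'. x' \<in> closure U \<Longrightarrow> - c x' (g n) - u x' \<le> - c x (g n) - u x + inverse (real (Suc n))" by blast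
  obtain y r where y: "y \<in> closure V" "strict_mono r" "(g \<circ> r) \<longlonglongrightarrow> y"
    using compact_convergent_subsequence[of "closure V" g, OF Y g(1)] by blast
  have lim: "(\<lambda>n. c a (g (r n))) \<longlonglongrightarrow> c a y" if a: "a \<in> closure U" for a
  proof -
    have "(\<lambda>n. (a, g (r n))) \<longlonglongrightarrow> (a, y)" using y(3) by (intro tendsto_Pair tendsto_const) (simp add: comp_def)
    from continuous_on_tendsto_compose[OF c this] show ?thesis using a y(1) g(1) by simp
  qed
  have lim0: "(\<lambda>n. inverse (real (Suc (r n)))) \<longlonglongrightarrow> 0"
    using LIMSEQ_subseq_LIMSEQ[OF LIMSEQ_inverse_real_of_nat y(2)] by (simp add: comp_def)
  have "u x + - c x' y - - c x y \<le> u x'" if x': "x' \<in> closure U" for x'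
  proof -
    have "- c x' y - u x' \<le> - c x y - u x + 0"
    proof (rule LIMSEQ_le)
      show "(\<lambda>n. - c x' (g (r n)) - u x') \<longlonglongrightarrow> - c x' y - u x'" by (intro tendsto_intros lim x')
      show "(\<lambda>n. - c x (g (r n)) - u x + inverse (real (Suc (r n)))) \<longlonglongrightarrow> - c x y - u x + 0"
        by (intro tendsto_add tendsto_diff tendsto_minus tendsto_const lim x lim0)
      show "\<exists>N. \<forall>n\<ge>N. - c x' (g (r n)) - u x' \<le> - c x (g (r n)) - u x + inverse (real (Suc (r n)))"
        using g(2)[OF x'] by blast
    qed
    then show ?thesis by simp
  qed
  with y(1) show ?thesis unfolding contacts_def by blast
qed

lemma cost_of_B:
  fixes U V :: "(real^'n) set" and c :: "real^'n \<Rightarrow> real^'n \<Rightarrow> real"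
  assumes U: "open U" "bounded U" "U \<noteq> {}" and V: "open V" "bounded V" "closure V \<noteq> {}"
    and Ck: "Ck_near 4 (closure U \<times> closure V) (\<lambda>p. c (fst p) (snd p))"
    and B: "B1 U V c" "B2 U V c" "B3 U V c"
  shows "\<exists>W. cost U V W (\<lambda>p. - c (fst p) (snd p))"
proof -
  define F where "F = (\<lambda>p. - c (fst p) (snd p))"
  obtain W where W: "open W" "closure U \<times> closure V \<subseteq> W" "Ck_on 4 W (\<lambda>p. c (fst p) (snd p))"
    using Ck unfolding Ck_near_def by blast
  have CkF: "Ck_on 4 W F" using Ck_on_cmult[OF W(1,3), of "- 1"] by (simp add: F_def)
  have gX: "gX F x y = - gradx c x y" and gY: "gY F x y = - grady c x y" if "x \<in> closure U" "y \<in> closure V" for x y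
  proof -
    have "F differentiable (at (x, y))" using Ck_on_differentiable[OF CkF] W(2) that by auto
    then show "gX F x y = - gradx c x y" "gY F x y = - grady c x y"
      by (rule gX_eq_gradx[OF F_def], rule gY_eq_grady[OF F_def])
  qed
  \<comment> \<open>(B1) and (B2) quantify over both base points at once, so either half can be used
    only with a point of the other set at hand.\<close>
  obtain x0 where x0: "x0 \<in> closure U" using U(3) closure_subset by blast
  obtain y0 where y0: "y0 \<in> closure V" using V(3) unfolding ex_in_conv[symmetric] by (elim exE)
  have pre: "cost_pre U V W F"
  proof
    show "open U" "bounded U" "open V" "bounded V" "open W" "closure U \<times> closure V \<subseteq> W" "Ck_on 4 W F"
      by (rule U V W CkF)+
    show "\<exists>g T. open T \<and> (\<lambda>x. gY F x y) ` closure U \<subseteq> T \<and> Ck_on 1 T g \<and> (\<forall>x\<in>closure U. g (gY F x y) = x)"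
      if y: "y \<in> closure V" for y
    proof -
      have im: "(\<lambda>x. gY F x y) ` closure U = (\<lambda>x. - grady c x y) ` closure U"
        using gY[OF _ y] by (rule image_cong[OF refl])
      have "diffeo_onto_range (closure U) (\<lambda>x. - grady c x y)" using B(1) x0 y unfolding B1_def by blast
      then obtain g where g: "Ck_near 1 ((\<lambda>x. - grady c x y) ` closure U) g" "\<forall>x\<in>closure U. g (- grady c x y) = x"
        unfolding diffeo_onto_range_def by blast
      obtain T where T: "open T" "(\<lambda>x. - grady c x y) ` closure U \<subseteq> T" "Ck_on 1 T g"
        using g(1) unfolding Ck_near_def by blast
      have "\<forall>x\<in>closure U. g (gY F x y) = x" using g(2) gY[OF _ y] by simp
      with T show ?thesis unfolding im by blast
    qed
    show "\<exists>g T. open T \<and> (\<lambda>y. gX F x y) ` closure V \<subseteq> T \<and> Ck_on 1 T g \<and> (\<forall>y\<in>closure V. g (gX F x y) = y)"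
      if x: "x \<in> closure U" for x
    proof -
      have im: "(\<lambda>y. gX F x y) ` closure V = (\<lambda>y. - gradx c x y) ` closure V"
        using gX[OF x] by (rule image_cong[OF refl])
      have "diffeo_onto_range (closure V) (\<lambda>y. - gradx c x y)" using B(1) x y0 unfolding B1_def by blast
      then obtain g where g: "Ck_near 1 ((\<lambda>y. - gradx c x y) ` closure V) g" "\<forall>y\<in>closure V. g (- gradx c x y) = y"
        unfolding diffeo_onto_range_def by blast
      obtain T where T: "open T" "(\<lambda>y. - gradx c x y) ` closure V \<subseteq> T" "Ck_on 1 T g"
        using g(1) unfolding Ck_near_def by blast
      have "\<forall>y\<in>closure V. g (gX F x y) = y" using g(2) gX[OF x] by simp
      with T show ?thesis unfolding im by blast
    qed
    show "convex ((\<lambda>x. gY F x y) ` U)" if y: "y \<in> closure V" for y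
    proof -
      have "(\<lambda>x. gY F x y) ` U = (\<lambda>x. - grady c x y) ` U"
        by (rule image_cong[OF refl]) (rule gY[OF subsetD[OF closure_subset] y])
      moreover have "convex ((\<lambda>x. - grady c x y) ` U)" using B(2) x0 y unfolding B2_def by blast
      ultimately show ?thesis by simp
    qed
    show "convex ((\<lambda>y. gX F x y) ` V)" if x: "x \<in> closure U" for x
    proof -
      have "(\<lambda>y. gX F x y) ` V = (\<lambda>y. - gradx c x y) ` V"
        by (rule image_cong[OF refl]) (rule gX[OF x subsetD[OF closure_subset]])
      moreover have "convex ((\<lambda>y. - gradx c x y) ` V)" using B(2) x y0 unfolding B2_def by blast
      ultimately show ?thesis by simp
    qed
  qed
  have "cost U V W F"
    by (rule cost.intro[OF pre cost_axioms.intro]) (rule cross_of_B3[OF pre F_def B(3)])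
  then show ?thesis unfolding F_def by blast
qed

theorem theorem8p1:
  fixes U V Ulam :: "(real^'n) set" and c :: "real^'n \<Rightarrow> real^'n \<Rightarrow> real"
    and u :: "real^'n \<Rightarrow> real" and lam Lam :: real and xt yt :: "real^'n"
  assumes "open U" "bounded U" "open V" "bounded V"
    and "Ck_near 4 (closure U \<times> closure V) (\<lambda>p. c (fst p) (snd p))"
    and "B1 U V c" "B2 U V c" "B3 U V c"
    and "lam > 0" "Lam > 0"
    and "open Ulam" "Ulam \<subseteq> U"
    and "c_convex U V c u"
    and "\<forall>X. X \<in> sets borel \<and> X \<subseteq> Ulam \<longrightarrow>
           ennreal lam * emeasure lebesgue X \<le> cMA U V c u X \<and>
           cMA U V c u X \<le> ennreal (1 / lam) * emeasure lebesgue X"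
    and "\<forall>X. X \<in> sets borel \<and> X \<subseteq> closure U \<longrightarrow>
           cMA U V c u X \<le> ennreal Lam * emeasure lebesgue X"
    and "xt \<in> Ulam" "yt \<in> csubdiff_img U V c u {xt}"
    and "{x \<in> closure U. u x = u xt - c x yt + c xt yt} \<noteq> {xt}"
  shows "{x \<in> closure U. u x = u xt - c x yt + c xt yt} \<inter> frontier U \<noteq> {}"
proof
  assume disj: "{x \<in> closure U. u x = u xt - c x yt + c xt yt} \<inter> frontier U = {}"
  have lower: "ennreal lam * emeasure lebesgue X \<le> cMA U V c u X" if "compact X" "X \<subseteq> Ulam" for X
    using assms(14) borel_compact[OF that(1)] that(2) by blast
  have upper: "cMA U V c u X \<le> ennreal Lam * emeasure lebesgue X" if "compact X" "X \<subseteq> closure U" for X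
    using assms(15) borel_compact[OF that(1)] that(2) by blast
  let ?con = "contacts (closure U) (closure V) (\<lambda>x y. - c x y) u"
  have UC: "U \<subseteq> closure U" by (rule closure_subset)
  have xt: "xt \<in> U" using assms(12,16) by blast
  have Cc: "compact (closure U)" and Yc: "compact (closure V)" using assms(2,4) by auto
  have yt: "yt \<in> ?con xt"
    using assms(17) csubdiff_img_eq_contacts[of "{xt}" U V c u] xt UC by auto
  then have "closure V \<noteq> {}" by (auto simp: contacts_def)
  then obtain W where W: "cost U V W (\<lambda>p. - c (fst p) (snd p))"
    using cost_of_B[OF assms(1,2) _ assms(3,4) _ assms(5-8)] xt by blast
  have cc: "continuous_on (closure U \<times> closure V) (\<lambda>p. c (fst p) (snd p))"
    using assms(5) unfolding Ck_near_def by (meson Ck_on_continuous continuous_on_subset)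
  have fin: "emeasure lebesgue X = ennreal (measure lebesgue X)" if "compact X" for X :: "(real^'n) set"
    using fmeasurableD2[OF lmeasurable_compact[OF that]] by (simp add: emeasure_eq_ennreal_measure)
  have cMA_eq: "cMA U V c u X = emeasure lebesgue (\<Union>x\<in>X. ?con x)" if "X \<subseteq> closure U" for X
    unfolding cMA_def csubdiff_img_eq_contacts[OF that] ..
  \<comment> \<open>\<open>measure\<close> is 0 on sets of infinite measure. Finiteness, which
    follows from the upper bound, is therefore recorded as well; it is used to carry the lower bound
    over to real numbers.\<close>
  have up: "measure lebesgue (\<Union>x\<in>X. ?con x) \<le> Lam * measure lebesgue X" "emeasure lebesgue (\<Union>x\<in>X. ?con x) < \<infinity>"
    if X: "compact X" "X \<subseteq> closure U" for X
  proof -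
    have le: "emeasure lebesgue (\<Union>x\<in>X. ?con x) \<le> ennreal (Lam * measure lebesgue X)"
      using upper[OF X] assms(10) unfolding cMA_eq[OF X(2)] fin[OF X(1)] by (simp add: ennreal_mult)
    then show "emeasure lebesgue (\<Union>x\<in>X. ?con x) < \<infinity>" by (rule le_less_trans) simp
    have "enn2real (emeasure lebesgue (\<Union>x\<in>X. ?con x)) \<le> Lam * measure lebesgue X"
      by (rule enn2real_leI[OF _ le]) (use assms(10) in simp)
    then show "measure lebesgue (\<Union>x\<in>X. ?con x) \<le> Lam * measure lebesgue X" by (simp add: measure_def)
  qed
  obtain \<delta> where \<delta>: "\<delta> > 0" "ball xt \<delta> \<subseteq> Ulam" using assms(11,16) open_contains_ball by blast
  have low: "lam * measure lebesgue X \<le> measure lebesgue (\<Union>x\<in>X. ?con x)" if X: "compact X" "X \<subseteq> ball xt \<delta>" for X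
  proof -
    have XU: "X \<subseteq> Ulam" "X \<subseteq> closure U" using X(2) \<delta>(2) assms(12) UC by blast+
    have "ennreal (lam * measure lebesgue X) \<le> emeasure lebesgue (\<Union>x\<in>X. ?con x)"
      using lower[OF X(1) XU(1)] assms(9) unfolding cMA_eq[OF XU(2)] fin[OF X(1)] by (simp add: ennreal_mult)
    also have "\<dots> = ennreal (measure lebesgue (\<Union>x\<in>X. ?con x))"
      using up(2)[OF X(1) XU(2)] by (intro emeasure_eq_ennreal_measure) simp
    finally show ?thesis by (simp add: ennreal_le_iff)
  qed
  have inner: "u x - - c x yt \<noteq> u xt - - c xt yt" if x: "x \<in> closure U - U" for x
  proof
    assume "u x - - c x yt = u xt - - c xt yt"
    then have "u x = u xt - c x yt + c xt yt" by simp
    moreover have "x \<in> frontier U" using x assms(1) by (simp add: frontier_def interior_open)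
    ultimately show False using disj x by blast
  qed
  have "{x \<in> closure U. u x - - c x yt = u xt - - c xt yt} = {xt}"
  proof (rule contacts_singleton[OF W xt, unfolded fst_conv snd_conv])
    show "continuous_on (closure U) u" by (rule c_convex_continuous[OF Cc Yc cc assms(13)])
    show "yt \<in> ?con xt" by (rule yt)
    show "?con x \<noteq> {}" if "x \<in> U" for x
      using c_convex_contacts_nonempty[OF Yc cc assms(13)] that UC by blast
    show "0 \<le> Lam" using assms(10) by simp
    show "measure lebesgue (\<Union>x\<in>X. ?con x) \<le> Lam * measure lebesgue X" if "compact X" "X \<subseteq> U" for X
      using up(1)[OF that(1)] that(2) UC by blast
    show "0 < lam" "0 < \<delta>" by (rule assms(9) \<delta>(1))+
    show "lam * measure lebesgue X \<le> measure lebesgue (\<Union>x\<in>X. ?con x)" if "compact X" "X \<subseteq> ball xt \<delta>" for X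
      by (rule low[OF that])
    show "u x - - c x yt \<noteq> u xt - - c xt yt" if "x \<in> closure U - U" for x by (rule inner[OF that])
  qed
  moreover have "u x - - c x yt = u xt - - c xt yt \<longleftrightarrow> u x = u xt - c x yt + c xt yt" for x by linarith
  ultimately show False using assms(18) by simp
qed

end
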